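(* Let $u>0$ be real. Then for all real $t$, $$Z_{\mathbb Q}\!\left(-u,-\tfrac u2+it\right)=\theta(1)^{-u}\int_{-\infty}^{\infty}f(r)^u e^{-irt}\,dr,$$ where $$f(r)=\theta(1)\frac{e^{r/2}}{\theta(e^{-2r})}=\frac{\theta(1)}{\sqrt{\theta(e^{-2r})\theta(e^{2r})}}=\theta(1)\frac{e^{-r/2}}{\theta(e^{2r})},\qquad \theta(e^{-2r})=1+2\sum_{n\ge1}e^{-\pi n^2e^{-2r}}.$$ The function $f$ is the characteristic function of an infinitely divisible probability measure with finite second moment, whose Feller canonical measure is $M\{dx\}=M(x)\,dx$ with $$M(x)=\frac{1}{8\pi}x^2\left|\hat\zeta\!\left(\tfrac{ix}{2}\right)\right|^2\bigl|1-2^{1+\frac{ix}{2}}\bigr|^2=\frac1\pi\,\xi_{\mathbb Q}(0,ix),$$ so that its Khintchine canonical measure is $\frac{1}{1+x^2}M(x)\,dx$. In particular $$Z_{\mathbb Q}\!\left(-u,-\tfrac u2+it\right)>0\quad\text{for all }t\in\mathbb R.$$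
   Context: Let $\theta(t)=\sum_{n\in\mathbb Z}e^{-\pi n^2t}$ for $t>0$. For $\Re(w)<\Re(s)<0$ define $Z_{\mathbb Q}(w,s)=\int_0^\infty\theta(t^2)^s\theta(1/t^2)^{w-s}\frac{dt}{t}$ (absolutely convergent there; note the points $(-u,-u/2+it)$ with $u>0$ lie in this region). $\xi_{\mathbb Q}(w,s)=\frac{s(s-w)}{2w}Z_{\mathbb Q}(w,s)$, extended to an entire function on $\mathbb C^2$ (its value at $w=0$ is meant). $\hat\zeta(s)=\pi^{-s/2}\Gamma(s/2)\zeta(s)$ is the completed Riemann zeta function. The characteristic function of a probability measure $P$ is $r\mapsto\int e^{irx}P\{dx\}$. A probability measure is infinitely divisible iff its characteristic function is $\exp(\psi(r))$ with $\psi(r)=ibr+\int_{-\infty}^\infty\frac{e^{irx}-1-ir\sin x}{x^2}M\{dx\}$ for a real constant $b$ and a canonical measure $M$ (nonnegative, finite on finite intervals, with $\int_x^\infty y^{-2}M\{dy\}$ and $\int_{-\infty}^{-x}y^{-2}M\{dy\}$ finite for $x>0$); $M$ is unique and is called the Feller canonical measure, and $\frac{1}{1+x^2}M\{dx\}$ is the Khintchine canonical measure. *)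

theory Defs
  imports "HOL-Complex_Analysis.Complex_Analysis" "HOL-Probability.Probability"
begin

section \<open>The theta function and the two-variable zeta function\<close>

definition theta :: "real \<Rightarrow> real" where
  "theta t = (\<Sum>\<^sub>\<infinity>n\<in>(UNIV :: int set). exp (- pi * (real_of_int n)\<^sup>2 * t))"

definition Z_Q :: "complex \<Rightarrow> complex \<Rightarrow> complex" where
  "Z_Q w s = (LINT t:{0<..}|lborel.
     complex_of_real (theta (t\<^sup>2)) powr s * complex_of_real (theta (1 / t\<^sup>2)) powr (w - s)
       / complex_of_real t)"

text \<open>Joint complex differentiability at every point of \<open>\<complex>\<^sup>2\<close>: the real Frechet derivative exists
  and is complex-linear.\<close>

definition entire2 :: "(complex \<Rightarrow> complex \<Rightarrow> complex) \<Rightarrow> bool" where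
  "entire2 F \<longleftrightarrow> (\<forall>w s. \<exists>a b.
     ((\<lambda>(x, y). F x y) has_derivative (\<lambda>(h, k). a * h + b * k)) (at (w, s)))"

text \<open>The condition \<open>Re w < Re s < 0\<close> excludes \<open>w = 0\<close>, so the quotient below is a genuine one;
  values at \<open>w = 0\<close> come from the continuation.\<close>

definition xi_Q :: "complex \<Rightarrow> complex \<Rightarrow> complex" where
  "xi_Q = (THE F. entire2 F \<and>
     (\<forall>w s. Re w < Re s \<and> Re s < 0 \<longrightarrow> F w s = s * (s - w) / (2 * w) * Z_Q w s))"

section \<open>The completed Riemann zeta function\<close>

text \<open>The value at the pole \<open>s = 1\<close> is fixed to be \<open>0\<close> so that the description is unique.\<close>

definition riemann_zeta :: "complex \<Rightarrow> complex" where
  "riemann_zeta = (THE F. F holomorphic_on (- {1}) \<and> F 1 = 0 \<and>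
     (\<forall>s. Re s > 1 \<longrightarrow> (\<lambda>n. 1 / of_nat (Suc n) powr s) sums F s))"

definition zeta_hat :: "complex \<Rightarrow> complex" where
  "zeta_hat s = complex_of_real pi powr (- s / 2) * Gamma (s / 2) * riemann_zeta s"

section \<open>Infinitely divisible distributions and canonical measures\<close>

primrec convolution_power :: "real measure \<Rightarrow> nat \<Rightarrow> real measure" where
  "convolution_power Q 0 = return borel 0"
| "convolution_power Q (Suc n) = convolution Q (convolution_power Q n)"

definition infinitely_divisible :: "real measure \<Rightarrow> bool" where
  "infinitely_divisible P \<longleftrightarrow> real_distribution P \<and>
     (\<forall>n\<ge>1. \<exists>Q. real_distribution Q \<and> P = convolution_power Q n)"

definition canonical_measure :: "real measure \<Rightarrow> bool" where
  "canonical_measure M \<longleftrightarrow> sets M = sets borel \<and>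
     (\<forall>a b. emeasure M {a..b} < \<infinity>) \<and>
     (\<forall>x>0. (\<integral>\<^sup>+y\<in>{x..}. ennreal (1 / y\<^sup>2) \<partial>M) < \<infinity> \<and>
            (\<integral>\<^sup>+y\<in>{..-x}. ennreal (1 / y\<^sup>2) \<partial>M) < \<infinity>)"

text \<open>The integrand \<open>(exp (irx) - 1 - ir sin x) / x\<^sup>2\<close> takes its limiting value \<open>- r\<^sup>2 / 2\<close> at \<open>x = 0\<close>;
  this matters when the canonical measure has an atom there (a Gaussian component).\<close>

definition feller_kernel :: "real \<Rightarrow> real \<Rightarrow> complex" where
  "feller_kernel r x =
     (if x = 0 then - (complex_of_real r)\<^sup>2 / 2
      else (exp (\<i> * of_real (r * x)) - 1 - \<i> * of_real (r * sin x)) / (of_real x)\<^sup>2)"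

definition feller_canonical_measure :: "real measure \<Rightarrow> real measure \<Rightarrow> bool" where
  "feller_canonical_measure P M \<longleftrightarrow> canonical_measure M \<and>
     (\<exists>b::real. \<forall>r. char P r =
        exp (\<i> * of_real (b * r) + (CLINT x|M. feller_kernel r x)))"

definition khintchine_canonical_measure :: "real measure \<Rightarrow> real measure \<Rightarrow> bool" where
  "khintchine_canonical_measure P K \<longleftrightarrow>
     (\<exists>M. feller_canonical_measure P M \<and> K = density M (\<lambda>x. ennreal (1 / (1 + x\<^sup>2))))"

section \<open>The function \<open>f\<close> and the density \<open>M(x)\<close>\<close>

definition theta_cf :: "real \<Rightarrow> real" where
  "theta_cf r = theta 1 * exp (r / 2) / theta (exp (- 2 * r))"

definition theta_density_formula :: "real \<Rightarrow> real" where
  "theta_density_formula x = 1 / (8 * pi) * x\<^sup>2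
     * (cmod (zeta_hat (\<i> * of_real x / 2)))\<^sup>2
     * (cmod (1 - 2 powr (1 + \<i> * of_real x / 2)))\<^sup>2"

text \<open>The pole of \<open>zeta_hat\<close> at \<open>0\<close> is cancelled by \<open>x\<^sup>2\<close>, so the formula has a removable singularity
  at \<open>x = 0\<close>, where it is extended by continuity.\<close>

definition theta_density :: "real \<Rightarrow> real" where
  "theta_density x =
     (if x = 0 then Lim (at 0) theta_density_formula else theta_density_formula x)"

end

theory Submission
  imports Defs
begin

text \<open>
  Write \<open>L(r) = ln \<theta>(e\<^sup>2\<^sup>r)\<close>. The functional equation gives \<open>L(-r) = L(r) + r\<close>, and with \<open>t = e\<^sup>r\<close> the
  integral \<open>Z(w,s)\<close> becomes the two-sided Laplace integral of \<open>exp (w L(r) + (w - s) r)\<close>. Folding it at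
  \<open>r = 0\<close> exhibits the pole part and continues \<open>\<xi>\<close> to \<open>\<complex>\<^sup>2\<close>, with
  \<open>\<xi>(0,s) = 1/2 + s\<^sup>2/2 \<integral>\<^sub>0\<^sup>\<infinity> L(r) (e\<^sup>s\<^sup>r + e\<^sup>-\<^sup>s\<^sup>r) dr\<close>.

  By the Jacobi triple product, \<open>\<theta>(t) = E(2t)\<^sup>5 / (E(t)\<^sup>2 E(4t)\<^sup>2)\<close> with \<open>E(t) = \<Prod> (1 - e\<^sup>-\<^sup>\<pi>\<^sup>n\<^sup>t)\<close>, so the
  Mellin transform of \<open>ln \<theta>\<close> is a multiple of \<open>\<zeta>(s) \<zeta>(s + 1)\<close>; by duplication, reflection and analytic
  continuation \<open>\<xi>(0,ix)\<close> is a squared absolute value, hence nonnegative. Writing \<open>f = exp (- \<phi>)\<close>, the second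
  difference of \<open>\<phi>\<close> has cosine transform \<open>4 \<pi> (1 - cos (a x)) M(x) / x\<^sup>2 \<ge> 0\<close>, and Fourier inversion
  at the origin yields \<open>\<phi>(a) = \<integral> (1 - cos (a x)) M(x) / x\<^sup>2 dx\<close>.

  Consequently every power \<open>f\<^sup>u\<close> is a limit of characteristic functions of compound Poisson laws, so its
  Fourier transform \<open>g\<^sub>u\<close> is nonnegative and \<open>g\<^sub>u / (2 \<pi>)\<close> is a probability density with characteristic
  function \<open>f\<^sup>u\<close>. Strict positivity follows from \<open>2 \<pi> g\<^sub>u = g\<^sub>v * g\<^sub>v\<close>, \<open>v = u/2\<close>: a zero of \<open>g\<^sub>u\<close> would force the
  analytic function \<open>g\<^sub>v\<close> to vanish on an interval.
\<close>

section \<open>Logarithmic change of variables\<close>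

text \<open>The exponent \<open>\<phi>\<close> grows like \<open>|a| / 2\<close>, so it has no
  cosine transform of its own. Its second difference with step \<open>a\<close> turns the linear
  part into a tent function plus an integrable remainder, and its value at the origin is
  \<open>2 \<phi>(a)\<close>, as \<open>\<phi>\<close> is even with \<open>\<phi>(0) = 0\<close>.
  Inversion needs an integrable transform; for a nonnegative transform of a bounded continuous
  function this follows from monotone convergence under Gaussian damping. The sign is therefore the
  crux. On \<open>s = ix/2\<close> conjugation is \<open>s \<mapsto> -s\<close>: reflection makes
  the completed zeta values at \<open>s\<close> and \<open>s + 1\<close> conjugate, and the
  coefficients 2, -5, 2 in the logarithm of the product formula produce
  \<open>2 - 5q + 2q^2 = (2 - q)(1 - 2q)\<close> with \<open>q = 2^(-s)\<close>, whose factors have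
  equal absolute value there. Finally, \<open>\<phi>(a) \<le> C a^2\<close> near 0 gives, through
  Fatou's lemma, both the integrability of \<open>M\<close> and the finite second moment.\<close>

lemma distr_lborel_exp:
  "distr lborel borel exp = density lborel (\<lambda>t::real. ennreal (indicator {0<..} t / t))" (is "?D = ?E")
proof (rule measure_eqI)
  fix A assume "A \<in> sets ?D"
  then have A[measurable]: "A \<in> sets borel" by simp
  \<comment> \<open>The substitution rule is applied on compact intervals; exhausting the line by
    \<open>[-n, n]\<close> and the half-line by its images under \<open>exp\<close> then needs only
    monotone convergence.\<close>
  have sub: "(\<integral>\<^sup>+t. ennreal (indicator A t / t * indicator {exp (- real n)..exp (real n)} t) \<partial>lborel)
     = (\<integral>\<^sup>+r. ennreal (indicator A (exp r) * indicator {- real n..real n} r) \<partial>lborel)" for n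
  proof -
    have "(\<integral>\<^sup>+t. ennreal (indicator A t / t * indicator {exp (- real n)..exp (real n)} t) \<partial>lborel) =
       (\<integral>\<^sup>+r. ennreal (indicator A (exp r) / exp r * exp r * indicator {- real n..real n} r) \<partial>lborel)"
      by (rule nn_integral_substitution)
        (auto simp: set_borel_measurable_def intro!: derivative_eq_intros continuous_intros)
    then show ?thesis by simp
  qed
  have "emeasure ?D A = (\<integral>\<^sup>+t. indicator A t \<partial>?D)" by simp
  also have "\<dots> = (\<integral>\<^sup>+r. indicator A (exp r) \<partial>lborel)" by (rule nn_integral_distr) auto
  also have "\<dots> = (\<integral>\<^sup>+r. (SUP n. ennreal (indicator A (exp r) * indicator {- real n..real n} r)) \<partial>lborel)"
  proof (rule nn_integral_cong)
    fix r :: real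
    obtain n :: nat where "\<bar>r\<bar> \<le> real n" using real_arch_simple by blast
    then show "indicator A (exp r) = (SUP n. ennreal (indicator A (exp r) * indicator {- real n..real n} r))"
      by (intro antisym SUP_upper2[of n] SUP_least) (auto simp: indicator_def)
  qed
  also have "\<dots> = (SUP n. \<integral>\<^sup>+r. ennreal (indicator A (exp r) * indicator {- real n..real n} r) \<partial>lborel)"
    by (rule nn_integral_monotone_convergence_SUP)
       (auto simp: incseq_def le_fun_def indicator_def)
  also have "\<dots> = (SUP n. \<integral>\<^sup>+t. ennreal (indicator A t / t * indicator {exp (- real n)..exp (real n)} t) \<partial>lborel)"
    by (simp only: sub)
  also have "\<dots> = (\<integral>\<^sup>+t. (SUP n. ennreal (indicator A t / t * indicator {exp (- real n)..exp (real n)} t)) \<partial>lborel)"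
  proof (rule nn_integral_monotone_convergence_SUP[symmetric])
    show "incseq (\<lambda>n t. ennreal (indicator A t / t * indicator {exp (- real n)..exp (real n)} t))"
    proof (intro incseq_SucI le_funI)
      fix n t
      show "ennreal (indicator A t / t * indicator {exp (- real n)..exp (real n)} t)
        \<le> ennreal (indicator A t / t * indicator {exp (- real (Suc n))..exp (real (Suc n))} t)"
      proof (cases "t \<in> {exp (- real n)..exp (real n)}")
        case True
        then have "t \<in> {exp (- real (Suc n))..exp (real (Suc n))}"
          using exp_le_cancel_iff[of "- real (Suc n)" "- real n"] exp_le_cancel_iff[of "real n" "real (Suc n)"]
          by (auto intro: order_trans simp del: exp_le_cancel_iff)
        then show ?thesis by (auto simp: indicator_def)
      qed simp
    qed
  qed measurable
  also have "\<dots> = (\<integral>\<^sup>+t. ennreal (indicator {0<..} t / t) * indicator A t \<partial>lborel)"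
  proof (rule nn_integral_cong)
    fix t :: real
    show "(SUP n. ennreal (indicator A t / t * indicator {exp (- real n)..exp (real n)} t)) =
       ennreal (indicator {0<..} t / t) * indicator A t"
    proof (cases "t > 0")
      case True
      obtain n :: nat where n: "\<bar>ln t\<bar> \<le> real n" using real_arch_simple by blast
      then have "t \<in> {exp (- real n)..exp (real n)}" using True
        by (metis abs_le_iff atLeastAtMost_iff exp_le_cancel_iff exp_ln neg_le_iff_le minus_le_iff)
      then show ?thesis using True
        by (intro antisym SUP_upper2[of n] SUP_least) (auto simp: indicator_def)
    next
      case False
      then have "t \<notin> {exp (- real n)..exp (real n)}" for n
        using exp_gt_zero[of "- real n"] by (auto simp del: exp_gt_zero)
      then show ?thesis using False by simp
    qed
  qed
  also have "\<dots> = emeasure ?E A" by (simp add: emeasure_density)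
  finally show "emeasure ?D A = emeasure ?E A" .
qed simp

lemma
  fixes g :: "real \<Rightarrow> 'b::{banach, second_countable_topology}"
  assumes [measurable]: "g \<in> borel_measurable borel"
  shows integrable_exp_substitution:
      "set_integrable lborel {0<..} (\<lambda>t. g t /\<^sub>R t) \<longleftrightarrow> integrable lborel (\<lambda>r. g (exp r))"
    and integral_exp_substitution:
      "(LINT t:{0<..}|lborel. g t /\<^sub>R t) = (LINT r|lborel. g (exp r))"
proof -
  have eq: "(indicat_real {0<..} t / t) *\<^sub>R g t = indicator {0<..} t *\<^sub>R g t /\<^sub>R t" for t
    by (simp add: divide_inverse)
  show "set_integrable lborel {0<..} (\<lambda>t. g t /\<^sub>R t) \<longleftrightarrow> integrable lborel (\<lambda>r. g (exp r))"
    using integrable_distr_eq[of exp lborel borel g]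
      integrable_density[of g lborel "\<lambda>t. indicator {0<..} t / t"]
    by (simp add: distr_lborel_exp eq set_integrable_def indicator_def divide_inverse)
  show "(LINT t:{0<..}|lborel. g t /\<^sub>R t) = (LINT r|lborel. g (exp r))"
    using integral_distr[of exp lborel borel g]
      integral_density[of g lborel "\<lambda>t. indicator {0<..} t / t"]
    by (simp add: distr_lborel_exp eq set_lebesgue_integral_def indicator_def divide_inverse)
qed

section \<open>The theta series\<close>

lemma summable_gaussian_Suc:
  fixes a :: real assumes "a > 0"
  shows "summable (\<lambda>n. exp (- a * (real (Suc n))\<^sup>2))"
proof (rule summable_comparison_test')
  show "summable (\<lambda>n. exp (- a) ^ n)"
    using assms by (intro summable_geometric) auto
  fix n :: nat
  have "real n \<le> (real (Suc n))\<^sup>2" by (simp add: power2_eq_square algebra_simps)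
  then have "a * real n \<le> a * (real (Suc n))\<^sup>2" using assms by (intro mult_left_mono) auto
  then show "norm (exp (- a * (real (Suc n))\<^sup>2)) \<le> exp (- a) ^ n"
    by (simp add: exp_of_nat_mult[symmetric] mult.commute)
qed

lemma summable_theta: "t > 0 \<Longrightarrow> summable (\<lambda>n. exp (- pi * (real (Suc n))\<^sup>2 * t))"
  using summable_gaussian_Suc[of "pi * t"] by (simp add: algebra_simps)

lemma theta_eq:
  assumes "t > 0"
  shows "theta t = 1 + 2 * (\<Sum>n. exp (- pi * (real (Suc n))\<^sup>2 * t))"
proof -
  define f where "f = (\<lambda>n::int. exp (- pi * (real_of_int n)\<^sup>2 * t))"
  define S where "S = (\<Sum>n. exp (- pi * (real (Suc n))\<^sup>2 * t))"
  have S: "((\<lambda>n. exp (- pi * (real (Suc n))\<^sup>2 * t)) has_sum S) UNIV"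
    using summable_theta[OF assms] by (intro sums_nonneg_imp_has_sum) (auto simp: S_def summable_sums)
  have 1: "(f has_sum S) (range (\<lambda>n. int (Suc n)))"
    using S by (subst has_sum_reindex) (auto simp: o_def f_def inj_on_def)
  have 2: "(f has_sum S) (range (\<lambda>n. - int (Suc n)))"
    using S by (subst has_sum_reindex)
      (auto simp: o_def f_def inj_on_def power2_eq_square algebra_simps)
  have 3: "(f has_sum (S + S)) (range (\<lambda>n. int (Suc n)) \<union> range (\<lambda>n. - int (Suc n)))"
    by (rule has_sum_Un_disjoint[OF 1 2]) auto
  have 4: "(f has_sum (f 0 + (S + S))) (insert 0 (range (\<lambda>n. int (Suc n)) \<union> range (\<lambda>n. - int (Suc n))))"
    by (rule has_sum_insert[OF _ 3]) auto
  have "insert 0 (range (\<lambda>n. int (Suc n)) \<union> range (\<lambda>n. - int (Suc n))) = UNIV"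
  proof (rule set_eqI)
    fix k :: int
    have "k = 0 \<or> k = int (Suc (nat (k - 1))) \<or> k = - int (Suc (nat (- k - 1)))" by linarith
    then show "k \<in> insert 0 (range (\<lambda>n. int (Suc n)) \<union> range (\<lambda>n. - int (Suc n))) \<longleftrightarrow> k \<in> UNIV"
      by blast
  qed
  with 4 have "theta t = f 0 + (S + S)"
    unfolding theta_def f_def by (simp add: infsumI)
  then show ?thesis by (simp add: f_def S_def)
qed

lemma theta_ge_1: "t > 0 \<Longrightarrow> 1 \<le> theta t"
  using suminf_nonneg[OF summable_theta[of t]] by (simp add: theta_eq)

lemma continuous_on_theta: "continuous_on {0<..} theta"
proof (rule continuous_on_cong[THEN iffD2])
  show "theta t = 1 + 2 * (\<Sum>n. exp (- pi * (real (Suc n))\<^sup>2 * t))" if "t \<in> {0<..}" for t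
    using that by (simp add: theta_eq)
  show "continuous_on {0<..} (\<lambda>t. 1 + 2 * (\<Sum>n. exp (- pi * (real (Suc n))\<^sup>2 * t)))"
  proof (rule continuous_at_imp_continuous_on)
    show "\<forall>t\<in>{0<..}. isCont (\<lambda>t. 1 + 2 * (\<Sum>n. exp (- pi * (real (Suc n))\<^sup>2 * t))) t"
    proof
      fix t :: real assume "t \<in> {0<..}"
      then have t: "t / 2 > 0" "t > t / 2" by auto
      \<comment> \<open>Uniform convergence holds only away from 0, hence the half-line starting at
        \<open>t / 2\<close>.\<close>
      have "uniform_limit {t/2<..} (\<lambda>n t. \<Sum>i<n. exp (- pi * (real (Suc i))\<^sup>2 * t))
             (\<lambda>t. \<Sum>i. exp (- pi * (real (Suc i))\<^sup>2 * t)) sequentially"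
        by (rule Weierstrass_m_test[OF _ summable_theta[OF t(1)]]) auto
      then have "continuous_on {t/2<..} (\<lambda>t. \<Sum>i. exp (- pi * (real (Suc i))\<^sup>2 * t))"
        by (rule uniform_limit_theorem[rotated]) (auto intro!: always_eventually continuous_intros)
      then have "isCont (\<lambda>t. \<Sum>i. exp (- pi * (real (Suc i))\<^sup>2 * t)) t"
        using t by (simp add: continuous_on_eq_continuous_at)
      then show "isCont (\<lambda>t. 1 + 2 * (\<Sum>n. exp (- pi * (real (Suc n))\<^sup>2 * t))) t"
        by (intro continuous_intros)
    qed
  qed
qed simp

text \<open>\<open>(n^2 - 1) (t - 1) \<ge> 0\<close> compares the \<open>n\<close>-th term with its
  value at \<open>t = 1\<close>, at the cost of the factor \<open>exp pi * exp (- pi * t)\<close>.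
  The constant is thus twice \<open>exp pi\<close> times the series at 1.\<close>

lemma theta_decay:
  obtains C where "C > 0" "\<And>t. t \<ge> 1 \<Longrightarrow> theta t - 1 \<le> C * exp (- pi * t)"
proof
  define C where "C = 2 * exp pi * (\<Sum>n. exp (- pi * (real (Suc n))\<^sup>2 * 1))"
  show "C > 0" unfolding C_def
    by (intro mult_pos_pos suminf_pos summable_theta) auto
  fix t :: real assume t: "t \<ge> 1"
  have "(\<Sum>n. exp (- pi * (real (Suc n))\<^sup>2 * t)) \<le>
    (\<Sum>n. exp pi * exp (- pi * t) * exp (- pi * (real (Suc n))\<^sup>2 * 1))"
  proof (rule suminf_le)
    fix n
    have "0 \<le> pi * (((real (Suc n))\<^sup>2 - 1) * (t - 1))" using t
      by (intro mult_nonneg_nonneg) (auto simp: power2_eq_square algebra_simps)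
    then have "- pi * (real (Suc n))\<^sup>2 * t \<le> pi + (- pi * t) + (- pi * (real (Suc n))\<^sup>2 * 1)"
      by (simp add: algebra_simps)
    then show "exp (- pi * (real (Suc n))\<^sup>2 * t) \<le> exp pi * exp (- pi * t) * exp (- pi * (real (Suc n))\<^sup>2 * 1)"
      by (simp only: exp_add[symmetric] exp_le_cancel_iff)
  next
    show "summable (\<lambda>n. exp (- pi * (real (Suc n))\<^sup>2 * t))" using t by (intro summable_theta) auto
    show "summable (\<lambda>n. exp pi * exp (- pi * t) * exp (- pi * (real (Suc n))\<^sup>2 * 1))"
      by (intro summable_mult summable_theta) auto
  qed
  also have "\<dots> = exp pi * exp (- pi * t) * (\<Sum>n. exp (- pi * (real (Suc n))\<^sup>2 * 1))"
    by (rule suminf_mult[OF summable_theta]) simp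
  finally have le: "(\<Sum>n. exp (- pi * (real (Suc n))\<^sup>2 * t)) \<le>
      exp pi * exp (- pi * t) * (\<Sum>n. exp (- pi * (real (Suc n))\<^sup>2 * 1))" .
  have "theta t - 1 = 2 * (\<Sum>n. exp (- pi * (real (Suc n))\<^sup>2 * t))"
    using t by (subst theta_eq) auto
  also have "\<dots> \<le> C * exp (- pi * t)"
    using mult_left_mono[OF le, of 2] by (simp only: C_def mult_ac zero_le_numeral)
  finally show "theta t - 1 \<le> C * exp (- pi * t)" .
qed

text \<open>Double exponential decay beats \<open>exp (c * r)\<close> for every real
  \<open>c\<close>; this is what makes the half-line Laplace integrals below entire. The constant
  comes from \<open>exp (2 * r) \<ge> 2 * r^2\<close> and completing the square:
  \<open>(c + 1)^2 / 8\<close> is the maximum of \<open>(c + 1) * r - 2 * r^2\<close>.\<close>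

lemma theta_exp_decay:
  obtains K where "K > 0" "\<And>r. r \<ge> 0 \<Longrightarrow> exp (c * r) * (theta (exp (2 * r)) - 1) \<le> K * exp (- r)"
proof -
  obtain C where C: "C > 0" "\<And>t. t \<ge> 1 \<Longrightarrow> theta t - 1 \<le> C * exp (- pi * t)"
    using theta_decay by blast
  show ?thesis
  proof
    show "C * exp ((c + 1)\<^sup>2 / 8) > 0" using C by simp
    fix r :: real assume r: "r \<ge> 0"
    have "2 * r\<^sup>2 \<le> exp (2 * r)" using exp_lower_Taylor_quadratic[of "2 * r"] r by (simp add: power2_eq_square)
    moreover have "exp (2 * r) \<le> pi * exp (2 * r)" using pi_gt3 by simp
    moreover have "(c + 1)\<^sup>2 / 8 - r - c * r + 2 * r\<^sup>2 = 2 * (r - (c + 1) / 4)\<^sup>2"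
      by (simp add: power2_eq_square field_simps)
    moreover have "0 \<le> 2 * (r - (c + 1) / 4)\<^sup>2" by simp
    ultimately have "c * r - pi * exp (2 * r) \<le> (c + 1)\<^sup>2 / 8 - r"
      by linarith
    then have le: "exp (c * r) * exp (- pi * exp (2 * r)) \<le> exp ((c + 1)\<^sup>2 / 8) * exp (- r)"
      by (simp add: exp_add[symmetric])
    have "exp (c * r) * (theta (exp (2 * r)) - 1) \<le> exp (c * r) * (C * exp (- pi * exp (2 * r)))"
      using C(2)[of "exp (2 * r)"] r by (intro mult_left_mono) auto
    also have "\<dots> \<le> C * exp ((c + 1)\<^sup>2 / 8) * exp (- r)"
      using mult_left_mono[OF le, of C] C(1) by (simp add: algebra_simps)
    finally show "exp (c * r) * (theta (exp (2 * r)) - 1) \<le> C * exp ((c + 1)\<^sup>2 / 8) * exp (- r)" .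
  qed
qed

section \<open>The functional equation of theta\<close>

lemma sum_cis_multiples:
  fixes l :: nat and k :: int assumes "l > 0"
  shows "(\<Sum>\<nu><l. cis (2 * pi * of_int k * real \<nu> / real l)) = (if int l dvd k then of_nat l else 0)"
proof -
  define w where "w = cis (2 * pi * of_int k / real l)"
  have pw: "cis (2 * pi * of_int k * real \<nu> / real l) = w ^ \<nu>" for \<nu>
    by (simp add: w_def Complex.DeMoivre mult_ac)
  have wl: "w ^ l = 1"
    using assms cis_multiple_2pi[of "of_int k"] by (simp add: w_def Complex.DeMoivre)
  have iff: "w = 1 \<longleftrightarrow> int l dvd k"
  proof
    assume "w = 1"
    then have "cos (2 * pi * of_int k / real l) = 1" by (simp add: w_def complex_eq_iff)
    then obtain n :: int where "2 * pi * of_int k / real l = of_int n * 2 * pi"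
      using cos_one_2pi_int by blast
    then have "real_of_int k = of_int (n * int l)" using assms by (simp add: field_simps)
    then have "k = n * int l" using of_int_eq_iff by blast
    then show "int l dvd k" by simp
  next
    assume "int l dvd k"
    then obtain n where "k = int l * n" by blast
    then have "2 * pi * of_int k / real l = 2 * pi * of_int n" using assms by simp
    then show "w = 1" unfolding w_def by (simp only: cis_multiple_2pi[OF Ints_of_int])
  qed
  show ?thesis
  proof (cases "w = 1")
    case True
    then show ?thesis using iff by (simp add: pw)
  next
    case False
    then have "(\<Sum>\<nu><l. w ^ \<nu>) = 0" using geometric_sum[of w l] wl by simp
    then show ?thesis using iff False by (simp add: pw)
  qed
qed

text \<open>Expanding \<open>(cis x + cis (- x)) ^ (2 * m)\<close> leaves the frequencies
  \<open>2 * (j - m)\<close>; summation over the roots of unity keeps those with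
  \<open>j - m\<close> divisible by \<open>l\<close>. With an even power the angles
  \<open>pi * \<nu> / l\<close> already produce \<open>l\<close>-th roots of unity.\<close>

lemma cos_power_sum:
  fixes l m :: nat assumes l: "l > 0"
  shows "(\<Sum>\<nu><l. (2 * cos (pi * real \<nu> / real l)) ^ (2 * m)) =
    real l * (\<Sum>j\<le>2*m. if int l dvd int j - int m then real ((2 * m) choose j) else 0)"
proof -
  have expand: "complex_of_real ((2 * cos x) ^ (2 * m)) =
      (\<Sum>j\<le>2*m. of_nat ((2 * m) choose j) * cis (2 * of_int (int j - int m) * x))" for x :: real
  proof -
    have "complex_of_real (2 * cos x) = cis x + cis (- x)" by (simp add: complex_eq_iff)
    then have "complex_of_real ((2 * cos x) ^ (2 * m)) = (cis x + cis (- x)) ^ (2 * m)"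
      by (simp only: of_real_power)
    also have "\<dots> = (\<Sum>j\<le>2*m. of_nat ((2 * m) choose j) * cis x ^ j * cis (- x) ^ (2 * m - j))"
      by (rule binomial_ring)
    also have "\<dots> = (\<Sum>j\<le>2*m. of_nat ((2 * m) choose j) * cis (2 * of_int (int j - int m) * x))"
    proof (rule sum.cong[OF refl])
      fix j assume "j \<in> {..2 * m}"
      then have "real (2 * m - j) = 2 * real m - real j" by (simp add: of_nat_diff)
      then have "cis x ^ j * cis (- x) ^ (2 * m - j) = cis (2 * of_int (int j - int m) * x)"
        unfolding Complex.DeMoivre cis_mult by (intro arg_cong[where f=cis]) (simp add: algebra_simps)
      then show "of_nat ((2 * m) choose j) * cis x ^ j * cis (- x) ^ (2 * m - j) =
          of_nat ((2 * m) choose j) * cis (2 * of_int (int j - int m) * x)"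
        by (simp add: mult.assoc)
    qed
    finally show ?thesis .
  qed
  have "complex_of_real (\<Sum>\<nu><l. (2 * cos (pi * real \<nu> / real l)) ^ (2 * m)) =
     (\<Sum>\<nu><l. \<Sum>j\<le>2*m. of_nat ((2 * m) choose j) * cis (2 * pi * of_int (int j - int m) * real \<nu> / real l))"
    unfolding of_real_sum expand by (intro sum.cong refl arg_cong2[where f="(*)"] arg_cong[where f=cis]) (simp add: field_simps)
  also have "\<dots> = (\<Sum>j\<le>2*m. of_nat ((2 * m) choose j) * (\<Sum>\<nu><l. cis (2 * pi * of_int (int j - int m) * real \<nu> / real l)))"
    by (subst sum.swap) (simp add: sum_distrib_left)
  also have "\<dots> = (\<Sum>j\<le>2*m. of_nat ((2 * m) choose j) * (if int l dvd int j - int m then of_nat l else 0))"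
    by (simp only: sum_cis_multiples[OF l])
  also have "\<dots> = complex_of_real (real l * (\<Sum>j\<le>2*m. if int l dvd int j - int m then real ((2 * m) choose j) else 0))"
    by (simp add: sum_distrib_left if_distrib mult.commute cong: if_cong)
  finally show ?thesis using of_real_eq_iff by blast
qed

text \<open>For odd \<open>l\<close> the involution \<open>\<nu> \<mapsto> l - \<nu>\<close> has no
  fixed point among \<open>1, ..., l - 1\<close>, so the nonzero residues pair off, mirroring the
  shape \<open>1 + 2 * \<Sum>\<close> of theta.\<close>

lemma cos_power_sum_odd:
  fixes p :: nat
  defines "l \<equiv> 2 * p + 1"
  shows "(\<Sum>\<nu><l. (2 * cos (pi * real \<nu> / real l)) ^ (2 * m)) =
    4 ^ m * (1 + 2 * (\<Sum>\<nu><p. cos (pi * real (Suc \<nu>) / real l) ^ (2 * m)))"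
proof -
  let ?f = "\<lambda>\<nu>. cos (pi * real \<nu> / real l) ^ (2 * m)"
  have refl: "?f (l - \<nu>) = ?f \<nu>" if "\<nu> \<le> l" for \<nu>
  proof -
    have "pi * real (l - \<nu>) / real l = pi - pi * real \<nu> / real l"
      using that by (simp add: l_def of_nat_diff field_simps)
    then show ?thesis by (simp add: power_mult)
  qed
  have "(\<Sum>\<nu><l. ?f \<nu>) = ?f 0 + (\<Sum>\<nu><2*p. ?f (Suc \<nu>))"
    by (simp add: l_def sum.lessThan_Suc_shift del: sum.lessThan_Suc)
  also have "(\<Sum>\<nu><2*p. ?f (Suc \<nu>)) = (\<Sum>\<nu><p. ?f (Suc \<nu>)) + (\<Sum>\<nu>=p..<2*p. ?f (Suc \<nu>))"
    by (simp add: lessThan_atLeast0 sum.atLeastLessThan_concat del: of_nat_Suc)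
  also have "(\<Sum>\<nu>=p..<2*p. ?f (Suc \<nu>)) = (\<Sum>\<nu><p. ?f (Suc \<nu>))"
  proof (rule sum.reindex_bij_witness[of _ "\<lambda>\<nu>. 2 * p - 1 - \<nu>" "\<lambda>\<nu>. 2 * p - 1 - \<nu>"])
    fix \<nu> assume "\<nu> \<in> {p..<2*p}"
    then have "Suc (2 * p - 1 - \<nu>) = l - Suc \<nu>" "Suc \<nu> \<le> l" by (auto simp: l_def)
    then show "?f (Suc (2 * p - 1 - \<nu>)) = ?f (Suc \<nu>)" using refl[of "Suc \<nu>"] by simp
  qed auto
  finally have "(\<Sum>\<nu><l. ?f \<nu>) = 1 + 2 * (\<Sum>\<nu><p. ?f (Suc \<nu>))" by simp
  then show ?thesis
    by (simp add: power_mult_distrib sum_distrib_left[symmetric] power_mult del: of_nat_Suc)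
qed

text \<open>Multiples of \<open>l\<close> at equal distance from the centre \<open>m\<close> carry
  equal binomial coefficients. The terminating sum is written as a series to suit Tannery's
  theorem.\<close>

lemma sum_choose_multiples:
  fixes l m :: nat assumes "l > 0"
  shows "(\<Sum>j\<le>2*m. if int l dvd int j - int m then real ((2 * m) choose j) else 0) =
    real ((2 * m) choose m) + 2 * (\<Sum>k. real ((2 * m) choose (m + l * Suc k)))"
proof -
  let ?g = "\<lambda>j. if int l dvd int j - int m then real ((2 * m) choose j) else 0"
  have fin: "(\<Sum>k. real ((2 * m) choose (m + l * Suc k))) = (\<Sum>k<m. real ((2 * m) choose (m + l * Suc k)))"
  proof (rule suminf_finite)
    fix k assume "k \<notin> {..<m}"
    then have "m < Suc k" by simp
    also have "Suc k \<le> l * Suc k" using assms by (cases l) auto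
    finally show "real ((2 * m) choose (m + l * Suc k)) = 0" by simp
  qed simp
  have upper: "(\<Sum>i=1..m. ?g (m + i)) = (\<Sum>k<m. real ((2 * m) choose (m + l * Suc k)))"
  proof -
    have "(\<Sum>i=1..m. ?g (m + i)) = (\<Sum>i\<in>{i\<in>{1..m}. l dvd i}. real ((2 * m) choose (m + i)))"
      by (rule sum.mono_neutral_cong_right) (auto simp: int_dvd_int_iff)
    also have "\<dots> = (\<Sum>k\<in>{k. k < m \<and> l * Suc k \<le> m}. real ((2 * m) choose (m + l * Suc k)))"
    proof (rule sum.reindex_bij_witness[of _ "\<lambda>k. l * Suc k" "\<lambda>i. i div l - 1"])
      fix i assume i: "i \<in> {i\<in>{1..m}. l dvd i}"
      then obtain q where q: "i = l * q" by blast
      with i assms have "q \<ge> 1" by (cases q) auto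
      then show "l * Suc (i div l - 1) = i" using assms q by simp
      have "q \<le> l * q" using assms by (cases l) auto
      moreover have "i div l - 1 = q - 1" "l * q \<le> m" using assms q i by auto
      ultimately show "i div l - 1 \<in> {k. k < m \<and> l * Suc k \<le> m}" using \<open>q \<ge> 1\<close> by (cases q) auto
    next
      fix i assume "i \<in> {i\<in>{1..m}. l dvd i}"
      then obtain q where q: "i = l * q" "q \<ge> 1" by (cases "i = 0") (auto elim!: dvdE simp: Suc_le_eq)
      then have "l * Suc (i div l - 1) = i" using assms by simp
      then show "real ((2 * m) choose (m + l * Suc (i div l - 1))) = real ((2 * m) choose (m + i))" by simp
    qed (use assms in auto)
    also have "\<dots> = (\<Sum>k<m. real ((2 * m) choose (m + l * Suc k)))"
      by (rule sum.mono_neutral_left) (auto simp: not_le)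
    finally show ?thesis .
  qed
  have "(\<Sum>j\<le>2*m. ?g j) = (\<Sum>j<m. ?g j) + (\<Sum>j=m..2*m. ?g j)"
    by (subst sum.union_disjoint[symmetric]) (auto intro!: sum.cong)
  also have "(\<Sum>j=m..2*m. ?g j) = ?g m + (\<Sum>j=Suc m..2*m. ?g j)"
    by (rule sum.atLeast_Suc_atMost) simp
  also have "(\<Sum>j=Suc m..2*m. ?g j) = (\<Sum>i=1..m. ?g (m + i))"
    by (rule sum.reindex_bij_witness[of _ "\<lambda>i. m + i" "\<lambda>j. j - m"]) auto
  also have "(\<Sum>j<m. ?g j) = (\<Sum>i=1..m. ?g (m + i))"
  proof (rule sum.reindex_bij_witness[of _ "\<lambda>i. m - i" "\<lambda>j. m - j"])
    fix j assume j: "j \<in> {..<m}"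
    then have "int (m + (m - j)) - int m = - (int j - int m)" by simp
    moreover have "(2 * m) choose (m + (m - j)) = (2 * m) choose j"
      using j by (subst binomial_symmetric) (auto intro!: arg_cong2[where f=binomial])
    ultimately show "?g (m + (m - j)) = ?g j" by (simp only: dvd_minus_iff)
  qed auto
  finally show ?thesis using fin upper by simp
qed

section \<open>Binomial ratios and exponential limits\<close>

text \<open>Each factor lies between \<open>1 - k / m\<close> and \<open>1 - k / (m + k)\<close>, so
  the ratio to the central coefficient is trapped between two \<open>k\<close>-th powers.\<close>

lemma binomial_ratio_prod:
  assumes "k \<le> m"
  shows "real ((2 * m) choose (m + k)) = real ((2 * m) choose m) * (\<Prod>i=1..k. 1 - real k / real (m + i))"
proof -
  have fs: "fact (n + k) = (fact n :: real) * (\<Prod>i=1..k. real (n + i))" for n k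
    by (induction k) (auto simp: algebra_simps)
  have a: "(fact (m + k) :: real) = fact m * (\<Prod>i=1..k. real (m + i))" by (rule fs)
  have b: "(fact m :: real) = fact (m - k) * (\<Prod>i=1..k. real (m - k + i))"
    using fs[of "m - k" k] assms by simp
  have c: "real ((2 * m) choose (m + k)) * (fact (m + k) * fact (m - k)) = fact (2 * m)"
    using assms binomial_fact[of "m + k" "2 * m", where 'a=real] by simp
  have d: "real ((2 * m) choose m) * (fact m * fact m) = fact (2 * m)"
    using binomial_fact[of m "2 * m", where 'a=real] by (simp add: mult_2)
  have e: "(\<Prod>i=1..k. 1 - real k / real (m + i)) * (\<Prod>i=1..k. real (m + i)) = (\<Prod>i=1..k. real (m - k + i))"
    unfolding prod.distrib[symmetric] using assms
    by (intro prod.cong refl) (auto simp: of_nat_diff field_simps)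
  have pos: "(\<Prod>i=1..k. real (m + i)) > 0" by (intro prod_pos) auto
  have "real ((2 * m) choose (m + k)) * (fact (m + k) * fact (m - k)) =
      real ((2 * m) choose m) * (\<Prod>i=1..k. 1 - real k / real (m + i)) * (fact (m + k) * fact (m - k))"
  proof -
    have "real ((2 * m) choose m) * (\<Prod>i=1..k. 1 - real k / real (m + i)) * (fact (m + k) * fact (m - k))
      = real ((2 * m) choose m) * (fact m * (fact (m - k) * ((\<Prod>i=1..k. 1 - real k / real (m + i)) * (\<Prod>i=1..k. real (m + i)))))"
      by (simp only: a mult_ac)
    also have "\<dots> = fact (2 * m)" by (simp only: e b[symmetric] d)
    finally show ?thesis using c by simp
  qed
  then show ?thesis by (simp add: mult_right_cancel)
qed

lemma power_one_minus_lower: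
  assumes "0 \<le> a" "(a::real) < 1"
  shows "exp (- (real n * a / (1 - a))) \<le> (1 - a) ^ n"
proof -
  have "1 / (1 - a) = 1 + a / (1 - a)" using assms by (simp add: field_simps)
  also have "\<dots> \<le> exp (a / (1 - a))" by (rule exp_ge_add_one_self)
  finally have "exp (- (a / (1 - a))) \<le> 1 - a"
    using assms by (simp add: exp_minus field_simps)
  then have "exp (- (a / (1 - a))) ^ n \<le> (1 - a) ^ n" by (rule power_mono) simp
  then show ?thesis by (simp add: exp_of_nat_mult[symmetric])
qed

lemma power_one_minus_upper:
  assumes "(a::real) \<le> 1"
  shows "(1 - a) ^ n \<le> exp (- (real n * a))"
proof -
  have "(1 - a) ^ n \<le> exp (- a) ^ n" using exp_ge_add_one_self[of "- a"] assms by (intro power_mono) auto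
  then show ?thesis by (simp add: exp_of_nat_mult[symmetric])
qed

text \<open>The expression is exactly the inverse of the \<open>m\<close>-th partial product of
  Wallis, not merely asymptotic to it; the induction checks the ratio of consecutive terms.\<close>

lemma central_binomial_asymp:
  "(\<lambda>m. real (2 * m + 1) * (real ((2 * m) choose m) / 4 ^ m)\<^sup>2) \<longlonglongrightarrow> 2 / pi"
proof -
  have eq: "(\<Prod>k=1..m. (4*real k^2) / (4*real k^2 - 1)) * (real (2 * m + 1) * (real ((2 * m) choose m) / 4 ^ m)\<^sup>2) = 1" for m
  proof (induction m)
    case (Suc m)
    define b where "b = real ((2 * m) choose m) / 4 ^ m"
    define b' where "b' = real ((2 * Suc m) choose Suc m) / 4 ^ Suc m"
    define n where "n = real m + 1"
    have n: "n \<ge> 1" by (simp add: n_def)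
    have bb: "b' = b * ((2 * n - 1) / (2 * n))"
    proof -
      have f: "real ((2 * m) choose m) = fact (2 * m) / (fact m * fact m)" for m
        using binomial_fact[of m "2 * m", where 'a=real] by (simp add: mult_2)
      have e: "2 * Suc m = Suc (Suc (2 * m))" by simp
      have "fact (2 * Suc m) = (2 * real m + 2) * (2 * real m + 1) * (fact (2 * m) :: real)"
        unfolding e fact_Suc by (simp add: algebra_simps)
      then have "(fact (2 * Suc m) :: real) = (2 * n) * (2 * n - 1) * fact (2 * m)"
        by (simp add: n_def algebra_simps)
      moreover have "fact (Suc m) = n * (fact m :: real)" by (simp add: n_def algebra_simps)
      ultimately show ?thesis unfolding b_def b'_def f using n
        by (simp add: divide_simps del: fact_Suc)
    qed
    have "(\<Prod>k=1..Suc m. (4*real k^2) / (4*real k^2 - 1)) =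
        (\<Prod>k=1..m. (4*real k^2) / (4*real k^2 - 1)) * (4 * n\<^sup>2 / (4 * n\<^sup>2 - 1))"
      by (simp add: n_def add.commute)
    also have "4 * n\<^sup>2 / (4 * n\<^sup>2 - 1) = (2 * n / (2 * n - 1))\<^sup>2 * ((2 * n - 1) / (2 * n + 1))"
    proof -
      have "4 * n\<^sup>2 - 1 = (2 * n - 1) * (2 * n + 1)" by (simp add: power2_eq_square algebra_simps)
      then show ?thesis using n by (simp add: power2_eq_square)
    qed
    finally have P: "(\<Prod>k=1..Suc m. (4*real k^2) / (4*real k^2 - 1)) =
        (\<Prod>k=1..m. (4*real k^2) / (4*real k^2 - 1)) * ((2 * n / (2 * n - 1))\<^sup>2 * ((2 * n - 1) / (2 * n + 1)))" .
    have r: "real (2 * Suc m + 1) = 2 * n + 1" by (simp add: n_def)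
    have r': "real (2 * m + 1) = 2 * n - 1" by (simp add: n_def)
    have IH: "(\<Prod>k=1..m. (4*real k^2) / (4*real k^2 - 1)) * ((2 * n - 1) * b\<^sup>2) = 1"
      using Suc.IH unfolding r' b_def .
    have "(\<Prod>k=1..Suc m. (4*real k^2) / (4*real k^2 - 1)) * ((2 * n + 1) * b'\<^sup>2)
       = (\<Prod>k=1..m. (4*real k^2) / (4*real k^2 - 1)) * ((2 * n - 1) * b\<^sup>2) * 
         (((2 * n / (2 * n - 1)) * ((2 * n - 1) / (2 * n)))\<^sup>2 * (((2 * n + 1) / (2 * n + 1))))"
      unfolding P bb by (simp add: power2_eq_square)
    also have "\<dots> = 1" unfolding IH using n by simp
    finally show ?case unfolding r b'_def .
  qed simp
  have "real (2 * m + 1) * (real ((2 * m) choose m) / 4 ^ m)\<^sup>2 = inverse (\<Prod>k=1..m. (4*real k^2) / (4*real k^2 - 1))" for m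
    using inverse_unique[OF eq[of m]] by (rule sym)
  moreover have "(\<lambda>m. inverse (\<Prod>k=1..m. (4*real k^2) / (4*real k^2 - 1))) \<longlonglongrightarrow> inverse (pi / 2)"
    by (intro tendsto_inverse wallis) simp
  moreover have "inverse (pi / 2) = 2 / pi" by simp
  ultimately show ?thesis by (simp only:)
qed

text \<open>From \<open>sin y \<ge> y - y^3 / 6\<close> and \<open>y \<le> pi / 2 < 2\<close>. The
  factor 1/3 is crude, but \<open>pi > 3\<close> compensates it later.\<close>

lemma sin_ge_third:
  assumes "0 \<le> y" "y \<le> pi / 2"
  shows "y / 3 \<le> sin (y::real)"
proof -
  have y: "y \<le> 2" using assms pi_half_less_two by linarith
  have "\<bar>sin y - (\<Sum>m<3. sin_coeff m * y ^ m)\<bar> \<le> inverse (fact 3) * \<bar>y\<bar> ^ 3"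
    by (rule Maclaurin_sin_bound)
  then have "\<bar>sin y - y\<bar> \<le> y ^ 3 / 6"
    using assms by (simp add: sin_coeff_def eval_nat_numeral field_simps)
  moreover have "y ^ 3 \<le> 4 * y"
    using mult_mono[of y 2 y 2] y assms by (simp add: power3_eq_cube mult_right_mono)
  ultimately show ?thesis by linarith
qed

lemma tendsto_exp_squeeze:
  fixes a :: "nat \<Rightarrow> real" and m :: "nat \<Rightarrow> nat"
  assumes a: "a \<longlonglongrightarrow> 0" "\<And>n. 0 \<le> a n" and lim: "(\<lambda>n. real (m n) * a n) \<longlonglongrightarrow> L"
  shows "(\<lambda>n. (1 - a n) ^ m n) \<longlonglongrightarrow> exp (- L)"
proof (rule tendsto_sandwich)
  have ev: "\<forall>\<^sub>F n in sequentially. a n < 1" using order_tendstoD(2)[OF a(1), of 1] by simp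
  show "\<forall>\<^sub>F n in sequentially. exp (- (real (m n) * a n / (1 - a n))) \<le> (1 - a n) ^ m n"
    using ev by eventually_elim (use power_one_minus_lower a in auto)
  show "\<forall>\<^sub>F n in sequentially. (1 - a n) ^ m n \<le> exp (- (real (m n) * a n))"
    using ev by eventually_elim (simp add: power_one_minus_upper)
  have "(\<lambda>n. exp (- (real (m n) * a n / (1 - a n)))) \<longlonglongrightarrow> exp (- (L / (1 - 0)))"
    by (intro tendsto_intros a lim) auto
  then show "(\<lambda>n. exp (- (real (m n) * a n / (1 - a n)))) \<longlonglongrightarrow> exp (- L)" by simp
  show "(\<lambda>n. exp (- (real (m n) * a n))) \<longlonglongrightarrow> exp (- L)"
    by (intro tendsto_intros lim)
qed

lemma eventually_prod_snd:
  assumes "eventually P F" "\<And>k n. P n \<Longrightarrow> Q k n"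
  shows "eventually (\<lambda>(k, n). Q k n) (G \<times>\<^sub>F F)"
  unfolding eventually_prod_filter using assms by (intro exI[of _ "\<lambda>_. True"] exI[of _ P]) auto

text \<open>Polya's argument: \<open>cos_power_sum\<close> evaluates the same power sum over \<open>l\<close>-th roots of unity in two
  ways; letting \<open>l \<rightarrow> \<infinity>\<close> with \<open>m \<sim> c l\<^sup>2\<close> turns the two sides into theta series at reciprocal arguments.\<close>

lemma theta_inverse_aux:
  fixes c :: real assumes c: "c > 0"
  shows "theta (pi * c) = theta (1 / (pi * c)) / sqrt (pi * c)"
proof -
  have pc: "pi * c > 0" and pc': "1 / (pi * c) > 0" using c by auto
  define l where "l p = 2 * p + 1" for p :: nat
  define m where "m p = nat \<lfloor>c * (real (l p))\<^sup>2\<rfloor>" for p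
  define b where "b p = real ((2 * m p) choose m p)" for p
  define A where "A \<nu> p = (if \<nu> < p then cos (pi * real (Suc \<nu>) / real (l p)) ^ (2 * m p) else 0)" for \<nu> p
  define B where "B k p = real ((2 * m p) choose (m p + l p * Suc k)) / b p" for k p
  have lpos: "l p > 0" for p by (simp add: l_def)
  have bpos: "b p > 0" for p by (simp add: b_def)
  have m_le: "real (m p) \<le> c * (real (l p))\<^sup>2" for p
    unfolding m_def using c by (simp add: of_nat_nat)
  have m_ge: "c * (real (l p))\<^sup>2 - 1 \<le> real (m p)" for p
    unfolding m_def using c by (simp add: of_nat_nat)
  have ratio: "(\<lambda>p. real (m p) / (real (l p))\<^sup>2) \<longlonglongrightarrow> c"
  proof (rule tendsto_sandwich)
    show "\<forall>\<^sub>F p in sequentially. c - 1 / (real (l p))\<^sup>2 \<le> real (m p) / (real (l p))\<^sup>2"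
    proof (intro always_eventually allI)
      fix p
      have "c - 1 / (real (l p))\<^sup>2 = (c * (real (l p))\<^sup>2 - 1) / (real (l p))\<^sup>2"
        using lpos[of p] by (simp add: diff_divide_distrib)
      also have "\<dots> \<le> real (m p) / (real (l p))\<^sup>2" using m_ge[of p] by (intro divide_right_mono) auto
      finally show "c - 1 / (real (l p))\<^sup>2 \<le> real (m p) / (real (l p))\<^sup>2" .
    qed
    show "\<forall>\<^sub>F p in sequentially. real (m p) / (real (l p))\<^sup>2 \<le> c"
      using m_le lpos by (intro always_eventually allI) (simp add: field_simps)
    show "(\<lambda>p. c - 1 / (real (l p))\<^sup>2) \<longlonglongrightarrow> c" unfolding l_def by real_asymp
  qed simp
  have m_top: "filterlim m at_top sequentially"
  proof -
    have "filterlim (\<lambda>p. c * (real (l p))\<^sup>2 - 1) at_top sequentially"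
      using c unfolding l_def by real_asymp
    then have "filterlim (\<lambda>p. real (m p)) at_top sequentially"
      by (rule filterlim_at_top_mono) (use m_ge in auto)
    then show ?thesis using filterlim_sequentially_iff_filterlim_real by blast
  qed
  \<comment> \<open>Both evaluations of the power sum, divided by \<open>4 ^ m\<close> so that each
    bracket has the shape \<open>1 + 2 * \<Sum>\<close>; the prefactor carries the central binomial
    coefficient.\<close>
  have eqn: "1 + 2 * (\<Sum>\<nu>. A \<nu> p) = real (l p) * b p / 4 ^ m p * (1 + 2 * (\<Sum>k. B k p))" for p
  proof -
    have sA: "(\<Sum>\<nu>. A \<nu> p) = (\<Sum>\<nu><p. cos (pi * real (Suc \<nu>) / real (l p)) ^ (2 * m p))"
      by (subst suminf_finite[of "{..<p}"]) (auto simp: A_def)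
    have sB: "(\<Sum>k. B k p) = (\<Sum>k. real ((2 * m p) choose (m p + l p * Suc k))) / b p"
      unfolding B_def
    proof (rule suminf_divide)
      show "summable (\<lambda>k. real ((2 * m p) choose (m p + l p * Suc k)))"
      proof (rule summable_finite[of "{..<m p}"])
        fix k assume "k \<notin> {..<m p}"
        then have "m p < Suc k" by simp
        also have "Suc k \<le> l p * Suc k" by (simp add: l_def)
        finally show "real ((2 * m p) choose (m p + l p * Suc k)) = 0" by simp
      qed simp
    qed
    have "4 ^ m p * (1 + 2 * (\<Sum>\<nu>. A \<nu> p)) = real (l p) * (b p + 2 * (\<Sum>k. real ((2 * m p) choose (m p + l p * Suc k))))"
      using cos_power_sum[OF lpos, of p "m p"] cos_power_sum_odd[of p "m p"] sum_choose_multiples[OF lpos, of p "m p"]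
      by (simp only: sA b_def l_def)
    also have "\<dots> = real (l p) * b p * (1 + 2 * (\<Sum>k. B k p))"
      using bpos[of p] by (simp add: sB field_simps)
    finally show ?thesis by (simp add: field_simps)
  qed
  \<comment> \<open>\<open>cos^2 = 1 - sin^2\<close> together with
    \<open>l * sin (x / l) \<rightarrow> x\<close> turns the power into
    \<open>exp (- c * x^2)\<close>, where \<open>x = pi * (\<nu> + 1)\<close>.\<close>
  have limA: "(\<lambda>p. \<Sum>\<nu>. A \<nu> p) \<longlonglongrightarrow> (\<Sum>\<nu>. exp (- pi * (real (Suc \<nu>))\<^sup>2 * (pi * c)))"
  proof (rule tannerys_theorem[THEN conjunct2, THEN conjunct2])
    fix \<nu> :: nat
    define x where "x = pi * real (Suc \<nu>)"
    have "(\<lambda>p. (1 - (sin (x / real (l p)))\<^sup>2) ^ m p) \<longlonglongrightarrow> exp (- (c * x\<^sup>2))"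
    proof (rule tendsto_exp_squeeze)
      have "(\<lambda>p. (sin (x * (1 / real (l p))))\<^sup>2) \<longlonglongrightarrow> (sin (x * 0))\<^sup>2"
        by (intro tendsto_intros) (unfold l_def, real_asymp)
      then show "(\<lambda>p. (sin (x / real (l p)))\<^sup>2) \<longlonglongrightarrow> 0" by simp
      have "(\<lambda>p. real (l p) * sin (x / real (l p))) \<longlonglongrightarrow> x" unfolding l_def by real_asymp
      then have "(\<lambda>p. (real (m p) / (real (l p))\<^sup>2) * (real (l p) * sin (x / real (l p)))\<^sup>2) \<longlonglongrightarrow> c * x\<^sup>2"
        by (intro tendsto_intros ratio)
      then show "(\<lambda>p. real (m p) * (sin (x / real (l p)))\<^sup>2) \<longlonglongrightarrow> c * x\<^sup>2"
        using lpos[THEN gr_implies_not0] by (simp add: power_mult_distrib)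
    qed simp
    then have "(\<lambda>p. cos (x / real (l p)) ^ (2 * m p)) \<longlonglongrightarrow> exp (- (c * x\<^sup>2))"
      by (simp add: power_mult cos_squared_eq)
    moreover have "\<forall>\<^sub>F p in sequentially. cos (x / real (l p)) ^ (2 * m p) = A \<nu> p"
      using eventually_gt_at_top[of \<nu>] by eventually_elim (simp add: A_def x_def)
    ultimately have "A \<nu> \<longlonglongrightarrow> exp (- (c * x\<^sup>2))" by (rule Lim_transform_eventually)
    moreover have "- (c * x\<^sup>2) = - pi * (real (Suc \<nu>))\<^sup>2 * (pi * c)"
      by (simp add: x_def power2_eq_square algebra_simps)
    ultimately show "(\<lambda>p. A \<nu> p) \<longlonglongrightarrow> exp (- pi * (real (Suc \<nu>))\<^sup>2 * (pi * c))" by (simp only:)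
  next
    have "\<forall>\<^sub>F p in sequentially. c / 2 < real (m p) / (real (l p))\<^sup>2"
      by (rule order_tendstoD[OF ratio]) (use c in simp)
    then show "\<forall>\<^sub>F (\<nu>, p) in at_top \<times>\<^sub>F sequentially. norm (A \<nu> p) \<le> exp (- (c / 2) * (real (Suc \<nu>))\<^sup>2)"
    proof (rule eventually_prod_snd)
      fix \<nu> p assume p: "c / 2 < real (m p) / (real (l p))\<^sup>2"
      show "norm (A \<nu> p) \<le> exp (- (c / 2) * (real (Suc \<nu>))\<^sup>2)"
      proof (cases "\<nu> < p")
        case True
        define y where "y = pi * real (Suc \<nu>) / real (l p)"
        have y0: "0 \<le> y" by (simp add: y_def)
        have "real (Suc \<nu>) * 2 \<le> real (l p)" using True by (simp add: l_def)
        then have "pi * (real (Suc \<nu>) * 2) \<le> pi * real (l p)" by (intro mult_left_mono) auto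
        then have y1: "y \<le> pi / 2" using lpos[of p] by (simp add: y_def field_simps)
        \<comment> \<open>\<open>pi > 3\<close> cancels the 1/3 of \<open>sin_ge_third\<close>,
          giving a Gaussian majorant independent of \<open>p\<close>. The angle stays at most
          \<open>pi / 2\<close> because \<open>\<nu> < p\<close> and
          \<open>l = 2 * p + 1\<close>.\<close>
        have "3 * real (Suc \<nu>) / real (l p) \<le> y" using pi_gt3 lpos[of p]
          unfolding y_def by (intro divide_right_mono mult_right_mono) auto
        then have s: "real (Suc \<nu>) / real (l p) \<le> sin y" proof -
            have "3 * real (Suc \<nu>) / real (l p) = 3 * (real (Suc \<nu>) / real (l p))" by simp
            then show ?thesis using \<open>3 * real (Suc \<nu>) / real (l p) \<le> y\<close> sin_ge_third[OF y0 y1] by linarith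
          qed
        have "c / 2 * (real (Suc \<nu>))\<^sup>2 \<le> real (m p) / (real (l p))\<^sup>2 * (real (Suc \<nu>))\<^sup>2"
          using p by (intro mult_right_mono) auto
        also have "\<dots> = real (m p) * (real (Suc \<nu>) / real (l p))\<^sup>2" by (simp add: power_divide)
        also have "\<dots> \<le> real (m p) * (sin y)\<^sup>2"
          using s by (intro mult_left_mono power_mono) auto
        finally have e: "c / 2 * (real (Suc \<nu>))\<^sup>2 \<le> real (m p) * (sin y)\<^sup>2" .
        have "norm (A \<nu> p) = (1 - (sin y)\<^sup>2) ^ m p"
          using True by (simp only: cos_squared_eq[symmetric]) (simp add: A_def y_def power_mult)
        also have "\<dots> \<le> exp (- (real (m p) * (sin y)\<^sup>2))"
          by (rule power_one_minus_upper) (simp add: abs_square_le_1)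
        also have "\<dots> \<le> exp (- (c / 2) * (real (Suc \<nu>))\<^sup>2)" using e by simp
        finally show ?thesis .
      qed (simp add: A_def)
    qed
    show "summable (\<lambda>\<nu>. exp (- (c / 2) * (real (Suc \<nu>))\<^sup>2))"
      using c by (intro summable_gaussian_Suc) simp
  qed simp
  \<comment> \<open>With \<open>h = l * (k + 1)\<close> one has \<open>h / m \<rightarrow> 0\<close>
    but \<open>h^2 / m \<rightarrow> (k + 1)^2 / c\<close>; the enclosing powers
    \<open>(1 - h / m)^h\<close> and \<open>(1 - h / (m + h))^h\<close> therefore share their
    limit.\<close>
  have limB: "(\<lambda>p. \<Sum>k. B k p) \<longlonglongrightarrow> (\<Sum>k. exp (- pi * (real (Suc k))\<^sup>2 * (1 / (pi * c))))"
  proof (rule tannerys_theorem[THEN conjunct2, THEN conjunct2])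
    fix k :: nat
    define h where "h p = l p * Suc k" for p
    define K where "K = real (Suc k)"
    have hK: "real (h p) = real (l p) * K" for p unfolding h_def K_def by (rule of_nat_mult)
    have linv: "(\<lambda>p. 1 / real (l p)) \<longlonglongrightarrow> 0" unfolding l_def by real_asymp
    have "(\<lambda>p. K * (1 / real (l p)) / (real (m p) / (real (l p))\<^sup>2)) \<longlonglongrightarrow> K * 0 / c"
      by (intro tendsto_intros ratio linv) (use c in simp)
    moreover have "K * (1 / real (l p)) / (real (m p) / (real (l p))\<^sup>2) = real (h p) / real (m p)" for p
      using lpos[of p] by (simp add: hK power2_eq_square)
    ultimately have hm: "(\<lambda>p. real (h p) / real (m p)) \<longlonglongrightarrow> 0" by (simp only: mult_zero_right div_0)
    have "(\<lambda>p. K\<^sup>2 / (real (m p) / (real (l p))\<^sup>2)) \<longlonglongrightarrow> K\<^sup>2 / c"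
      by (intro tendsto_intros ratio) (use c in simp)
    moreover have "K\<^sup>2 / (real (m p) / (real (l p))\<^sup>2) = real (h p) * (real (h p) / real (m p))" for p
      using lpos[of p] by (simp add: hK power2_eq_square)
    ultimately have hhm: "(\<lambda>p. real (h p) * (real (h p) / real (m p))) \<longlonglongrightarrow> K\<^sup>2 / c" by (simp only:)
    have ev: "\<forall>\<^sub>F p in sequentially. h p \<le> m p \<and> 0 < m p"
      using order_tendstoD(2)[OF hm, of 1, simplified] eventually_compose_filterlim[OF eventually_gt_at_top[of 0] m_top]
      by eventually_elim (simp add: field_simps)
    have hmh_eq: "\<forall>\<^sub>F p in sequentially. real (h p) / real (m p) / (1 + real (h p) / real (m p)) = real (h p) / real (m p + h p)"
      using ev by eventually_elim (simp add: field_simps)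
    have hmh: "(\<lambda>p. real (h p) / real (m p + h p)) \<longlonglongrightarrow> 0"
    proof (rule Lim_transform_eventually[OF _ hmh_eq])
      have "(\<lambda>p. real (h p) / real (m p) / (1 + real (h p) / real (m p))) \<longlonglongrightarrow> 0 / (1 + 0)"
        by (intro tendsto_intros hm) simp
      then show "(\<lambda>p. real (h p) / real (m p) / (1 + real (h p) / real (m p))) \<longlonglongrightarrow> 0" by simp
    qed
    have hhmh: "(\<lambda>p. real (h p) * (real (h p) / real (m p + h p))) \<longlonglongrightarrow> K\<^sup>2 / c"
    proof (rule Lim_transform_eventually)
      show "\<forall>\<^sub>F p in sequentially. real (h p) * (real (h p) / real (m p)) / (1 + real (h p) / real (m p)) =
          real (h p) * (real (h p) / real (m p + h p))"
        using hmh_eq by eventually_elim (simp only: times_divide_eq_right[symmetric])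
      have "(\<lambda>p. real (h p) * (real (h p) / real (m p)) / (1 + real (h p) / real (m p))) \<longlonglongrightarrow> K\<^sup>2 / c / (1 + 0)"
        by (intro tendsto_divide hhm tendsto_add hm tendsto_const) simp
      then show "(\<lambda>p. real (h p) * (real (h p) / real (m p)) / (1 + real (h p) / real (m p))) \<longlonglongrightarrow> K\<^sup>2 / c" by simp
    qed
    have Beq: "B k p = (\<Prod>i=1..h p. 1 - real (h p) / real (m p + i))" if "h p \<le> m p" for p
      using binomial_ratio_prod[OF that] bpos[of p] by (simp add: B_def b_def h_def)
    have "(\<lambda>p. B k p) \<longlonglongrightarrow> exp (- (K\<^sup>2 / c))"
    proof (rule tendsto_sandwich)
      show "\<forall>\<^sub>F p in sequentially. (1 - real (h p) / real (m p)) ^ h p \<le> B k p"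
        using ev
      proof eventually_elim
        case (elim p)
        have "(\<Prod>i=1..h p. 1 - real (h p) / real (m p)) \<le> (\<Prod>i=1..h p. 1 - real (h p) / real (m p + i))"
          using elim by (intro prod_mono) (auto intro!: divide_left_mono)
        then show ?case using elim by (simp add: Beq)
      qed
      show "\<forall>\<^sub>F p in sequentially. B k p \<le> (1 - real (h p) / real (m p + h p)) ^ h p"
        using ev
      proof eventually_elim
        case (elim p)
        have "(\<Prod>i=1..h p. 1 - real (h p) / real (m p + i)) \<le> (\<Prod>i=1..h p. 1 - real (h p) / real (m p + h p))"
          using elim by (intro prod_mono) (auto intro!: divide_left_mono)
        then show ?case using elim by (simp add: Beq)
      qed
      show "(\<lambda>p. (1 - real (h p) / real (m p)) ^ h p) \<longlonglongrightarrow> exp (- (K\<^sup>2 / c))"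
        by (rule tendsto_exp_squeeze[OF hm _ hhm]) simp
      show "(\<lambda>p. (1 - real (h p) / real (m p + h p)) ^ h p) \<longlonglongrightarrow> exp (- (K\<^sup>2 / c))"
        by (rule tendsto_exp_squeeze[OF hmh _ hhmh]) simp
    qed
    moreover have "- (K\<^sup>2 / c) = - pi * (real (Suc k))\<^sup>2 * (1 / (pi * c))"
      using c by (simp add: K_def field_simps)
    ultimately show "(\<lambda>p. B k p) \<longlonglongrightarrow> exp (- pi * (real (Suc k))\<^sup>2 * (1 / (pi * c)))" by (simp only:)
  next
    show "\<forall>\<^sub>F (k, p) in at_top \<times>\<^sub>F sequentially. norm (B k p) \<le> exp (- (1 / (2 * c)) * (real (Suc k))\<^sup>2)"
    proof (rule eventually_prod_snd[OF eventually_True])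
      fix k p
      define h where "h = l p * Suc k"
      show "norm (B k p) \<le> exp (- (1 / (2 * c)) * (real (Suc k))\<^sup>2)"
      proof (cases "h \<le> m p")
        case True
        have h: "h > 0" using lpos[of p] by (simp add: h_def)
        have "B k p = (\<Prod>i=1..h. 1 - real h / real (m p + i))"
          using binomial_ratio_prod[OF True] bpos[of p] by (simp add: B_def b_def h_def)
        also have "\<dots> \<le> (\<Prod>i=1..h. 1 - real h / real (m p + h))"
          using True h by (intro prod_mono) (auto intro!: divide_left_mono)
        also have "\<dots> = (1 - real h / real (m p + h)) ^ h" by simp
        also have "\<dots> \<le> exp (- (real h * (real h / real (m p + h))))"
          by (rule power_one_minus_upper) (use h in simp)
        also have "\<dots> \<le> exp (- (1 / (2 * c)) * (real (Suc k))\<^sup>2)"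
        proof -
          \<comment> \<open>\<open>h \<le> m \<le> c * l^2\<close>. For \<open>h > m\<close> the
            binomial coefficient vanishes, so every nonzero term is covered.\<close>
          have "real (m p + h) \<le> 2 * c * (real (l p))\<^sup>2" using True m_le[of p] by simp
          then have "(real (Suc k))\<^sup>2 * real (m p + h) \<le> (real (Suc k))\<^sup>2 * (2 * c * (real (l p))\<^sup>2)"
            by (intro mult_left_mono) auto
          also have "\<dots> = 2 * c * (real h * real h)" by (simp add: h_def power2_eq_square algebra_simps)
          finally have "(real (Suc k))\<^sup>2 / (2 * c) \<le> real h * (real h / real (m p + h))"
            using h c by (simp add: divide_le_eq le_divide_eq mult_ac)
          then show ?thesis by simp
        qed
        finally show ?thesis using bpos[of p] by (simp add: B_def)
      next
        case False
        then have "B k p = 0" unfolding B_def h_def[symmetric] by (subst binomial_eq_0) auto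
        then show ?thesis by simp
      qed
    qed
    show "summable (\<lambda>k. exp (- (1 / (2 * c)) * (real (Suc k))\<^sup>2))"
      using c by (intro summable_gaussian_Suc) simp
  qed simp
  \<comment> \<open>Wallis determines the square of this positive sequence; the limit follows by
    taking roots.\<close>
  have limb: "(\<lambda>p. real (l p) * b p / 4 ^ m p) \<longlonglongrightarrow> 1 / sqrt (pi * c)"
  proof -
    have "(\<lambda>p. inverse (2 * (real (m p) / (real (l p))\<^sup>2) + 1 / (real (l p))\<^sup>2) *
        (real (2 * m p + 1) * (b p / 4 ^ m p)\<^sup>2)) \<longlonglongrightarrow> inverse (2 * c + 0) * (2 / pi)"
    proof (intro tendsto_intros ratio)
      show "(\<lambda>p. 1 / (real (l p))\<^sup>2) \<longlonglongrightarrow> 0" unfolding l_def by real_asymp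
      show "(\<lambda>p. real (2 * m p + 1) * (b p / 4 ^ m p)\<^sup>2) \<longlonglongrightarrow> 2 / pi"
        unfolding b_def by (rule filterlim_compose[OF central_binomial_asymp m_top])
    qed (use c in simp)
    moreover have "inverse (2 * (real (m p) / (real (l p))\<^sup>2) + 1 / (real (l p))\<^sup>2) *
        (real (2 * m p + 1) * (b p / 4 ^ m p)\<^sup>2) = (real (l p) * b p / 4 ^ m p)\<^sup>2" for p
    proof -
      have "2 * (real (m p) / (real (l p))\<^sup>2) + 1 / (real (l p))\<^sup>2 = real (2 * m p + 1) / (real (l p))\<^sup>2"
        by (simp add: add_divide_distrib)
      then show ?thesis by (simp add: power_mult_distrib power_divide)
    qed
    moreover have "inverse (2 * c + 0) * (2 / pi) = 1 / (pi * c)" using c by (simp add: field_simps)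
    ultimately have "(\<lambda>p. (real (l p) * b p / 4 ^ m p)\<^sup>2) \<longlonglongrightarrow> 1 / (pi * c)" by (simp only:)
    from tendsto_real_sqrt[OF this] show ?thesis
      using bpos by (simp add: real_sqrt_divide less_imp_le)
  qed
  have "(\<lambda>p. 1 + 2 * (\<Sum>\<nu>. A \<nu> p)) \<longlonglongrightarrow> theta (pi * c)"
    unfolding theta_eq[OF pc] by (intro tendsto_add tendsto_mult tendsto_const limA)
  moreover have "(\<lambda>p. real (l p) * b p / 4 ^ m p * (1 + 2 * (\<Sum>k. B k p))) \<longlonglongrightarrow> 1 / sqrt (pi * c) * theta (1 / (pi * c))"
    unfolding theta_eq[OF pc'] by (intro tendsto_add tendsto_mult tendsto_const limB limb)
  ultimately have "theta (pi * c) = 1 / sqrt (pi * c) * theta (1 / (pi * c))"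
    unfolding eqn by (rule LIMSEQ_unique)
  then show ?thesis by (simp only: mult_1_left times_divide_eq_left)
qed

lemma theta_inverse: assumes "t > 0" shows "theta (1 / t) = sqrt t * theta t"
proof -
  have e: "pi * (t / pi) = t" by simp
  show ?thesis using assms theta_inverse_aux[of "t / pi"] unfolding e by (simp add: field_simps)
qed

section \<open>The product formula\<close>

text \<open>The q-Pascal recursion in base \<open>p\<close>: it avoids dividing by
  \<open>1 - p ^ i\<close> and turns the q-binomial theorem into an induction. For
  \<open>j > m\<close> the truncated difference \<open>m - j\<close> is harmless, since then the
  factor \<open>gauss_binom p m j\<close> vanishes.\<close>

fun gauss_binom :: "real \<Rightarrow> nat \<Rightarrow> nat \<Rightarrow> real" where
  "gauss_binom p m 0 = 1"
| "gauss_binom p 0 (Suc j) = 0"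
| "gauss_binom p (Suc m) (Suc j) = gauss_binom p m (Suc j) + p ^ (m - j) * gauss_binom p m j"

lemma gauss_binom_eq_0: "m < j \<Longrightarrow> gauss_binom p m j = 0"
proof (induction m arbitrary: j)
  case 0 then show ?case by (cases j) auto
next
  case (Suc m) then show ?case by (cases j) auto
qed

text \<open>The q-Pochhammer symbol \<open>(x; x)_n\<close>.\<close>

definition euler_prod :: "real \<Rightarrow> nat \<Rightarrow> real" where
  "euler_prod x n = (\<Prod>i=1..n. 1 - x ^ i)"

lemma euler_prod_simps [simp]:
  "euler_prod x 0 = 1" "euler_prod x (Suc n) = euler_prod x n * (1 - x ^ Suc n)"
  by (simp_all add: euler_prod_def)

text \<open>The quotient formula for Gaussian binomials with denominators cleared. In the induction
  step the two recursive contributions combine through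
  \<open>p ^ (m - i) * p ^ (i + 1) = p ^ (m + 1)\<close>.\<close>

lemma gauss_binom_euler_prod:
  "j \<le> m \<Longrightarrow> gauss_binom p m j * (euler_prod p j * euler_prod p (m - j)) = euler_prod p m"
proof (induction m arbitrary: j)
  case (Suc m)
  show ?case
  proof (cases j)
    case 0 then show ?thesis by simp
  next
    case (Suc i)
    with Suc.prems have i: "i \<le> m" by simp
    have IH: "gauss_binom p m i * (euler_prod p i * euler_prod p (m - i)) = euler_prod p m"
      using Suc.IH[OF i] .
    show ?thesis
    proof (cases "i = m")
      case True
      have "gauss_binom p m m * euler_prod p m = euler_prod p m" using IH True by simp
      moreover have "gauss_binom p (Suc m) j = gauss_binom p m m" using Suc True by (simp add: gauss_binom_eq_0)
      ultimately show ?thesis using Suc True by (simp add: mult.assoc[symmetric])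
    next
      case False
      with i have si: "Suc i \<le> m" by simp
      then have d: "m - i = Suc (m - Suc i)" by simp
      have IH2: "gauss_binom p m (Suc i) * (euler_prod p (Suc i) * euler_prod p (m - Suc i)) = euler_prod p m"
        using Suc.IH[OF si] .
      have ep: "euler_prod p (m - i) = euler_prod p (m - Suc i) * (1 - p ^ (m - i))" by (simp add: d)
      have pw: "p ^ (m - i) * p ^ Suc i = p ^ Suc m" using i by (simp add: power_add[symmetric] del: power_Suc)
      have "gauss_binom p (Suc m) j * (euler_prod p j * euler_prod p (Suc m - j)) =
         (gauss_binom p m (Suc i) * (euler_prod p (Suc i) * euler_prod p (m - Suc i))) * (1 - p ^ (m - i))
         + p ^ (m - i) * (1 - p ^ Suc i) * (gauss_binom p m i * (euler_prod p i * euler_prod p (m - i)))"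
        by (simp add: Suc ep algebra_simps del: power_Suc)
      also have "\<dots> = euler_prod p m * (1 - p ^ (m - i) * p ^ Suc i)"
        unfolding IH IH2 by (simp add: algebra_simps del: power_Suc)
      also have "\<dots> = euler_prod p (Suc m)" unfolding pw by simp
      finally show ?thesis .
    qed
  qed
qed simp

text \<open>The new factor contributes \<open>q ^ (2 * m + 1)\<close>, and
  \<open>j^2 + 2 * m + 1 = (j + 1)^2 + 2 * (m - j)\<close> converts it into the weight
  \<open>(q^2) ^ (m - j)\<close> of the q-Pascal recursion.\<close>

lemma q_binomial_theorem:
  fixes q z :: real
  shows "(\<Prod>k<m. 1 + z * q ^ (2 * k + 1)) = (\<Sum>j\<le>m. q ^ (j * j) * z ^ j * gauss_binom (q\<^sup>2) m j)"
proof (induction m)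
  case (Suc m)
  let ?g = "gauss_binom (q\<^sup>2)"
  have "(\<Prod>k<Suc m. 1 + z * q ^ (2 * k + 1)) =
     (\<Sum>j\<le>m. q ^ (j * j) * z ^ j * ?g m j) + (\<Sum>j\<le>m. z * q ^ (2 * m + 1) * (q ^ (j * j) * z ^ j * ?g m j))"
  proof -
    have "S * (1 + a) = S + a * S" for S a :: real by (simp add: algebra_simps)
    then show ?thesis by (simp only: prod.lessThan_Suc Suc.IH sum_distrib_left)
  qed
  also have "(\<Sum>j\<le>m. q ^ (j * j) * z ^ j * ?g m j) = (\<Sum>j\<le>Suc m. q ^ (j * j) * z ^ j * ?g m j)"
    by (simp add: gauss_binom_eq_0)
  also have "\<dots> = 1 + (\<Sum>j\<le>m. q ^ (Suc j * Suc j) * z ^ Suc j * ?g m (Suc j))"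
    by (subst sum.atMost_Suc_shift) simp
  also have "(\<Sum>j\<le>m. z * q ^ (2 * m + 1) * (q ^ (j * j) * z ^ j * ?g m j)) =
      (\<Sum>j\<le>m. q ^ (Suc j * Suc j) * z ^ Suc j * ((q\<^sup>2) ^ (m - j) * ?g m j))"
  proof (rule sum.cong[OF refl])
    fix j assume "j \<in> {..m}"
    then have "2 * m + 1 + j * j = Suc j * Suc j + 2 * (m - j)" by simp
    then have "q ^ (2 * m + 1) * q ^ (j * j) = q ^ (Suc j * Suc j) * (q\<^sup>2) ^ (m - j)"
      by (simp only: power_add[symmetric] power_mult[symmetric])
    moreover have "z * q ^ (2 * m + 1) * (q ^ (j * j) * z ^ j * ?g m j) =
        (q ^ (2 * m + 1) * q ^ (j * j)) * (z ^ Suc j * ?g m j)"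
      unfolding power_Suc[of z] by (simp only: mult_ac)
    ultimately show "z * q ^ (2 * m + 1) * (q ^ (j * j) * z ^ j * ?g m j) =
        q ^ (Suc j * Suc j) * z ^ Suc j * ((q\<^sup>2) ^ (m - j) * ?g m j)"
      by (simp only: mult.assoc) (simp only: mult.left_commute)
  qed
  also have "1 + (\<Sum>j\<le>m. q ^ (Suc j * Suc j) * z ^ Suc j * ?g m (Suc j)) +
      (\<Sum>j\<le>m. q ^ (Suc j * Suc j) * z ^ Suc j * ((q\<^sup>2) ^ (m - j) * ?g m j)) =
      1 + (\<Sum>j\<le>m. q ^ (Suc j * Suc j) * z ^ Suc j * ?g (Suc m) (Suc j))"
    by (simp add: sum.distrib[symmetric] distrib_left del: power_Suc mult_Suc mult_Suc_right)
  also have "\<dots> = (\<Sum>j\<le>Suc m. q ^ (j * j) * z ^ j * ?g (Suc m) j)"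
    by (subst sum.atMost_Suc_shift) simp
  finally show ?case .
qed simp

lemma euler_prod_pos: "0 < x \<Longrightarrow> x < 1 \<Longrightarrow> euler_prod x n > 0"
  unfolding euler_prod_def by (intro prod_pos) (auto simp: power_less_one_iff)

text \<open>The choice \<open>z = inverse (q ^ (2 * N))\<close> in the q-binomial theorem with
  \<open>2 * N\<close> factors centres the exponents: multiplied by \<open>q ^ (N * N)\<close>, the
  lower half of the product equals the upper half, whence the square, and
  \<open>N^2 + j^2 - 2 * N * j = (j - N)^2\<close>.\<close>

lemma finite_triple_product:
  fixes q :: real assumes q: "0 < q" "q < 1"
  shows "(\<Prod>k<N. 1 + q ^ (2 * k + 1))\<^sup>2 = gauss_binom (q\<^sup>2) (2 * N) N +
     2 * (\<Sum>n<N. q ^ (Suc n)\<^sup>2 * gauss_binom (q\<^sup>2) (2 * N) (N + Suc n))"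
proof -
  define z where "z = inverse (q ^ (2 * N))"
  let ?g = "gauss_binom (q\<^sup>2) (2 * N)"
  have zq: "z * q ^ (2 * N) = 1" using q by (simp add: z_def)
  have low: "(\<Prod>k<N. 1 + z * q ^ (2 * k + 1)) * q ^ (N * N) = (\<Prod>k<N. 1 + q ^ (2 * k + 1))"
  proof -
    have "q ^ (N * N) = (\<Prod>k<N. q ^ (2 * k + 1))"
    proof (induction N)
      case (Suc n)
      have "Suc n * Suc n = n * n + (2 * n + 1)" by simp
      then show ?case by (simp only: power_add Suc.IH prod.lessThan_Suc)
    qed simp
    also have "\<dots> = (\<Prod>k<N. q ^ (2 * (N - Suc k) + 1))" by (rule prod.nat_diff_reindex[symmetric])
    finally have "(\<Prod>k<N. 1 + z * q ^ (2 * k + 1)) * q ^ (N * N) =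
       (\<Prod>k<N. (1 + z * q ^ (2 * k + 1)) * q ^ (2 * (N - Suc k) + 1))" by (simp only: prod.distrib)
    also have "\<dots> = (\<Prod>k<N. 1 + q ^ (2 * (N - Suc k) + 1))"
    proof (rule prod.cong[OF refl])
      fix k assume "k \<in> {..<N}"
      then have "q ^ (2 * k + 1) * q ^ (2 * (N - Suc k) + 1) = q ^ (2 * N)"
        unfolding power_add[symmetric] by (intro arg_cong[where f="power q"]) auto
      then have "z * q ^ (2 * k + 1) * q ^ (2 * (N - Suc k) + 1) = 1" using zq by (simp only: mult.assoc)
      then show "(1 + z * q ^ (2 * k + 1)) * q ^ (2 * (N - Suc k) + 1) = 1 + q ^ (2 * (N - Suc k) + 1)"
        by (simp only: distrib_right mult_1_left add.commute)
    qed
    also have "\<dots> = (\<Prod>k<N. 1 + q ^ (2 * k + 1))" by (rule prod.nat_diff_reindex)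
    finally show ?thesis .
  qed
  have high: "(\<Prod>k=N..<2*N. 1 + z * q ^ (2 * k + 1)) = (\<Prod>k<N. 1 + q ^ (2 * k + 1))"
  proof (rule prod.reindex_bij_witness[of _ "\<lambda>k. k + N" "\<lambda>k. k - N"])
    fix k assume "k \<in> {N..<2*N}"
    then have "q ^ (2 * k + 1) = q ^ (2 * N) * q ^ (2 * (k - N) + 1)"
      unfolding power_add[symmetric] by (intro arg_cong[where f="power q"]) auto
    then show "1 + q ^ (2 * (k - N) + 1) = 1 + z * q ^ (2 * k + 1)" using zq by (simp only: mult.assoc[symmetric] mult_1_left)
  qed auto
  have "(\<Prod>k<2*N. 1 + z * q ^ (2 * k + 1)) = (\<Prod>k<N. 1 + z * q ^ (2 * k + 1)) * (\<Prod>k=N..<2*N. 1 + z * q ^ (2 * k + 1))"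
    by (simp add: lessThan_atLeast0 prod.atLeastLessThan_concat)
  then have "(\<Prod>k<N. 1 + q ^ (2 * k + 1))\<^sup>2 = q ^ (N * N) * (\<Prod>k<2*N. 1 + z * q ^ (2 * k + 1))"
    using low high by (simp add: power2_eq_square mult_ac)
  also have "\<dots> = (\<Sum>j\<le>2*N. q ^ (N * N) * (q ^ (j * j) * z ^ j) * ?g j)"
    unfolding q_binomial_theorem sum_distrib_left by (simp only: mult.assoc)
  also have "\<dots> = (\<Sum>j\<le>2*N. q ^ (nat \<bar>int j - int N\<bar>)\<^sup>2 * ?g j)"
  proof (rule sum.cong[OF refl])
    fix j
    define d where "d = (nat \<bar>int j - int N\<bar>)\<^sup>2"
    have "int d = (int j - int N)\<^sup>2" unfolding d_def by simp
    then have "int (N * N + j * j) = int (d + 2 * N * j)" by (simp add: power2_eq_square algebra_simps)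
    then have "N * N + j * j = d + 2 * N * j" by (simp only: of_nat_eq_iff)
    then have "q ^ (N * N) * q ^ (j * j) = q ^ d * (q ^ (2 * N)) ^ j"
      by (simp only: power_add[symmetric] power_mult[symmetric])
    then have "q ^ (N * N) * (q ^ (j * j) * z ^ j) = q ^ d * (q ^ (2 * N)) ^ j * z ^ j"
      by (simp only: mult.assoc[symmetric])
    then have "q ^ (N * N) * (q ^ (j * j) * z ^ j) = q ^ d * (z * q ^ (2 * N)) ^ j"
      by (simp only: power_mult_distrib mult_ac)
    then show "q ^ (N * N) * (q ^ (j * j) * z ^ j) * ?g j = q ^ (nat \<bar>int j - int N\<bar>)\<^sup>2 * ?g j"
      by (simp add: zq d_def)
  qed
  also have "\<dots> = (\<Sum>j<N. q ^ (nat \<bar>int j - int N\<bar>)\<^sup>2 * ?g j) + (\<Sum>j=N..2*N. q ^ (nat \<bar>int j - int N\<bar>)\<^sup>2 * ?g j)"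
    by (subst sum.union_disjoint[symmetric]) (auto intro!: sum.cong)
  also have "(\<Sum>j=N..2*N. q ^ (nat \<bar>int j - int N\<bar>)\<^sup>2 * ?g j) = ?g N + (\<Sum>j=Suc N..2*N. q ^ (nat \<bar>int j - int N\<bar>)\<^sup>2 * ?g j)"
    by (subst sum.atLeast_Suc_atMost) auto
  also have "(\<Sum>j=Suc N..2*N. q ^ (nat \<bar>int j - int N\<bar>)\<^sup>2 * ?g j) = (\<Sum>n<N. q ^ (Suc n)\<^sup>2 * ?g (N + Suc n))"
  proof (rule sum.reindex_bij_witness[of _ "\<lambda>n. N + Suc n" "\<lambda>j. j - Suc N"])
    fix j assume "j \<in> {Suc N..2*N}"
    then have "nat \<bar>int j - int N\<bar> = Suc (j - Suc N)" "N + Suc (j - Suc N) = j" by auto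
    then show "q ^ (Suc (j - Suc N))\<^sup>2 * ?g (N + Suc (j - Suc N)) = q ^ (nat \<bar>int j - int N\<bar>)\<^sup>2 * ?g j"
      by (simp only:)
  qed auto
  also have "(\<Sum>j<N. q ^ (nat \<bar>int j - int N\<bar>)\<^sup>2 * ?g j) = (\<Sum>n<N. q ^ (Suc n)\<^sup>2 * ?g (N + Suc n))"
  proof (rule sum.reindex_bij_witness[of _ "\<lambda>n. N - Suc n" "\<lambda>j. N - Suc j"])
    fix j assume j: "j \<in> {..<N}"
    have e: "nat \<bar>int j - int N\<bar> = Suc (N - Suc j)" using j by auto
    have p: "euler_prod (q\<^sup>2) n > 0" for n using q by (intro euler_prod_pos) (auto simp: power_less_one_iff)
    have "N + Suc (N - Suc j) \<le> 2 * N" "2 * N - (N + Suc (N - Suc j)) = j" "2 * N - j = N + Suc (N - Suc j)" "j \<le> 2 * N"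
      using j by auto
    then have "?g j * (euler_prod (q\<^sup>2) j * euler_prod (q\<^sup>2) (N + Suc (N - Suc j))) =
       ?g (N + Suc (N - Suc j)) * (euler_prod (q\<^sup>2) j * euler_prod (q\<^sup>2) (N + Suc (N - Suc j)))"
      using gauss_binom_euler_prod[of j "2 * N" "q\<^sup>2"] gauss_binom_euler_prod[of "N + Suc (N - Suc j)" "2 * N" "q\<^sup>2"]
      by (simp only: mult.commute)
    moreover have "euler_prod (q\<^sup>2) j * euler_prod (q\<^sup>2) (N + Suc (N - Suc j)) \<noteq> 0"
      using p[of j] p[of "N + Suc (N - Suc j)"] by (simp del: euler_prod_simps add_Suc_right)
    ultimately have "?g j = ?g (N + Suc (N - Suc j))" by (rule mult_right_cancel[THEN iffD1, rotated])
    then show "q ^ (Suc (N - Suc j))\<^sup>2 * ?g (N + Suc (N - Suc j)) = q ^ (nat \<bar>int j - int N\<bar>)\<^sup>2 * ?g j"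
      by (simp only: e)
  qed auto
  finally show ?thesis by simp
qed

section \<open>The infinite product and its logarithm\<close>

text \<open>Minus the logarithm of \<open>E(t)\<close>. With this sign all terms are nonnegative, as
  the termwise Mellin transform requires.\<close>

definition euler_log :: "real \<Rightarrow> real" where
  "euler_log t = (\<Sum>n. - ln (1 - exp (- pi * real (Suc n) * t)))"

lemma euler_log_term:
  assumes "t > 0"
  shows "0 \<le> - ln (1 - exp (- pi * real (Suc n) * t))"
    and "- ln (1 - exp (- pi * real (Suc n) * t)) \<le> exp (- pi * real (Suc n) * t) / (1 - exp (- pi * t))"
proof -
  define x where "x = exp (- pi * real (Suc n) * t)"
  have x: "0 < x" "x < 1" using assms by (auto simp: x_def intro!: mult_pos_pos)
  have xle: "x \<le> exp (- pi * t)" using assms by (simp add: x_def mult_right_mono)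
  show "0 \<le> - ln (1 - exp (- pi * real (Suc n) * t))" using x unfolding x_def[symmetric] by simp
  have "ln (1 / (1 - x)) \<le> 1 / (1 - x) - 1" using x by (intro ln_le_minus_one) auto
  also have "\<dots> = x / (1 - x)" using x by (simp add: field_simps)
  also have "\<dots> \<le> x / (1 - exp (- pi * t))" using xle x assms by (intro divide_left_mono) auto
  finally show "- ln (1 - exp (- pi * real (Suc n) * t)) \<le> exp (- pi * real (Suc n) * t) / (1 - exp (- pi * t))"
    using x unfolding x_def[symmetric] by (simp add: ln_div)
qed

lemma summable_exp_Suc: "t > 0 \<Longrightarrow> summable (\<lambda>n. exp (- pi * real (Suc n) * t))"
proof -
  assume t: "t > 0"
  have "exp (- pi * real (Suc n) * t) = exp (- pi * t) * exp (- pi * t) ^ n" for n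
    by (simp add: exp_of_nat_mult[symmetric] exp_add[symmetric] algebra_simps)
  then show ?thesis using t by (simp only:) (intro summable_mult summable_geometric, simp)
qed

lemma summable_euler_log: "t > 0 \<Longrightarrow> summable (\<lambda>n. - ln (1 - exp (- pi * real (Suc n) * t)))"
  by (rule summable_comparison_test'[where N=0, OF summable_divide[OF summable_exp_Suc]])
    (use euler_log_term in \<open>auto simp: abs_le_iff\<close>)

lemma euler_prod_tendsto:
  assumes t: "t > 0"
  shows "(\<lambda>n. euler_prod (exp (- pi * t)) n) \<longlonglongrightarrow> exp (- euler_log t)"
proof -
  have "euler_prod (exp (- pi * t)) n = exp (- (\<Sum>i<n. - ln (1 - exp (- pi * real (Suc i) * t))))" for n
  proof (induction n)
    case (Suc n)
    have "exp (- pi * real (Suc n) * t) < 1" using t by (auto intro!: mult_pos_pos)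
    moreover have "exp (- pi * t) ^ Suc n = exp (- pi * real (Suc n) * t)"
      by (simp only: exp_of_nat_mult[symmetric]) (simp add: algebra_simps)
    ultimately show ?case using Suc.IH by (simp add: exp_diff exp_add exp_minus field_simps del: power_Suc of_nat_Suc)
  qed simp
  moreover have "(\<lambda>n. exp (- (\<Sum>i<n. - ln (1 - exp (- pi * real (Suc i) * t))))) \<longlonglongrightarrow> exp (- euler_log t)"
    unfolding euler_log_def by (intro tendsto_intros summable_LIMSEQ summable_euler_log t)
  ultimately show ?thesis by simp
qed

lemma prod_odd_eq:
  fixes q :: real assumes q: "0 < q" "q < 1"
  shows "(\<Prod>k<N. 1 - q ^ (2 * k + 1)) = euler_prod q (2 * N) / euler_prod (q\<^sup>2) N"
proof -
  have "(\<Prod>k<N. 1 - q ^ (2 * k + 1)) * euler_prod (q\<^sup>2) N = euler_prod q (2 * N)"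
  proof (induction N)
    case (Suc N)
    have "2 * Suc N = Suc (Suc (2 * N))" "(q\<^sup>2) ^ Suc N = q ^ Suc (Suc (2 * N))"
      by (simp_all only: power_mult[symmetric]) auto
    then have "(\<Prod>k<Suc N. 1 - q ^ (2 * k + 1)) * euler_prod (q\<^sup>2) (Suc N) =
        ((\<Prod>k<N. 1 - q ^ (2 * k + 1)) * euler_prod (q\<^sup>2) N) * ((1 - q ^ Suc (2 * N)) * (1 - q ^ Suc (Suc (2 * N))))"
      by (simp only: prod.lessThan_Suc euler_prod_simps mult_ac Suc_eq_plus1[symmetric])
    also have "\<dots> = euler_prod q (2 * Suc N)"
      unfolding Suc.IH \<open>2 * Suc N = Suc (Suc (2 * N))\<close> euler_prod_simps by (simp only: mult.assoc)
    finally show ?case .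
  qed simp
  then show ?thesis using euler_prod_pos[of "q\<^sup>2" N] q by (simp add: field_simps power_less_one_iff)
qed

text \<open>\<open>(1 + y) (1 - y) = 1 - y^2\<close> reduces the product to odd products in
  \<open>q\<close> and \<open>q^2\<close>, which \<open>prod_odd_eq\<close> expresses by Euler
  products.\<close>

lemma prod_odd_plus:
  fixes q :: real assumes q: "0 < q" "q < 1"
  shows "(\<Prod>k<N. 1 + q ^ (2 * k + 1)) =
    euler_prod (q\<^sup>2) (2 * N) * euler_prod (q\<^sup>2) N / (euler_prod (q ^ 4) N * euler_prod q (2 * N))"
proof -
  have q2: "0 < q\<^sup>2" "q\<^sup>2 < 1" using q by (auto simp: power_less_one_iff)
  have "(\<Prod>k<N. 1 + q ^ (2 * k + 1)) * (\<Prod>k<N. 1 - q ^ (2 * k + 1)) = (\<Prod>k<N. 1 - (q\<^sup>2) ^ (2 * k + 1))"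
    unfolding prod.distrib[symmetric]
    by (intro prod.cong refl) (simp add: algebra_simps power_mult_distrib power2_eq_square)
  then have "(\<Prod>k<N. 1 + q ^ (2 * k + 1)) * (euler_prod q (2 * N) / euler_prod (q\<^sup>2) N) = euler_prod (q\<^sup>2) (2 * N) / euler_prod (q ^ 4) N"
    unfolding prod_odd_eq[OF q] prod_odd_eq[OF q2] by (simp add: power_mult[symmetric])
  then have "(\<Prod>k<N. 1 + q ^ (2 * k + 1)) = euler_prod (q\<^sup>2) (2 * N) / euler_prod (q ^ 4) N / (euler_prod q (2 * N) / euler_prod (q\<^sup>2) N)"
    by (rule eq_divide_imp[rotated])
      (use euler_prod_pos[OF q2, of N] euler_prod_pos[OF q, of "2 * N"] in simp)
  moreover have "euler_prod (q ^ 4) N > 0" using q by (intro euler_prod_pos) (auto simp: power_less_one_iff)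
  ultimately show ?thesis using euler_prod_pos[OF q2, of N] euler_prod_pos[OF q, of "2 * N"] by (simp add: divide_simps)
qed

text \<open>The finite triple product as \<open>N \<rightarrow> \<infinity>\<close>. The base
  \<open>q^2\<close> belongs to \<open>E(2 t)\<close>: the Gaussian binomials tend to
  \<open>1 / E(2 t)\<close>, and this factor, moved to the other side, joins the square of
  \<open>E(2 t)^2 / (E(t) * E(4 t))\<close> to give the exponent 5.\<close>

lemma theta_eq_euler:
  assumes t: "t > 0"
  shows "theta t = exp (2 * euler_log t - 5 * euler_log (2 * t) + 2 * euler_log (4 * t))"
proof -
  define q where "q = exp (- pi * t)"
  have q: "0 < q" "q < 1" using t by (auto simp: q_def)
  have q2: "q\<^sup>2 = exp (- pi * (2 * t))" proof -
    have "- pi * (2 * t) = 2 * (- pi * t)" by simp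
    then show ?thesis by (simp only: exp_double q_def)
  qed
  have q4: "q ^ 4 = exp (- pi * (4 * t))" using exp_of_nat_mult[of 4 "- pi * t"] by (simp add: q_def mult_ac)
  have q2': "0 < q\<^sup>2" "q\<^sup>2 < 1" using q by (auto simp: power_less_one_iff)
  define E where "E n = euler_prod (q\<^sup>2) n" for n
  define E0 where "E0 = exp (- euler_log (2 * t))"
  have Epos: "E n > 0" for n unfolding E_def by (rule euler_prod_pos[OF q2'])
  have E: "E \<longlonglongrightarrow> E0" unfolding E_def E0_def q2 using t by (intro euler_prod_tendsto) simp
  have E0: "E0 > 0" by (simp add: E0_def)
  have dec: "decseq E"
  proof (rule decseq_SucI)
    fix n show "E (Suc n) \<le> E n" using Epos[of n] q2' by (simp add: E_def mult_le_cancel_left1)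
  qed
  \<comment> \<open>The finite products decrease to \<open>E0 > 0\<close> and are at most 1, so the
    ratios below are at most \<open>1 / E0^2\<close>: the majorant for Tannery's theorem.\<close>
  have Ege: "E0 \<le> E n" for n using decseq_ge[OF dec E] .
  have Ele: "E n \<le> 1" for n using decseqD[OF dec, of 0 n] by (simp add: E_def)
  have two: "(\<lambda>n. X (2 * n)) \<longlonglongrightarrow> x" if "X \<longlonglongrightarrow> x" for X :: "nat \<Rightarrow> real" and x
    by (rule filterlim_compose[OF that]) (simp add: filterlim_subseq strict_mono_def)
  note E2 = two[OF E]
  have qsq: "q ^ (Suc n)\<^sup>2 = exp (- pi * (real (Suc n))\<^sup>2 * t)" for n
  proof -
    have "real ((Suc n)\<^sup>2) * (- pi * t) = - pi * (real (Suc n))\<^sup>2 * t" by (simp only: of_nat_power) simp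
    then show ?thesis using exp_of_nat_mult[of "(Suc n)\<^sup>2" "- pi * t"] by (simp only: q_def)
  qed
  define A where "A n N = (if n < N then q ^ (Suc n)\<^sup>2 * (E (2 * N) / (E (N + Suc n) * E (N - Suc n))) else 0)" for n N
  have lim1: "(\<lambda>N. \<Sum>n. A n N) \<longlonglongrightarrow> (\<Sum>n. q ^ (Suc n)\<^sup>2 * (1 / E0))"
  proof (rule tannerys_theorem[THEN conjunct2, THEN conjunct2])
    fix n
    have "(\<lambda>N. q ^ (Suc n)\<^sup>2 * (E (2 * N) / (E (N + Suc n) * E (N - Suc n)))) \<longlonglongrightarrow> q ^ (Suc n)\<^sup>2 * (E0 / (E0 * E0))"
    proof -
      have "(\<lambda>N. E (N - Suc n)) \<longlonglongrightarrow> E0"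
        by (rule filterlim_compose[OF E filterlim_minus_const_nat_at_top])
      then show ?thesis using E0
        by (intro tendsto_mult tendsto_divide tendsto_const E2 LIMSEQ_ignore_initial_segment[OF E]) auto
    qed
    moreover have "\<forall>\<^sub>F N in sequentially. q ^ (Suc n)\<^sup>2 * (E (2 * N) / (E (N + Suc n) * E (N - Suc n))) = A n N"
      using eventually_gt_at_top[of n] by eventually_elim (simp add: A_def)
    ultimately have "(\<lambda>N. A n N) \<longlonglongrightarrow> q ^ (Suc n)\<^sup>2 * (E0 / (E0 * E0))"
      by (rule Lim_transform_eventually)
    moreover have "E0 / (E0 * E0) = 1 / E0" using E0 by simp
    ultimately show "(\<lambda>N. A n N) \<longlonglongrightarrow> q ^ (Suc n)\<^sup>2 * (1 / E0)" by (simp only:)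
  next
    show "\<forall>\<^sub>F (n, N) in at_top \<times>\<^sub>F sequentially. norm (A n N) \<le> q ^ (Suc n)\<^sup>2 * (1 / E0\<^sup>2)"
    proof (intro always_eventually allI, clarify)
      fix n N
      have "E (2 * N) / (E (N + Suc n) * E (N - Suc n)) \<le> 1 / (E0 * E0)"
        using mult_mono[OF Ege[of "N + Suc n"] Ege[of "N - Suc n"] less_imp_le[OF Epos] less_imp_le[OF E0]] E0
        by (intro frac_le[OF _ Ele]) auto
      then have "q ^ (Suc n)\<^sup>2 * (E (2 * N) / (E (N + Suc n) * E (N - Suc n))) \<le> q ^ (Suc n)\<^sup>2 * (1 / E0\<^sup>2)"
        unfolding power2_eq_square[of E0] using q by (intro mult_left_mono) auto
      moreover have "0 \<le> q ^ (Suc n)\<^sup>2 * (E (2 * N) / (E (N + Suc n) * E (N - Suc n)))"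
        using q less_imp_le[OF Epos] by (intro mult_nonneg_nonneg divide_nonneg_nonneg) auto
      moreover have "0 \<le> q ^ (Suc n)\<^sup>2 * (1 / E0\<^sup>2)" using q by simp
      ultimately show "norm (A n N) \<le> q ^ (Suc n)\<^sup>2 * (1 / E0\<^sup>2)"
        unfolding A_def by (cases "n < N") (simp_all only: if_True if_False real_norm_def abs_of_nonneg abs_zero)
    qed
    show "summable (\<lambda>n. q ^ (Suc n)\<^sup>2 * (1 / E0\<^sup>2))"
    proof (rule summable_mult2)
      have "summable (\<lambda>n. exp (- pi * (real (Suc n))\<^sup>2 * t))" by (rule summable_theta[OF t])
      then show "summable (\<lambda>n. q ^ (Suc n)\<^sup>2)" unfolding qsq .
    qed
  qed simp
  have gb: "gauss_binom (q\<^sup>2) (2 * N) (N + i) = E (2 * N) / (E (N + i) * E (N - i))" if "i \<le> N" for N i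
    using gauss_binom_euler_prod[of "N + i" "2 * N" "q\<^sup>2"] that Epos[of "N + i"] Epos[of "N - i"]
    by (simp add: E_def field_simps)
  have eqn: "(\<Prod>k<N. 1 + q ^ (2 * k + 1))\<^sup>2 = E (2 * N) / (E N * E N) + 2 * (\<Sum>n. A n N)" for N
  proof -
    have "(\<Sum>n. A n N) = (\<Sum>n<N. q ^ (Suc n)\<^sup>2 * gauss_binom (q\<^sup>2) (2 * N) (N + Suc n))"
      by (subst suminf_finite[of "{..<N}"]) (auto simp: A_def gb simp del: add_Suc_right intro!: sum.cong)
    then show ?thesis using finite_triple_product[OF q, of N] gb[of 0 N] by simp
  qed
  have "(\<lambda>N. (\<Prod>k<N. 1 + q ^ (2 * k + 1))\<^sup>2) \<longlonglongrightarrow> (E0 * E0 / (exp (- euler_log (4 * t)) * exp (- euler_log t)))\<^sup>2"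
    unfolding prod_odd_plus[OF q] E_def[symmetric]
  proof (intro tendsto_power tendsto_mult tendsto_divide E E2)
    show "(\<lambda>N. euler_prod (q ^ 4) N) \<longlonglongrightarrow> exp (- euler_log (4 * t))"
      unfolding q4 using t by (intro euler_prod_tendsto) simp
    show "(\<lambda>N. euler_prod q (2 * N)) \<longlonglongrightarrow> exp (- euler_log t)"
      unfolding q_def using t by (intro two euler_prod_tendsto)
  qed auto
  moreover have "(\<lambda>N. E (2 * N) / (E N * E N) + 2 * (\<Sum>n. A n N)) \<longlonglongrightarrow> E0 / (E0 * E0) + 2 * (\<Sum>n. q ^ (Suc n)\<^sup>2 * (1 / E0))"
    using E0 by (intro tendsto_add tendsto_mult tendsto_divide tendsto_const E E2 lim1) auto
  ultimately have "(E0 * E0 / (exp (- euler_log (4 * t)) * exp (- euler_log t)))\<^sup>2 = E0 / (E0 * E0) + 2 * (\<Sum>n. q ^ (Suc n)\<^sup>2 * (1 / E0))"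
    unfolding eqn by (rule LIMSEQ_unique)
  moreover have "(\<Sum>n. q ^ (Suc n)\<^sup>2 * (1 / E0)) = (\<Sum>n. exp (- pi * (real (Suc n))\<^sup>2 * t)) * (1 / E0)"
  proof -
    show ?thesis unfolding qsq by (rule suminf_mult2[OF summable_theta[OF t], symmetric])
  qed
  ultimately have "theta t = E0 * (E0 * E0 / (exp (- euler_log (4 * t)) * exp (- euler_log t)))\<^sup>2"
    using E0 t by (simp add: theta_eq field_simps)
  also have "\<dots> = exp (2 * euler_log t - 5 * euler_log (2 * t) + 2 * euler_log (4 * t))"
    unfolding E0_def power2_eq_square exp_add[symmetric] exp_diff[symmetric] by (simp add: algebra_simps)
  finally show ?thesis .
qed

section \<open>Laplace transforms\<close>

text \<open>The slack \<open>\<delta>\<close> in the exponential moment absorbs both the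
  perturbation of the parameters and the polynomial factors from differentiation. Since
  \<open>\<bar>exp \<zeta> - 1 - \<zeta>\<bar> \<le> \<bar>\<zeta>\<bar>^2 * exp
  \<bar>\<zeta>\<bar>\<close>, the remainder is quadratic in the displacement. The derivative is
  taken jointly in both variables because \<open>entire2\<close> asks for that.\<close>

lemma laplace_has_derivative:
  fixes p q k :: "'a \<Rightarrow> real" and w s :: complex
  defines "F \<equiv> \<lambda>w s x. of_real (k x) * exp (w * of_real (p x) + s * of_real (q x))"
  assumes [measurable]: "p \<in> borel_measurable M" "q \<in> borel_measurable M" "k \<in> borel_measurable M"
    and \<delta>: "\<delta> > 0"
    and int: "integrable M (\<lambda>x. \<bar>k x\<bar> * exp (Re w * p x + Re s * q x + \<delta> * (\<bar>p x\<bar> + \<bar>q x\<bar>)))"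
  shows "integrable M (F w s)"
    and "integrable M (\<lambda>x. of_real (q x) * F w s x)"
    and "((\<lambda>(w, s). \<integral>x. F w s x \<partial>M) has_derivative
      (\<lambda>(h, l). (\<integral>x. of_real (p x) * F w s x \<partial>M) * h + (\<integral>x. of_real (q x) * F w s x \<partial>M) * l)) (at (w, s))"
proof -
  define y where "y x = \<bar>p x\<bar> + \<bar>q x\<bar>" for x
  define G where "G x = \<bar>k x\<bar> * exp (Re w * p x + Re s * q x + \<delta> * y x)" for x
  have y0: "0 \<le> y x" for x by (simp add: y_def)
  have [measurable]: "F w s \<in> borel_measurable M" for w s unfolding F_def by measurable
  have [measurable]: "y \<in> borel_measurable M" unfolding y_def by measurable
  have intG: "integrable M G" using int unfolding G_def y_def by simp
  have nF: "norm (F w' s' x) = \<bar>k x\<bar> * exp (Re w' * p x + Re s' * q x)" for w' s' x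
    by (simp add: F_def norm_mult)
  have near: "integrable M (F w' s')" if "norm (w' - w) \<le> \<delta>" "norm (s' - s) \<le> \<delta>" for w' s'
  proof (rule Bochner_Integration.integrable_bound[OF intG])
    show "AE x in M. norm (F w' s' x) \<le> norm (G x)"
    proof (rule AE_I2)
      fix x
      have "\<bar>Re (w' - w) * p x\<bar> \<le> \<delta> * \<bar>p x\<bar>" "\<bar>Re (s' - s) * q x\<bar> \<le> \<delta> * \<bar>q x\<bar>"
        using that abs_Re_le_cmod[of "w' - w"] abs_Re_le_cmod[of "s' - s"]
        by (auto simp only: abs_mult intro!: mult_right_mono)
      then have "Re w' * p x + Re s' * q x \<le> Re w * p x + Re s * q x + \<delta> * y x"
        by (simp add: y_def algebra_simps abs_le_iff)
      then show "norm (F w' s' x) \<le> norm (G x)" unfolding nF G_def by (simp add: abs_mult mult_left_mono)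
    qed
  qed simp
  show i0: "integrable M (F w s)" using near[of w s] \<delta> by simp
  have sq: "(y x)\<^sup>2 \<le> 8 / \<delta>\<^sup>2 * exp (\<delta> * y x / 2)" for x
  proof -
    have "(\<delta> * y x / 2)\<^sup>2 / 2 \<le> exp (\<delta> * y x / 2)"
      using exp_lower_Taylor_quadratic[of "\<delta> * y x / 2"] mult_nonneg_nonneg[OF less_imp_le[OF \<delta>] y0[of x]] by linarith
    then show ?thesis using \<delta> by (simp add: field_simps power2_eq_square)
  qed
  have lin: "y x \<le> 1 / \<delta> * exp (\<delta> * y x)" for x
  proof -
    have "\<delta> * y x \<le> exp (\<delta> * y x)" using exp_ge_add_one_self[of "\<delta> * y x"] by linarith
    then show ?thesis using \<delta> by (simp add: field_simps)
  qed
  have intP: "integrable M (\<lambda>x. of_real (v x) * F w s x)" if "\<And>x. \<bar>v x\<bar> \<le> y x" "v \<in> borel_measurable M" for v :: "'a \<Rightarrow> real"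
  proof (rule Bochner_Integration.integrable_bound[OF integrable_mult_right[OF intG, of "1 / \<delta>"]])
    show "AE x in M. norm (of_real (v x) * F w s x) \<le> norm (1 / \<delta> * G x)"
    proof (rule AE_I2)
      fix x
      have "norm (of_real (v x) * F w s x) = \<bar>v x\<bar> * (\<bar>k x\<bar> * exp (Re w * p x + Re s * q x))"
        by (simp add: norm_mult nF)
      also have "\<dots> \<le> (1 / \<delta> * exp (\<delta> * y x)) * (\<bar>k x\<bar> * exp (Re w * p x + Re s * q x))"
        using that(1)[of x] lin[of x] by (intro mult_right_mono) auto
      also have "\<dots> = norm (1 / \<delta> * G x)" using \<delta> by (simp add: G_def exp_add abs_mult)
      finally show "norm (of_real (v x) * F w s x) \<le> norm (1 / \<delta> * G x)" .
    qed
  qed (use that(2) in measurable)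
  have ip: "integrable M (\<lambda>x. of_real (p x) * F w s x)" by (rule intP) (auto simp: y_def)
  show iq: "integrable M (\<lambda>x. of_real (q x) * F w s x)" by (rule intP) (auto simp: y_def)
  \<comment> \<open>\<open>32 = 4 * 8\<close>: the 8 is from the bound \<open>sq\<close> on
    \<open>y^2\<close>, the 4 is a generous constant in
    \<open>(norm \<zeta>)^2 \<le> 4 * n^2 * y^2\<close>. The radius \<open>\<delta> / 4\<close>
    keeps \<open>exp (norm \<zeta>)\<close> within half of the slack; \<open>sq\<close> takes the
    other half.\<close>
  define K where "K = 32 / \<delta>\<^sup>2 * (\<integral>x. G x \<partial>M)"
  show "((\<lambda>(w, s). \<integral>x. F w s x \<partial>M) has_derivative
      (\<lambda>(h, l). (\<integral>x. of_real (p x) * F w s x \<partial>M) * h + (\<integral>x. of_real (q x) * F w s x \<partial>M) * l)) (at (w, s))"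
  proof (rule has_derivativeI_sandwich[where e = "\<delta> / 4" and H = "\<lambda>z. K * norm (z - (w, s))"])
    show "bounded_linear (\<lambda>(h, l). (\<integral>x. of_real (p x) * F w s x \<partial>M) * h + (\<integral>x. of_real (q x) * F w s x \<partial>M) * l)"
      unfolding case_prod_beta by (intro bounded_linear_intros)
    show "((\<lambda>z. K * norm (z - (w, s))) \<longlongrightarrow> 0) (at (w, s))"
      by (rule tendsto_eq_intros refl)+ simp
    show "\<delta> / 4 > 0" using \<delta> by simp
    fix z :: "complex \<times> complex" assume z: "z \<noteq> (w, s)" "dist z (w, s) < \<delta> / 4"
    obtain w' s' where zz: "z = (w', s')" by (cases z)
    define h l where "h = w' - w" and "l = s' - s"
    define n where "n = norm (z - (w, s))"
    have hn: "norm h \<le> n" "norm l \<le> n" unfolding n_def zz h_def l_def using norm_fst_le norm_snd_le by force+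
    have n: "0 < n" "n < \<delta> / 4" using z by (auto simp: n_def dist_norm)
    have i1: "integrable M (F w' s')" using hn n by (intro near) (auto simp: h_def l_def)
    have eq: "(\<integral>x. F w' s' x \<partial>M) - (\<integral>x. F w s x \<partial>M) - ((\<integral>x. of_real (p x) * F w s x \<partial>M) * h + (\<integral>x. of_real (q x) * F w s x \<partial>M) * l)
       = (\<integral>x. F w' s' x - F w s x - (of_real (p x) * F w s x * h + of_real (q x) * F w s x * l) \<partial>M)"
      using i0 i1 ip iq by simp
    have "norm ((\<integral>x. F w' s' x \<partial>M) - (\<integral>x. F w s x \<partial>M) - ((\<integral>x. of_real (p x) * F w s x \<partial>M) * h + (\<integral>x. of_real (q x) * F w s x \<partial>M) * l))
        \<le> (\<integral>x. norm (F w' s' x - F w s x - (of_real (p x) * F w s x * h + of_real (q x) * F w s x * l)) \<partial>M)"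
      unfolding eq by (rule integral_norm_bound)
    also have "\<dots> \<le> (\<integral>x. 32 / \<delta>\<^sup>2 * n\<^sup>2 * G x \<partial>M)"
    proof (rule integral_mono)
      show "integrable M (\<lambda>x. norm (F w' s' x - F w s x - (of_real (p x) * F w s x * h + of_real (q x) * F w s x * l)))"
        using i0 i1 ip iq by simp
      show "integrable M (\<lambda>x. 32 / \<delta>\<^sup>2 * n\<^sup>2 * G x)" using intG by simp
      fix x
      define \<zeta> where "\<zeta> = h * of_real (p x) + l * of_real (q x)"
      have n\<zeta>: "norm \<zeta> \<le> n * y x"
      proof -
        have "norm \<zeta> \<le> norm h * \<bar>p x\<bar> + norm l * \<bar>q x\<bar>"
          unfolding \<zeta>_def by (rule order_trans[OF norm_triangle_ineq]) (simp add: norm_mult)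
        also have "\<dots> \<le> n * \<bar>p x\<bar> + n * \<bar>q x\<bar>" using hn by (intro add_mono mult_right_mono) auto
        finally show ?thesis by (simp add: y_def algebra_simps)
      qed
      have w: "w' * of_real (p x) + s' * of_real (q x) = (w * of_real (p x) + s * of_real (q x)) + \<zeta>"
        by (simp add: \<zeta>_def h_def l_def algebra_simps)
      have "F w' s' x = F w s x * exp \<zeta>" unfolding F_def w by (simp only: exp_add[of _ \<zeta>] mult.assoc)
      then have "F w' s' x - F w s x - (of_real (p x) * F w s x * h + of_real (q x) * F w s x * l) = F w s x * (exp \<zeta> - (1 + \<zeta>))"
        by (simp add: \<zeta>_def algebra_simps)
      then have nn: "norm (F w' s' x - F w s x - (of_real (p x) * F w s x * h + of_real (q x) * F w s x * l))
          = norm (F w s x) * norm (exp \<zeta> - (1 + \<zeta>))" by (simp only: norm_mult)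
      have "norm (exp \<zeta> - (1 + \<zeta>)) \<le> exp (norm \<zeta>) * (norm \<zeta>)\<^sup>2"
        using Taylor_exp_field[of \<zeta> 1] by (simp add: power2_eq_square)
      also have "\<dots> \<le> exp (\<delta> * y x / 2) * (4 * n\<^sup>2 * (y x)\<^sup>2)"
      proof (rule mult_mono)
        have "n * y x \<le> \<delta> / 4 * y x" using n y0[of x] by (intro mult_right_mono) auto
        also have "\<dots> \<le> \<delta> * y x / 2" using \<delta> y0[of x] by simp
        finally show "exp (norm \<zeta>) \<le> exp (\<delta> * y x / 2)" using n\<zeta> by simp
        have "(norm \<zeta>)\<^sup>2 \<le> (n * y x)\<^sup>2" using n\<zeta> by (intro power_mono) auto
        also have "\<dots> \<le> 4 * n\<^sup>2 * (y x)\<^sup>2" by (simp add: power_mult_distrib)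
        finally show "(norm \<zeta>)\<^sup>2 \<le> 4 * n\<^sup>2 * (y x)\<^sup>2" .
      qed auto
      also have "\<dots> \<le> exp (\<delta> * y x / 2) * (4 * n\<^sup>2 * (8 / \<delta>\<^sup>2 * exp (\<delta> * y x / 2)))"
        using sq[of x] by (intro mult_left_mono) auto
      also have "\<dots> = 32 / \<delta>\<^sup>2 * n\<^sup>2 * exp (\<delta> * y x)"
        by (simp add: exp_add[symmetric] mult.assoc[symmetric])
      finally have "norm (exp \<zeta> - (1 + \<zeta>)) \<le> 32 / \<delta>\<^sup>2 * n\<^sup>2 * exp (\<delta> * y x)" .
      from mult_left_mono[OF this norm_ge_zero[of "F w s x"]]
      show "norm (F w' s' x - F w s x - (of_real (p x) * F w s x * h + of_real (q x) * F w s x * l)) \<le> 32 / \<delta>\<^sup>2 * n\<^sup>2 * G x"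
        unfolding nn nF G_def exp_add by (simp only: mult_ac)
    qed
    also have "\<dots> = K * n * n" by (simp add: K_def power2_eq_square)
    finally show "norm ((case z of (w, s) \<Rightarrow> \<integral>x. F w s x \<partial>M) - (case (w, s) of (w, s) \<Rightarrow> \<integral>x. F w s x \<partial>M) -
       (case z - (w, s) of (h, l) \<Rightarrow> (\<integral>x. of_real (p x) * F w s x \<partial>M) * h + (\<integral>x. of_real (q x) * F w s x \<partial>M) * l)) /
       norm (z - (w, s)) \<le> K * norm (z - (w, s))"
      using n unfolding n_def[symmetric] by (simp add: zz h_def l_def divide_le_eq)
  qed
qed

text \<open>The case \<open>p = 0\<close>, restricted to the second variable.\<close>

lemma laplace_has_field_derivative:
  fixes q k :: "'a \<Rightarrow> real" and s :: complex
  assumes meas: "q \<in> borel_measurable M" "k \<in> borel_measurable M"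
    and "\<delta> > 0" "integrable M (\<lambda>x. \<bar>k x\<bar> * exp (Re s * q x + \<delta> * \<bar>q x\<bar>))"
  shows "integrable M (\<lambda>x. of_real (k x) * exp (s * of_real (q x)))"
    and "((\<lambda>s. \<integral>x. of_real (k x) * exp (s * of_real (q x)) \<partial>M) has_field_derivative
      (\<integral>x. of_real (q x) * (of_real (k x) * exp (s * of_real (q x))) \<partial>M)) (at s)"
proof -
  note L = laplace_has_derivative[of "\<lambda>_. 0" M q k \<delta> 0 s, simplified, OF meas assms(3,4)]
  show "integrable M (\<lambda>x. of_real (k x) * exp (s * of_real (q x)))" by (rule L(1))
  have "((\<lambda>s. (0::complex, s)) has_derivative (\<lambda>h. (0, h))) (at s)"
    by (intro derivative_intros)
  from has_derivative_compose[OF this L(3)]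
  show "((\<lambda>s. \<integral>x. of_real (k x) * exp (s * of_real (q x)) \<partial>M) has_field_derivative
      (\<integral>x. of_real (q x) * (of_real (k x) * exp (s * of_real (q x))) \<partial>M)) (at s)"
    by (simp add: has_field_derivative_def)
qed

section \<open>Translation, reflection and folding of integrals on the line\<close>

lemma integrable_translate:
  fixes f :: "real \<Rightarrow> 'a :: {banach, second_countable_topology}"
  shows "integrable lborel f \<Longrightarrow> integrable lborel (\<lambda>x. f (x + t))"
  using lborel_integrable_real_affine[of f 1 t] by (simp add: add.commute)

lemma integral_translate:
  fixes f :: "real \<Rightarrow> 'a :: {banach, second_countable_topology}"
  shows "(\<integral>x. f (x + t) \<partial>lborel) = (\<integral>x. f x \<partial>lborel)"
  using lborel_integral_real_affine[of 1 f t] by (simp add: add.commute)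

lemma integrable_reflect_lborel:
  fixes f :: "real \<Rightarrow> 'a :: {banach, second_countable_topology}"
  shows "integrable lborel f \<Longrightarrow> integrable lborel (\<lambda>x. f (- x))"
  using lborel_integrable_real_affine[of f "-1" 0] by simp

lemma integral_reflect_lborel:
  fixes f :: "real \<Rightarrow> 'a :: {banach, second_countable_topology}"
  shows "(\<integral>x. f (- x) \<partial>lborel) = (\<integral>x. f x \<partial>lborel)"
  using lborel_integral_real_affine[of "-1" f 0] by simp

lemma AE_neq_0_lborel: "AE x in lborel. x \<noteq> (0::real)"
  by (rule AE_lborel_singleton)

lemma integral_fold:
  fixes f :: "real \<Rightarrow> 'a :: {banach, second_countable_topology}"
  assumes f: "integrable lborel f"
  shows "set_integrable lborel {0<..} f" "set_integrable lborel {0<..} (\<lambda>x. f (- x))"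
    and "(\<integral>x. f x \<partial>lborel) = (LINT x:{0<..}|lborel. f x + f (- x))"
proof -
  have [measurable]: "f \<in> borel_measurable borel" using f by auto
  show a: "set_integrable lborel {0<..} f"
    unfolding set_integrable_def using f by (rule integrable_mult_indicator[rotated]) simp
  show b: "set_integrable lborel {0<..} (\<lambda>x. f (- x))"
    unfolding set_integrable_def using integrable_reflect_lborel[OF f] by (rule integrable_mult_indicator[rotated]) simp
  have c: "set_integrable lborel {..<0} f"
    unfolding set_integrable_def using f by (rule integrable_mult_indicator[rotated]) simp
  have "(\<integral>x. f x \<partial>lborel) = (\<integral>x. indicator {0<..} x *\<^sub>R f x + indicator {..<0} x *\<^sub>R f x \<partial>lborel)"
    by (rule integral_cong_AE) (use AE_neq_0_lborel in \<open>auto simp: indicator_def\<close>)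
  also have "\<dots> = (LINT x:{0<..}|lborel. f x) + (\<integral>x. indicator {..<0} x *\<^sub>R f x \<partial>lborel)"
    using a c unfolding set_integrable_def set_lebesgue_integral_def by simp
  also have "(\<integral>x. indicator {..<0} x *\<^sub>R f x \<partial>lborel) = (\<integral>x. indicator {..<0} (- x) *\<^sub>R f (- x) \<partial>lborel)"
    by (rule integral_reflect_lborel[symmetric])
  also have "\<dots> = (LINT x:{0<..}|lborel. f (- x))"
    unfolding set_lebesgue_integral_def by (simp add: indicator_def)
  finally show "(\<integral>x. f x \<partial>lborel) = (LINT x:{0<..}|lborel. f x + f (- x))"
    using set_integral_add(2)[OF a b] by simp
qed

lemma integrable_unfold:
  fixes f :: "real \<Rightarrow> 'a :: {banach, second_countable_topology}"
  assumes "f \<in> borel_measurable borel" "set_integrable lborel {0<..} f" "set_integrable lborel {0<..} (\<lambda>x. f (- x))"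
  shows "integrable lborel f"
proof -
  have [measurable]: "f \<in> borel_measurable borel" by fact
  have c: "integrable lborel (\<lambda>x. indicator {..<0} x *\<^sub>R f x)"
    using integrable_reflect_lborel[OF assms(3)[unfolded set_integrable_def]] by (simp add: indicator_def)
  have "integrable lborel (\<lambda>x. indicator {0<..} x *\<^sub>R f x + indicator {..<0} x *\<^sub>R f x)"
    using c assms(2) unfolding set_integrable_def by simp
  then show ?thesis
    by (rule integrable_cong_AE_imp) (use AE_neq_0_lborel in \<open>auto simp: indicator_def\<close>)
qed

lemma set_integrable_exp_neg: "a > 0 \<Longrightarrow> set_integrable lborel {0<..} (\<lambda>r::real. exp (- a * r))"
proof -
  assume a: "a > 0"
  have "((\<lambda>r. exp (- a * r)) has_integral exp (- a * 0) / a) {0..}"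
    using has_integral_exp_minus_to_infinity[OF a, of 0] by simp
  then have "(\<lambda>r. exp (- a * r)) absolutely_integrable_on {0..}"
    by (intro nonnegative_absolutely_integrable_1) (auto simp: has_integral_integrable)
  then have "set_integrable lborel {0..} (\<lambda>r. exp (- a * r))"
    unfolding set_integrable_def by (subst (asm) integrable_completion) auto
  then show ?thesis by (rule set_integrable_subset) auto
qed

lemma set_integrable_exp_bound:
  fixes f :: "real \<Rightarrow> 'a :: {banach, second_countable_topology}"
  assumes [measurable]: "f \<in> borel_measurable borel" and a: "a > 0"
    and bd: "\<And>r. r > 0 \<Longrightarrow> norm (f r) \<le> K * exp (- a * r)"
  shows "set_integrable lborel {0<..} f"
proof (rule set_integrable_bound[where f = "\<lambda>r. K * exp (- a * r)"])
  show "set_integrable lborel {0<..} (\<lambda>r. K * exp (- a * r))"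
    using set_integrable_exp_neg[OF a] by (rule set_integrable_mult_right)
  show "set_borel_measurable lborel {0<..} f" unfolding set_borel_measurable_def by measurable
  show "AE r in lborel. r \<in> {0<..} \<longrightarrow> norm (f r) \<le> norm (K * exp (- a * r))"
    using bd by (intro AE_I2) (force intro: order_trans)
qed

lemma FTC_Ioi:
  fixes F f :: "real \<Rightarrow> complex"
  assumes "\<And>x. x > 0 \<Longrightarrow> (F has_vector_derivative f x) (at x)" "\<And>x. x > 0 \<Longrightarrow> isCont f x"
    "set_integrable lborel {0<..} f" "isCont F 0" "(F \<longlongrightarrow> B) at_top"
  shows "(LINT x:{0<..}|lborel. f x) = B - F 0"
proof -
  have e: "einterval (ereal 0) \<infinity> = {0<..}" by (auto simp: einterval_def)
  have "(LBINT x=ereal 0..\<infinity>. f x) = B - F 0"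
  proof (rule interval_integral_FTC_integrable)
    show "((F \<circ> real_of_ereal) \<longlongrightarrow> F 0) (at_right (ereal 0))"
      unfolding ereal_tendsto_simps1 using assms(4) by (auto simp: continuous_at intro: tendsto_within_subset)
    show "((F \<circ> real_of_ereal) \<longlongrightarrow> B) (at_left \<infinity>)"
      unfolding ereal_tendsto_simps1 using assms(5) by simp
  qed (use assms e in auto)
  then show ?thesis by (simp add: interval_integral_to_infinity_eq)
qed

text \<open>These two integrals are the sources of the pole terms: \<open>1 / z\<close> comes from
  the constants split off from theta and its powers, \<open>1 / z^2\<close> from the summand
  \<open>r\<close> in \<open>log_theta (- r) = log_theta r + r\<close>.\<close>

lemma integral_exp_neg_complex:
  assumes z: "Re z > 0"
  shows "set_integrable lborel {0<..} (\<lambda>r. exp (- z * of_real r))"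
    and "(LINT r:{0<..}|lborel. exp (- z * of_real r)) = 1 / z"
    and "set_integrable lborel {0<..} (\<lambda>r. of_real r * exp (- z * of_real r))"
    and "(LINT r:{0<..}|lborel. of_real r * exp (- z * of_real r)) = 1 / z\<^sup>2"
proof -
  have z0: "z \<noteq> 0" using z by auto
  show a: "set_integrable lborel {0<..} (\<lambda>r. exp (- z * of_real r))"
    by (rule set_integrable_exp_bound[where K=1, OF _ z]) auto
  have lim0: "((\<lambda>r. exp (- z * of_real r)) \<longlongrightarrow> 0) at_top"
  proof (rule tendsto_norm_zero_cancel)
    show "((\<lambda>r. norm (exp (- z * of_real r))) \<longlongrightarrow> 0) at_top"
      using z by (simp del: exp_minus) real_asymp
  qed
  have lim1: "((\<lambda>r. of_real r * exp (- z * of_real r)) \<longlongrightarrow> 0) at_top"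
  proof (rule tendsto_norm_zero_cancel)
    show "((\<lambda>r. norm (of_real r * exp (- z * of_real r))) \<longlongrightarrow> 0) at_top"
      using z by (simp add: norm_mult) real_asymp
  qed
  have "(LINT r:{0<..}|lborel. exp (- z * of_real r)) = - 0 / z - (- exp (- z * of_real 0) / z)"
  proof (rule FTC_Ioi[OF _ _ a])
    show "((\<lambda>r. - exp (- z * of_real r) / z) \<longlongrightarrow> - 0 / z) at_top"
      using z0 by (intro tendsto_intros lim0)
  qed (use z0 in \<open>auto intro!: derivative_eq_intros has_vector_derivative_real_field continuous_intros\<close>)
  then show "(LINT r:{0<..}|lborel. exp (- z * of_real r)) = 1 / z" by simp
  show b: "set_integrable lborel {0<..} (\<lambda>r. of_real r * exp (- z * of_real r))"
  proof (rule set_integrable_exp_bound)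
    show "Re z / 2 > 0" using z by simp
    fix r :: real assume r: "r > 0"
    have "r * Re z / 2 \<le> exp (r * Re z / 2)" using exp_ge_add_one_self[of "r * Re z / 2"] by linarith
    then have "r \<le> 2 / Re z * exp (Re z / 2 * r)" using z by (simp add: field_simps)
    then have "r * exp (- Re z * r) \<le> 2 / Re z * exp (Re z / 2 * r) * exp (- Re z * r)" by (rule mult_right_mono) simp
    also have "\<dots> = 2 / Re z * exp (- (Re z / 2) * r)" by (simp add: exp_add[symmetric] mult.assoc)
    finally show "norm (of_real r * exp (- z * of_real r)) \<le> 2 / Re z * exp (- (Re z / 2) * r)"
      using r by (simp add: norm_mult)
  qed auto
  have "(LINT r:{0<..}|lborel. of_real r * exp (- z * of_real r)) =
     (- 0 / z - 0 / z\<^sup>2) - (- (of_real 0 * exp (- z * of_real 0)) / z - exp (- z * of_real 0) / z\<^sup>2)"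
  proof (rule FTC_Ioi[OF _ _ b])
    show "((\<lambda>r. - (of_real r * exp (- z * of_real r)) / z - exp (- z * of_real r) / z\<^sup>2) \<longlongrightarrow> - 0 / z - 0 / z\<^sup>2) at_top"
      using z0 by (intro tendsto_intros lim0 lim1) auto
    fix x :: real
    show "((\<lambda>r. - (of_real r * exp (- z * of_real r)) / z - exp (- z * of_real r) / z\<^sup>2) has_vector_derivative of_real x * exp (- z * of_real x)) (at x)"
      using z0 by (auto intro!: derivative_eq_intros has_vector_derivative_real_field simp: field_simps power2_eq_square)
  qed (use z0 in \<open>auto intro!: continuous_intros\<close>)
  then show "(LINT r:{0<..}|lborel. of_real r * exp (- z * of_real r)) = 1 / z\<^sup>2" by simp
qed

section \<open>The completed zeta function\<close>

lemma Gamma_mellin: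
  assumes s: "Re s > 0"
  shows "integrable lborel (\<lambda>x. of_real (exp (- exp x)) * exp (s * of_real x))"
    and "(\<integral>x. of_real (exp (- exp x)) * exp (s * of_real x) \<partial>lborel) = Gamma s"
proof -
  define g where "g t = of_real (exp (- t)) * (of_real t powr s :: complex)" for t :: real
  have [measurable]: "g \<in> borel_measurable borel" unfolding g_def by measurable
  have gexp: "g (exp x) = of_real (exp (- exp x)) * exp (s * of_real x)" for x
    by (simp add: g_def powr_def exp_of_real[symmetric] Ln_exp)
  have eq: "g t /\<^sub>R t = of_real t powr (s - 1) / of_real (exp t)" if "t > 0" for t
    using that by (simp add: g_def powr_diff exp_minus scaleR_conv_of_real field_simps)
  have abs: "set_integrable lebesgue {0<..} (\<lambda>t. g t /\<^sub>R t)"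
    using absolutely_integrable_Gamma_integral'[OF s] by (rule set_integrable_cong[THEN iffD1, rotated 3]) (auto simp: eq)
  then have int: "set_integrable lborel {0<..} (\<lambda>t. g t /\<^sub>R t)"
    unfolding set_integrable_def by (subst (asm) integrable_completion) auto
  then show "integrable lborel (\<lambda>x. of_real (exp (- exp x)) * exp (s * of_real x))"
    using integrable_exp_substitution[of g] by (simp add: gexp)
  have "((\<lambda>t. g t /\<^sub>R t) has_integral (LINT t:{0<..}|lebesgue. g t /\<^sub>R t)) {0<..}"
    using abs by (rule has_integral_set_lebesgue)
  moreover have "((\<lambda>t. g t /\<^sub>R t) has_integral Gamma s) {0<..}"
    using Gamma_integral_complex'[OF s] by (rule has_integral_eq[rotated]) (auto simp: eq)
  ultimately have "(LINT t:{0<..}|lebesgue. g t /\<^sub>R t) = Gamma s" by (rule has_integral_unique)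
  moreover have "(LINT t:{0<..}|lebesgue. g t /\<^sub>R t) = (LINT t:{0<..}|lborel. g t /\<^sub>R t)"
    unfolding set_lebesgue_integral_def by (rule integral_completion) measurable
  ultimately show "(\<integral>x. of_real (exp (- exp x)) * exp (s * of_real x) \<partial>lborel) = Gamma s"
    using integral_exp_substitution[of g] by (simp add: gexp)
qed

text \<open>The substitution \<open>x = ln pi + \<kappa> * r\<close> in the Gamma integral. Theta,
  taken at \<open>exp (2 * r)\<close>, needs \<open>\<kappa> = 2\<close>; the logarithm of the Euler
  product needs \<open>\<kappa> = 1\<close>.\<close>

lemma Gamma_mellin_pi:
  fixes s :: complex and \<kappa> :: real
  assumes s: "Re s > 0" and \<kappa>: "\<kappa> > 0"
  shows "integrable lborel (\<lambda>r. of_real (exp (- pi * exp (\<kappa> * r))) * exp (s * of_real r))"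
    and "(\<integral>r. of_real (exp (- pi * exp (\<kappa> * r))) * exp (s * of_real r) \<partial>lborel) =
      of_real pi powr (- s / of_real \<kappa>) * Gamma (s / of_real \<kappa>) / of_real \<kappa>"
proof -
  define s' where "s' = s / of_real \<kappa>"
  have s': "Re s' > 0" using s \<kappa> by (simp add: s'_def)
  define f where "f x = of_real (exp (- exp x)) * exp (s' * of_real x)" for x :: real
  define P where "P = exp (s' * of_real (ln pi))"
  have P: "P \<noteq> 0" by (simp add: P_def)
  have fe: "f (ln pi + \<kappa> * r) = P * (of_real (exp (- pi * exp (\<kappa> * r))) * exp (s * of_real r))" for r
  proof -
    have "s' * of_real (ln pi + \<kappa> * r) = s' * of_real (ln pi) + s * of_real r"
      using \<kappa> by (simp add: s'_def field_simps)
    moreover have "exp (ln pi + \<kappa> * r) = pi * exp (\<kappa> * r)" by (simp add: exp_add)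
    ultimately show ?thesis unfolding f_def P_def by (simp only: exp_add) simp
  qed
  have intf: "integrable lborel f" unfolding f_def by (rule Gamma_mellin(1)[OF s'])
  have "integrable lborel (\<lambda>r. f (ln pi + \<kappa> * r))"
    using lborel_integrable_real_affine[OF intf, of \<kappa> "ln pi"] \<kappa> by simp
  then show "integrable lborel (\<lambda>r. of_real (exp (- pi * exp (\<kappa> * r))) * exp (s * of_real r))"
    using P integrable_mult_right[of "inverse P" lborel "\<lambda>r. f (ln pi + \<kappa> * r)"]
    by (simp add: fe mult.assoc[symmetric])
  have "Gamma s' = \<kappa> *\<^sub>R (\<integral>r. f (ln pi + \<kappa> * r) \<partial>lborel)"
    using lborel_integral_real_affine[of \<kappa> f "ln pi"] \<kappa> Gamma_mellin(2)[OF s'] by (simp add: f_def)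
  also have "\<dots> = of_real \<kappa> * P * (\<integral>r. of_real (exp (- pi * exp (\<kappa> * r))) * exp (s * of_real r) \<partial>lborel)"
    unfolding fe by (simp only: integral_mult_right_zero scaleR_conv_of_real mult.assoc)
  finally have "(\<integral>r. of_real (exp (- pi * exp (\<kappa> * r))) * exp (s * of_real r) \<partial>lborel) = Gamma s' / (of_real \<kappa> * P)"
    using \<kappa> P by (simp add: field_simps)
  moreover have "of_real pi powr (- s / of_real \<kappa>) = inverse P"
    by (simp add: powr_def P_def s'_def exp_minus Ln_of_real flip: exp_minus)
  ultimately show "(\<integral>r. of_real (exp (- pi * exp (\<kappa> * r))) * exp (s * of_real r) \<partial>lborel) =
      of_real pi powr (- s / of_real \<kappa>) * Gamma (s / of_real \<kappa>) / of_real \<kappa>"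
    by (simp add: s'_def field_simps)
qed

text \<open>Dilation by \<open>n\<close> is the shift by \<open>ln n\<close>, which multiplies the
  transform by \<open>n powr (- s)\<close>; nonnegativity reduces the exchange of sum and integral
  to convergence of the norms. It yields the transforms of theta, of \<open>log_one_minus\<close>
  and of \<open>euler_log\<close>.\<close>

lemma mellin_sum:
  fixes c :: "real \<Rightarrow> real" and a :: "nat \<Rightarrow> real" and s :: complex
  assumes [measurable]: "c \<in> borel_measurable borel" and c0: "\<And>r. 0 \<le> c r" and a0: "\<And>n. 0 \<le> a n"
    and int: "integrable lborel (\<lambda>r. of_real (c r) * exp (s * of_real r))"
    and sm: "summable (\<lambda>n. a n * real (Suc n) powr (- Re s))"
    and pt: "\<And>r. summable (\<lambda>n. a n * c (r + ln (real (Suc n))))"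
  shows "integrable lborel (\<lambda>r. of_real (\<Sum>n. a n * c (r + ln (real (Suc n)))) * exp (s * of_real r))"
    and "(\<lambda>n. of_real (a n) / of_nat (Suc n) powr s * (\<integral>r. of_real (c r) * exp (s * of_real r) \<partial>lborel)) sums
      (\<integral>r. of_real (\<Sum>n. a n * c (r + ln (real (Suc n)))) * exp (s * of_real r) \<partial>lborel)"
proof -
  define g where "g r = of_real (c r) * exp (s * of_real r)" for r :: real
  define f where "f n r = of_real (a n * c (r + ln (real (Suc n)))) * exp (s * of_real r)" for n and r :: real
  have fe: "f n r = of_real (a n) * exp (- s * of_real (ln (real (Suc n)))) * g (r + ln (real (Suc n)))" for n r
    by (simp add: f_def g_def exp_add[symmetric] algebra_simps del: of_nat_Suc)
  have pw: "exp (- s * of_real (ln (real (Suc n)))) = 1 / of_nat (Suc n) powr s" for n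
    by (simp add: powr_def exp_minus Ln_of_nat divide_inverse del: of_nat_Suc)
  have intg: "integrable lborel g" using int unfolding g_def[abs_def] .
  have i: "integrable lborel (f n)" for n
    unfolding fe[abs_def] by (intro integrable_mult_right integrable_translate intg)
  have If: "integral\<^sup>L lborel (f n) = of_real (a n) / of_nat (Suc n) powr s * integral\<^sup>L lborel g" for n
    unfolding fe[abs_def] pw by (simp add: integral_translate[of g])
  have nf: "norm (f n r) = a n * exp (- Re s * ln (real (Suc n))) * norm (g (r + ln (real (Suc n))))" for n r
    unfolding fe using a0[of n] by (simp add: norm_mult)
  have In: "(\<integral>r. norm (f n r) \<partial>lborel) = a n * real (Suc n) powr (- Re s) * (\<integral>r. norm (g r) \<partial>lborel)" for n
    unfolding nf by (simp add: integral_translate[of "\<lambda>r. norm (g r)"] powr_def del: of_nat_Suc)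
  have s1: "AE r in lborel. summable (\<lambda>n. norm (f n r))"
  proof (rule AE_I2)
    fix r
    have "norm (f n r) = a n * c (r + ln (real (Suc n))) * exp (Re s * r)" for n
      using a0 c0 by (simp add: f_def norm_mult)
    then show "summable (\<lambda>n. norm (f n r))" using summable_mult2[OF pt[of r], of "exp (Re s * r)"] by simp
  qed
  have s2: "summable (\<lambda>n. \<integral>r. norm (f n r) \<partial>lborel)"
    unfolding In by (rule summable_mult2[OF sm])
  have fs: "(\<Sum>n. f n r) = of_real (\<Sum>n. a n * c (r + ln (real (Suc n)))) * exp (s * of_real r)" for r
  proof -
    have "(\<lambda>n. complex_of_real (a n * c (r + ln (real (Suc n))))) sums of_real (\<Sum>n. a n * c (r + ln (real (Suc n))))"
      by (intro sums_of_real summable_sums pt)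
    from sums_mult2[OF this, of "exp (s * of_real r)"] show ?thesis
      by (intro sums_unique[symmetric]) (simp add: f_def)
  qed
  show "integrable lborel (\<lambda>r. of_real (\<Sum>n. a n * c (r + ln (real (Suc n)))) * exp (s * of_real r))"
    using integrable_suminf[OF i s1 s2] unfolding fs .
  show "(\<lambda>n. of_real (a n) / of_nat (Suc n) powr s * (\<integral>r. of_real (c r) * exp (s * of_real r) \<partial>lborel)) sums
      (\<integral>r. of_real (\<Sum>n. a n * c (r + ln (real (Suc n)))) * exp (s * of_real r) \<partial>lborel)"
    using sums_integral[OF i s1 s2] unfolding fs If g_def[abs_def] .
qed

lemma continuous_theta_exp: "continuous_on UNIV (\<lambda>r. theta (exp (2 * r)))"
  by (rule continuous_on_compose2[OF continuous_on_theta]) (auto intro!: continuous_intros)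

lemma measurable_theta_exp [measurable]: "(\<lambda>r. theta (exp (2 * r))) \<in> borel_measurable borel"
  by (rule borel_measurable_continuous_onI[OF continuous_theta_exp])

lemma theta_exp_neg: "theta (exp (- (2 * r))) = exp r * theta (exp (2 * r))"
proof -
  have "sqrt (exp (2 * r)) = exp r" by (rule real_sqrt_unique) (auto simp: exp_double)
  then show ?thesis using theta_inverse[of "exp (2 * r)"] by (simp add: exp_minus divide_inverse)
qed

text \<open>The form with \<open>C * \<bar>r\<bar>\<close> is the hypothesis of the differentiation
  lemmas. The domination covers both theta minus 1 and \<open>log_theta\<close>.\<close>

lemma theta_dominated_moments:
  assumes [measurable]: "k \<in> borel_measurable borel"
    and k: "\<And>r. \<bar>k r\<bar> \<le> indicator {0<..} r * (theta (exp (2 * r)) - 1)"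
  shows "integrable lborel (\<lambda>r. \<bar>k r\<bar> * exp (x * r + C * \<bar>r\<bar>))"
proof -
  obtain K where K: "K > 0" "\<And>r. r \<ge> 0 \<Longrightarrow> exp ((x + C) * r) * (theta (exp (2 * r)) - 1) \<le> K * exp (- r)"
    using theta_exp_decay by blast
  have "set_integrable lborel {0<..} (\<lambda>r. \<bar>k r\<bar> * exp (x * r + C * \<bar>r\<bar>))"
  proof (rule set_integrable_exp_bound[where K=K and a=1])
    fix r :: real assume r: "r > 0"
    have "norm (\<bar>k r\<bar> * exp (x * r + C * \<bar>r\<bar>)) \<le> (theta (exp (2 * r)) - 1) * exp ((x + C) * r)"
      using k[of r] r by (simp add: abs_mult distrib_right mult_right_mono)
    also have "\<dots> \<le> K * exp (- 1 * r)" using K(2)[of r] r by (simp add: mult.commute)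
    finally show "norm (\<bar>k r\<bar> * exp (x * r + C * \<bar>r\<bar>)) \<le> K * exp (- 1 * r)" .
  qed auto
  moreover have "indicator {0<..} r *\<^sub>R (\<bar>k r\<bar> * exp (x * r + C * \<bar>r\<bar>)) = \<bar>k r\<bar> * exp (x * r + C * \<bar>r\<bar>)" for r
    using k[of r] by (cases "r > 0") auto
  ultimately show ?thesis unfolding set_integrable_def by (simp only:)
qed

text \<open>The indicator sits in the weight, so that the integral over the whole line is literally
  of the form differentiated in \<open>laplace_has_field_derivative\<close>.\<close>

definition half_laplace :: "(real \<Rightarrow> real) \<Rightarrow> complex \<Rightarrow> complex" where
  "half_laplace h z = (LINT r|lborel. of_real (indicator {0<..} r * h r) * exp (z * of_real r))"

lemma half_laplace:
  assumes [measurable]: "h \<in> borel_measurable borel"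
    and h: "\<And>r. r > 0 \<Longrightarrow> \<bar>h r\<bar> \<le> theta (exp (2 * r)) - 1"
  shows "integrable lborel (\<lambda>r. of_real (indicator {0<..} r * h r) * exp (z * of_real r))"
    and "set_integrable lborel {0<..} (\<lambda>r. of_real (h r) * exp (z * of_real r))"
    and "half_laplace h z = (LINT r:{0<..}|lborel. of_real (h r) * exp (z * of_real r))"
    and "half_laplace h holomorphic_on UNIV"
proof -
  have m: "integrable lborel (\<lambda>r. \<bar>indicator {0<..} r * h r\<bar> * exp (Re z * r + 1 * \<bar>r\<bar>))" for z
    by (rule theta_dominated_moments) (use h in \<open>auto simp: indicator_def\<close>)
  have D: "integrable lborel (\<lambda>r. of_real (indicator {0<..} r * h r) * exp (z * of_real r))"
      "\<exists>D. (half_laplace h has_field_derivative D) (at z)" for z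
    using laplace_has_field_derivative[of "\<lambda>r. r" lborel "\<lambda>r. indicator {0<..} r * h r" 1 z] m[of z]
    unfolding half_laplace_def[abs_def] by auto
  show "integrable lborel (\<lambda>r. of_real (indicator {0<..} r * h r) * exp (z * of_real r))" by (rule D(1))
  then show "set_integrable lborel {0<..} (\<lambda>r. of_real (h r) * exp (z * of_real r))"
    by (simp add: set_integrable_def scaleR_conv_of_real mult.assoc)
  show "half_laplace h z = (LINT r:{0<..}|lborel. of_real (h r) * exp (z * of_real r))"
    by (simp add: half_laplace_def set_lebesgue_integral_def scaleR_conv_of_real mult.assoc)
  show "half_laplace h holomorphic_on UNIV"
    using D(2) by (auto simp: holomorphic_on_def field_differentiable_def)
qed

abbreviation theta_half :: "complex \<Rightarrow> complex" where
  "theta_half \<equiv> half_laplace (\<lambda>r. theta (exp (2 * r)) - 1)"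

lemma theta_half:
  shows "set_integrable lborel {0<..} (\<lambda>r. of_real (theta (exp (2 * r)) - 1) * exp (z * of_real r))"
    and "theta_half z = (LINT r:{0<..}|lborel. of_real (theta (exp (2 * r)) - 1) * exp (z * of_real r))"
    and "theta_half holomorphic_on UNIV"
  by (rule half_laplace; use theta_ge_1 in auto)+

lemma theta_half_holomorphic [holomorphic_intros]:
  "f holomorphic_on A \<Longrightarrow> (\<lambda>s. theta_half (f s)) holomorphic_on A"
  using holomorphic_on_compose_gen[of f A theta_half UNIV] theta_half(3) by (simp add: o_def)

section \<open>Riemann's continuation of the zeta function\<close>

text \<open>Riemann's symmetric formula: the Mellin integral of theta split at \<open>r = 0\<close>,
  with the two polar terms separated. The reflection \<open>s \<mapsto> 1 - s\<close> and the
  singularities at 0 and 1 can be read off.\<close>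

definition completed_zeta :: "complex \<Rightarrow> complex" where
  "completed_zeta s = theta_half s + theta_half (1 - s) - 1 / s - 1 / (1 - s)"

lemma completed_zeta_reflect: "completed_zeta (1 - s) = completed_zeta s"
  by (simp add: completed_zeta_def)

lemma completed_zeta_holomorphic: "completed_zeta holomorphic_on - {0, 1}"
proof -
  show ?thesis unfolding completed_zeta_def by (intro holomorphic_intros) auto
qed

lemma half_laplace_cnj: "half_laplace h (cnj z) = cnj (half_laplace h z)"
proof -
  define f where "f r = of_real (indicator {0<..} r * h r) * exp (z * of_real r)" for r :: real
  have "(LINT r|lborel. cnj (f r)) = cnj (LINT r|lborel. f r)" 
    by (rule integral_bounded_linear'[OF bounded_linear_cnj bounded_linear_cnj]) simp
  then show ?thesis unfolding half_laplace_def f_def by (simp add: exp_cnj)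
qed

lemma completed_zeta_cnj: "completed_zeta (cnj s) = cnj (completed_zeta s)"
  using half_laplace_cnj[of "\<lambda>r. theta (exp (2 * r)) - 1" "1 - s"]
  by (simp add: completed_zeta_def half_laplace_cnj)

lemma summable_zeta:
  assumes "Re s > 1"
  shows "summable (\<lambda>n. 1 / of_nat (Suc n) powr s)"
proof -
  have "summable (\<lambda>n. exp (of_real (ln (real (Suc n))) * - s))"
    using assms by (subst summable_Suc_iff) (rule summable_complex_powr_iff, simp)
  moreover have "exp (of_real (ln (real (Suc n))) * - s) = 1 / of_nat (Suc n) powr s" for n
    by (simp add: powr_def exp_minus Ln_of_nat divide_inverse mult.commute del: of_nat_Suc)
  ultimately show ?thesis by simp
qed

lemma summable_real_zeta: "x > 1 \<Longrightarrow> summable (\<lambda>n. real (Suc n) powr (- x))"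
  using summable_real_powr_iff[of "- x"] by (subst summable_Suc_iff) simp

lemma theta_mellin:
  assumes s: "Re s > 1"
  shows "integrable lborel (\<lambda>r. of_real (theta (exp (2 * r)) - 1) * exp (s * of_real r))"
    and "(\<integral>r. of_real (theta (exp (2 * r)) - 1) * exp (s * of_real r) \<partial>lborel) =
      of_real pi powr (- s / 2) * Gamma (s / 2) * (\<Sum>n. 1 / of_nat (Suc n) powr s)"
proof -
  define c where "c r = exp (- pi * exp (2 * r))" for r :: real
  have ce: "c (r + ln (real (Suc n))) = exp (- pi * (real (Suc n))\<^sup>2 * exp (2 * r))" for r n
  proof -
    have "exp (2 * (r + ln (real (Suc n)))) = (exp (r + ln (real (Suc n))))\<^sup>2" by (rule exp_double)
    also have "\<dots> = (real (Suc n))\<^sup>2 * exp (2 * r)" by (simp add: exp_add power_mult_distrib exp_double del: of_nat_Suc)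
    finally show ?thesis by (simp only: c_def mult.assoc)
  qed
  have S: "(\<Sum>n. 2 * c (r + ln (real (Suc n)))) = theta (exp (2 * r)) - 1" for r
    unfolding ce using summable_theta[of "exp (2 * r)"] by (subst suminf_mult) (auto simp: theta_eq)
  have s0: "Re s > 0" using s by simp
  note G = Gamma_mellin_pi[OF s0, of 2, simplified]
  have pt: "summable (\<lambda>n. 2 * c (r + ln (real (Suc n))))" for r
    unfolding ce by (intro summable_mult summable_theta) simp
  have sm: "summable (\<lambda>n. 2 * real (Suc n) powr (- Re s))"
    by (intro summable_mult summable_real_zeta s)
  have "c \<in> borel_measurable borel" unfolding c_def by measurable
  note M = mellin_sum[of c "\<lambda>_. 2" s, OF this _ _ _ sm pt, unfolded S]
  have int: "integrable lborel (\<lambda>r. of_real (c r) * exp (s * of_real r))" using G(1) by (simp add: c_def)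
  show "integrable lborel (\<lambda>r. of_real (theta (exp (2 * r)) - 1) * exp (s * of_real r))"
    by (rule M(1)[OF _ _ int]) (auto simp: c_def)
  define I where "I = (\<integral>r. of_real (c r) * exp (s * of_real r) \<partial>lborel)"
  have I: "I = of_real pi powr (- s / 2) * Gamma (s / 2) / 2" using G(2) by (simp add: I_def c_def)
  have "(\<lambda>n. of_real 2 / of_nat (Suc n) powr s * I) sums (\<integral>r. of_real (theta (exp (2 * r)) - 1) * exp (s * of_real r) \<partial>lborel)"
    unfolding I_def by (rule M(2)[OF _ _ int]) (auto simp: c_def)
  moreover have "(\<lambda>n. 2 * I * (1 / of_nat (Suc n) powr s)) sums (2 * I * (\<Sum>n. 1 / of_nat (Suc n) powr s))"
    by (intro sums_mult summable_sums summable_zeta s)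
  moreover have "of_real 2 / of_nat (Suc n) powr s * I = 2 * I * (1 / of_nat (Suc n) powr s)" for n by simp
  ultimately have "(\<lambda>n. 2 * I * (1 / of_nat (Suc n) powr s)) sums (\<integral>r. of_real (theta (exp (2 * r)) - 1) * exp (s * of_real r) \<partial>lborel)"
    and "(\<lambda>n. 2 * I * (1 / of_nat (Suc n) powr s)) sums (2 * I * (\<Sum>n. 1 / of_nat (Suc n) powr s))"
    by (simp_all only:)
  then have "(\<integral>r. of_real (theta (exp (2 * r)) - 1) * exp (s * of_real r) \<partial>lborel) = 2 * I * (\<Sum>n. 1 / of_nat (Suc n) powr s)"
    by (rule sums_unique2)
  then show "(\<integral>r. of_real (theta (exp (2 * r)) - 1) * exp (s * of_real r) \<partial>lborel) =
      of_real pi powr (- s / 2) * Gamma (s / 2) * (\<Sum>n. 1 / of_nat (Suc n) powr s)"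
    by (simp add: I)
qed

text \<open>Folding at the origin:
  \<open>theta (exp (- 2 * r)) = exp r * theta (exp (2 * r))\<close> sends the negative half to
  \<open>theta_half (1 - s)\<close>, and the leftover exponentials integrate to
  \<open>1 / (s - 1) - 1 / s\<close>.\<close>

lemma completed_zeta_eq:
  assumes s: "Re s > 1"
  shows "completed_zeta s = of_real pi powr (- s / 2) * Gamma (s / 2) * (\<Sum>n. 1 / of_nat (Suc n) powr s)"
proof -
  define T where "T r = theta (exp (2 * r)) - 1" for r
  have Tneg: "of_real (T (- r)) * exp (s * of_real (- r)) =
      of_real (T r) * exp ((1 - s) * of_real r) + (exp (- (s - 1) * of_real r) - exp (- s * of_real r))" for r
  proof -
    have a: "T (- r) = exp r * T r + exp r - 1" by (simp only: T_def mult_minus_right theta_exp_neg) (simp add: algebra_simps)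
    have b: "exp ((1 - s) * of_real r) = of_real (exp r) * exp (- s * of_real r)"
      "exp (- (s - 1) * of_real r) = of_real (exp r) * exp (- s * of_real r)"
      by (simp_all add: exp_of_real[symmetric] exp_add[symmetric] algebra_simps)
    show ?thesis by (simp only: a b of_real_add of_real_diff of_real_mult of_real_1) (simp add: algebra_simps)
  qed
  have s1: "Re (s - 1) > 0" "Re s > 0" using s by auto
  note E1 = integral_exp_neg_complex[OF s1(1)] and E2 = integral_exp_neg_complex[OF s1(2)]
  have "of_real pi powr (- s / 2) * Gamma (s / 2) * (\<Sum>n. 1 / of_nat (Suc n) powr s) =
      (LINT r:{0<..}|lborel. of_real (T r) * exp (s * of_real r) + of_real (T (- r)) * exp (s * of_real (- r)))"
    unfolding theta_mellin(2)[OF s, symmetric] T_def by (rule integral_fold(3)[OF theta_mellin(1)[OF s]])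
  also have "\<dots> = (LINT r:{0<..}|lborel. of_real (T r) * exp (s * of_real r) +
      (of_real (T r) * exp ((1 - s) * of_real r) + (exp (- (s - 1) * of_real r) - exp (- s * of_real r))))"
    unfolding Tneg ..
  also have "\<dots> = theta_half s + (theta_half (1 - s) + (1 / (s - 1) - 1 / s))"
    unfolding T_def
  proof -
    note f = theta_half(1)[of s] and g = theta_half(1)[of "1 - s"]
    note hk = set_integral_diff[OF E1(1) E2(1)]
    note ghk = set_integral_add[OF g hk(1)]
    show "(LINT r:{0<..}|lborel. of_real (theta (exp (2 * r)) - 1) * exp (s * of_real r) +
        (of_real (theta (exp (2 * r)) - 1) * exp ((1 - s) * of_real r) + (exp (- (s - 1) * of_real r) - exp (- s * of_real r)))) =
      theta_half s + (theta_half (1 - s) + (1 / (s - 1) - 1 / s))"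
      unfolding set_integral_add(2)[OF f ghk(1)] ghk(2) hk(2) E1(2) E2(2) theta_half(2) ..
  qed
  finally have "of_real pi powr (- s / 2) * Gamma (s / 2) * (\<Sum>n. 1 / of_nat (Suc n) powr s) =
      theta_half s + (theta_half (1 - s) + (1 / (s - 1) - 1 / s))" .
  moreover have "1 / (1 - s) = - (1 / (s - 1))" by (metis minus_diff_eq minus_divide_right)
  ultimately show ?thesis by (simp add: completed_zeta_def)
qed

text \<open>The completed function is divided by its Gamma factor. The polar term at 0 is rewritten
  with \<open>rGamma (s / 2) / s = rGamma (s / 2 + 1) / 2\<close>, so \<open>F\<close> is visibly
  holomorphic there; the value at \<open>s = 1\<close> is the one fixed by the definition of
  \<open>riemann_zeta\<close>.\<close>

lemma zeta_continuation:
  defines "F \<equiv> \<lambda>s. if s = 1 then 0 else of_real pi powr (s / 2) *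
      (rGamma (s / 2) * (theta_half s + theta_half (1 - s) - 1 / (1 - s)) - rGamma (s / 2 + 1) / 2)"
  shows "riemann_zeta = F"
    and "s \<noteq> 0 \<Longrightarrow> s \<noteq> 1 \<Longrightarrow> F s = of_real pi powr (s / 2) * rGamma (s / 2) * completed_zeta s"
proof -
  show eq: "F s = of_real pi powr (s / 2) * rGamma (s / 2) * completed_zeta s" if "s \<noteq> 0" "s \<noteq> 1" for s
  proof -
    have "rGamma (s / 2 + 1) = rGamma (s / 2) / (s / 2)" using that rGamma_plus1[of "s / 2"] by (simp add: field_simps)
    then show ?thesis using that by (simp add: F_def completed_zeta_def algebra_simps)
  qed
  have hol: "F holomorphic_on - {1}"
  proof -
    have "(\<lambda>s. of_real pi powr (s / 2) *
      (rGamma (s / 2) * (theta_half s + theta_half (1 - s) - 1 / (1 - s)) - rGamma (s / 2 + 1) / 2)) holomorphic_on - {1}"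
      by (intro holomorphic_intros) auto
    then show ?thesis by (rule holomorphic_transform) (auto simp: F_def)
  qed
  have sums: "(\<lambda>n. 1 / of_nat (Suc n) powr s) sums F s" if s: "Re s > 1" for s
  proof -
    have ne: "s \<noteq> 0" "s \<noteq> 1" using s by auto
    have "s / 2 \<notin> \<int>\<^sub>\<le>\<^sub>0"
    proof
      assume "s / 2 \<in> \<int>\<^sub>\<le>\<^sub>0"
      then have "Re (s / 2) \<le> 0" by (auto elim!: nonpos_Ints_cases)
      then show False using s by simp
    qed
    then have "rGamma (s / 2) * Gamma (s / 2) = 1" by (simp add: Gamma_def rGamma_eq_zero_iff)
    moreover have "of_real pi powr (s / 2) * of_real pi powr (- s / 2) = (1::complex)"
      by (simp add: powr_minus)
    ultimately have "(rGamma (s / 2) * Gamma (s / 2)) * ((of_real pi powr (s / 2) * of_real pi powr (- s / 2)) * (\<Sum>n. 1 / of_nat (Suc n) powr s))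
        = (\<Sum>n. 1 / of_nat (Suc n) powr s)" by (simp only: mult_1_left)
    then have "F s = (\<Sum>n. 1 / of_nat (Suc n) powr s)"
      unfolding eq[OF ne] completed_zeta_eq[OF s] by (simp only: mult_ac)
    then show ?thesis using summable_sums[OF summable_zeta[OF s]] by simp
  qed
  show "riemann_zeta = F"
    unfolding riemann_zeta_def
  proof (rule the_equality)
    show "F holomorphic_on - {1} \<and> F 1 = 0 \<and> (\<forall>s. 1 < Re s \<longrightarrow> (\<lambda>n. 1 / of_nat (Suc n) powr s) sums F s)"
      using hol sums by (simp add: F_def)
    fix G assume G: "G holomorphic_on - {1} \<and> G 1 = 0 \<and> (\<forall>s. 1 < Re s \<longrightarrow> (\<lambda>n. 1 / of_nat (Suc n) powr s) sums G s)"
    show "G = F"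
    proof
      fix s
      show "G s = F s"
      proof (cases "s = 1")
        case False
        show ?thesis
        proof (rule analytic_continuation_open[of "{s. Re s > 1}" "- {1}" G F])
          have "2 \<in> {s. Re s > 1}" by simp
          then show "{s. Re s > 1} \<noteq> {}" by blast
          show "connected (- {1::complex})" by (rule connected_punctured_universe) simp
          show "G z = F z" if "z \<in> {s. 1 < Re s}" for z using that G sums sums_unique2 by blast
        qed (use G hol False in \<open>auto simp: open_halfspace_Re_gt\<close>)
      qed (use G in \<open>simp add: F_def\<close>)
    qed
  qed
qed

text \<open>The exceptions are points where the defining product takes default values:
  \<open>Gamma\<close> is 0 at its poles and \<open>riemann_zeta\<close> is 0 at 1.\<close>

lemma zeta_hat_eq:
  assumes "s \<noteq> 1" "s / 2 \<notin> \<int>\<^sub>\<le>\<^sub>0"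
  shows "zeta_hat s = completed_zeta s"
proof -
  have "s \<noteq> 0" using assms by auto
  have "rGamma (s / 2) * Gamma (s / 2) = 1" using assms by (simp add: Gamma_def rGamma_eq_zero_iff)
  moreover have "of_real pi powr (s / 2) * of_real pi powr (- s / 2) = (1::complex)" by (simp add: powr_minus)
  ultimately have "(of_real pi powr (- s / 2) * of_real pi powr (s / 2)) * (Gamma (s / 2) * rGamma (s / 2)) * completed_zeta s = completed_zeta s"
    by (simp add: mult.commute)
  then show ?thesis
    unfolding zeta_hat_def zeta_continuation(1) zeta_continuation(2)[OF \<open>s \<noteq> 0\<close> \<open>s \<noteq> 1\<close>]
    by (simp only: mult_ac)
qed

section \<open>The two-variable zeta function\<close>

definition log_theta :: "real \<Rightarrow> real" where
  "log_theta r = ln (theta (exp (2 * r)))"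

lemma log_theta_measurable [measurable]: "log_theta \<in> borel_measurable borel"
  unfolding log_theta_def[abs_def] by measurable

lemma exp_log_theta: "exp (log_theta r) = theta (exp (2 * r))"
  using theta_ge_1[of "exp (2 * r)"] by (simp add: log_theta_def)

lemma log_theta_nonneg: "0 \<le> log_theta r"
  using theta_ge_1[of "exp (2 * r)"] by (simp add: log_theta_def)

lemma log_theta_le: "log_theta r \<le> theta (exp (2 * r)) - 1"
  using ln_le_minus_one[of "theta (exp (2 * r))"] theta_ge_1[of "exp (2 * r)"] by (simp add: log_theta_def)

lemma log_theta_uminus: "log_theta (- r) = log_theta r + r"
proof -
  have "exp (log_theta (- r)) = exp (log_theta r + r)"
    by (simp only: exp_add exp_log_theta mult_minus_right theta_exp_neg) (simp only: mult.commute)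
  then show ?thesis by simp
qed

lemma log_theta_bounded: obtains C where "\<And>r. r \<ge> 0 \<Longrightarrow> log_theta r \<le> C"
proof -
  obtain K where K: "K > 0" "\<And>r. r \<ge> 0 \<Longrightarrow> exp (0 * r) * (theta (exp (2 * r)) - 1) \<le> K * exp (- r)"
    using theta_exp_decay by blast
  have "log_theta r \<le> K" if "r \<ge> 0" for r
  proof -
    have "log_theta r \<le> K * exp (- r)" using log_theta_le[of r] K(2)[OF that] by simp
    also have "\<dots> \<le> K * 1" using K(1) that by (intro mult_left_mono) auto
    finally show ?thesis by simp
  qed
  then show ?thesis using that by blast
qed

abbreviation log_theta_half :: "complex \<Rightarrow> complex" where
  "log_theta_half \<equiv> half_laplace log_theta"

lemma log_theta_half:
  shows "set_integrable lborel {0<..} (\<lambda>r. of_real (log_theta r) * exp (z * of_real r))"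
    and "log_theta_half z = (LINT r:{0<..}|lborel. of_real (log_theta r) * exp (z * of_real r))"
    and "log_theta_half holomorphic_on UNIV"
  by (rule half_laplace; use log_theta_nonneg log_theta_le in auto)+

lemma log_theta_half_holomorphic [holomorphic_intros]:
  "f holomorphic_on A \<Longrightarrow> (\<lambda>s. log_theta_half (f s)) holomorphic_on A"
  using holomorphic_on_compose_gen[of f A log_theta_half UNIV] log_theta_half(3) by (simp add: o_def)

lemma of_real_theta_powr: "complex_of_real (theta (exp (2 * r))) powr z = exp (z * of_real (log_theta r))"
proof -
  have "complex_of_real (theta (exp (2 * r))) = exp (of_real (log_theta r))"
    by (simp add: exp_of_real exp_log_theta)
  then show ?thesis by (simp add: powr_def Ln_exp)
qed

lemma Z_Q_eq: "Z_Q w s = (LINT r|lborel. exp (w * of_real (log_theta r) + (w - s) * of_real r))"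
proof -
  \<comment> \<open>Theta is controlled only for positive arguments; cutting it off makes the
    integrand Borel measurable on the whole line without changing it on
    \<open>{0<..}\<close>.\<close>
  define \<theta> where "\<theta> t = indicator {0<..} t *\<^sub>R theta t" for t
  have [measurable]: "\<theta> \<in> borel_measurable borel"
    unfolding \<theta>_def[abs_def] by (intro borel_measurable_continuous_on_indicator continuous_on_theta) simp
  define g where "g t = complex_of_real (\<theta> (t\<^sup>2)) powr s * complex_of_real (\<theta> (1 / t\<^sup>2)) powr (w - s)" for t
  have [measurable]: "g \<in> borel_measurable borel" unfolding g_def[abs_def] by measurable
  have ge: "g (exp r) = exp (w * of_real (log_theta r) + (w - s) * of_real r)" for r
  proof -
    have "(exp r)\<^sup>2 = exp (2 * r)" by (rule exp_double[symmetric])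
    moreover have "1 / (exp r)\<^sup>2 = exp (2 * (- r))"
      unfolding exp_double[symmetric] by (simp add: exp_minus divide_inverse)
    ultimately have "g (exp r) = exp (s * of_real (log_theta r)) * exp ((w - s) * of_real (log_theta (- r)))"
      by (simp only: g_def \<theta>_def of_real_theta_powr[symmetric]) simp
    then show ?thesis by (simp add: log_theta_uminus exp_add[symmetric] algebra_simps)
  qed
  have "Z_Q w s = (LINT t:{0<..}|lborel. g t /\<^sub>R t)"
    unfolding Z_Q_def by (rule set_lebesgue_integral_cong)
      (auto simp: g_def \<theta>_def scaleR_conv_of_real divide_inverse mult_ac)
  also have "\<dots> = (LINT r|lborel. g (exp r))" by (rule integral_exp_substitution) measurable
  finally show ?thesis unfolding ge .
qed

section \<open>Continuation in both variables\<close>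

lemma integral_exp_unit: "c * (LINT \<tau>:{0..1}|lborel. exp (c * of_real \<tau>)) = exp c - (1::complex)"
proof (cases "c = 0")
  case False
  have "(LINT \<tau>|lborel. indicator {0..1} \<tau> *\<^sub>R exp (c * of_real \<tau>)) = exp (c * of_real 1) / c - exp (c * of_real 0) / c"
    by (rule integral_FTC_Icc)
      (use False in \<open>auto intro!: derivative_eq_intros has_vector_derivative_real_field continuous_intros\<close>)
  then show ?thesis using False by (simp add: set_lebesgue_integral_def field_simps)
qed simp

lemma measurable_fst_snd_lborel:
  assumes "f \<in> borel_measurable borel"
  shows "(\<lambda>x. f (fst x)) \<in> borel_measurable (lborel \<Otimes>\<^sub>M lborel)"
    and "(\<lambda>x. f (snd x)) \<in> borel_measurable (lborel \<Otimes>\<^sub>M lborel)"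
  using assms measurable_compose[OF measurable_fst[of lborel lborel], of f borel]
    measurable_compose[OF measurable_snd[of lborel lborel], of f borel] by simp_all

lemma integrable_pair_bound:
  fixes f :: "real \<times> real \<Rightarrow> real"
  assumes a: "integrable lborel a" and b: "integrable lborel b"
    and [measurable]: "f \<in> borel_measurable (borel \<Otimes>\<^sub>M borel)"
    and bd: "\<And>x y. \<bar>f (x, y)\<bar> \<le> \<bar>a x\<bar> * \<bar>b y\<bar>"
  shows "integrable (lborel \<Otimes>\<^sub>M lborel) f"
proof -
  have [measurable]: "a \<in> borel_measurable borel" "b \<in> borel_measurable borel" using a b by auto
  have "integrable (lborel \<Otimes>\<^sub>M lborel) (\<lambda>x. \<bar>a (fst x)\<bar> * \<bar>b (snd x)\<bar>)"
  proof (rule lborel_pair.Fubini_integrable)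
    show "integrable lborel (\<lambda>x. LINT y|lborel. norm (\<bar>a (fst (x, y))\<bar> * \<bar>b (snd (x, y))\<bar>))"
      using integrable_mult_left[OF integrable_norm[OF a], of "LINT y|lborel. \<bar>b y\<bar>"] by (simp add: abs_mult)
    show "AE x in lborel. integrable lborel (\<lambda>y. \<bar>a (fst (x, y))\<bar> * \<bar>b (snd (x, y))\<bar>)"
      using b by simp
    show "(\<lambda>x. \<bar>a (fst x)\<bar> * \<bar>b (snd x)\<bar>) \<in> borel_measurable (lborel \<Otimes>\<^sub>M lborel)"
      by (intro borel_measurable_times borel_measurable_abs measurable_fst_snd_lborel) simp_all
  qed
  then show ?thesis
  proof (rule Bochner_Integration.integrable_bound)
    show "f \<in> borel_measurable (lborel \<Otimes>\<^sub>M lborel)"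
      using assms(3) by (simp cong: measurable_cong_sets sets_pair_measure_cong)
    show "AE x in lborel \<Otimes>\<^sub>M lborel. norm (f x) \<le> norm (\<bar>a (fst x)\<bar> * \<bar>b (snd x)\<bar>)"
      using bd by (intro AE_I2) (auto simp: abs_mult)
  qed
qed

lemma theta_laplace_measurable:
  "(\<lambda>x. log_theta (fst x) * snd x) \<in> borel_measurable (lborel \<Otimes>\<^sub>M lborel)"
  "(fst :: real \<times> real \<Rightarrow> real) \<in> borel_measurable (lborel \<Otimes>\<^sub>M lborel)"
  "(\<lambda>x :: real \<times> real. indicator {0<..} (fst x) * indicator {0..1} (snd x) * log_theta (fst x)) \<in> borel_measurable (lborel \<Otimes>\<^sub>M lborel)"
proof -
  show "(\<lambda>x. log_theta (fst x) * snd x) \<in> borel_measurable (lborel \<Otimes>\<^sub>M lborel)"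
    by (intro borel_measurable_times measurable_fst_snd_lborel) (auto intro!: borel_measurable_indicator)
  show "(fst :: real \<times> real \<Rightarrow> real) \<in> borel_measurable (lborel \<Otimes>\<^sub>M lborel)"
    using measurable_fst_snd_lborel(1)[of "\<lambda>x. x"] by simp
  show "(\<lambda>x :: real \<times> real. indicator {0<..} (fst x) * indicator {0..1} (snd x) * log_theta (fst x)) \<in> borel_measurable (lborel \<Otimes>\<^sub>M lborel)"
    by (intro borel_measurable_times measurable_fst_snd_lborel) (auto intro!: borel_measurable_indicator)
qed

text \<open>The extra variable in \<open>[0, 1]\<close> represents \<open>(exp (w L) - 1) / w\<close> as \<open>\<integral>\<^sub>0\<^sup>1 L exp (w L \<tau>) d\<tau>\<close>, which is
  entire in \<open>w\<close> without a case distinction at \<open>w = 0\<close>.\<close>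

definition theta_laplace :: "complex \<Rightarrow> complex \<Rightarrow> complex" where
  "theta_laplace w z = (LINT x|(lborel \<Otimes>\<^sub>M lborel). of_real (indicator {0<..} (fst x) * indicator {0..1} (snd x) * log_theta (fst x))
     * exp (w * of_real (log_theta (fst x) * snd x) + z * of_real (fst x)))"

text \<open>On the half-line \<open>log_theta\<close> is bounded by some \<open>C\<close>, so the
  exponential in \<open>w\<close> costs only the factor
  \<open>exp ((\<bar>a\<bar> + 1) * C)\<close>, and the integrand is majorised by a product of a
  function of \<open>r\<close> and one of \<open>\<tau>\<close>.\<close>

lemma theta_laplace_moments:
  "integrable (lborel \<Otimes>\<^sub>M lborel) (\<lambda>x. \<bar>indicator {0<..} (fst x) * indicator {0..1} (snd x) * log_theta (fst x)\<bar> *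
     exp (a * (log_theta (fst x) * snd x) + b * fst x + 1 * (\<bar>log_theta (fst x) * snd x\<bar> + \<bar>fst x\<bar>)))"
proof -
  obtain C where C: "\<And>r. r \<ge> 0 \<Longrightarrow> log_theta r \<le> C" using log_theta_bounded by blast
  define k where "k r = indicator {0<..} r * log_theta r" for r :: real
  have [measurable]: "k \<in> borel_measurable borel" unfolding k_def[abs_def] by measurable
  define h1 where "h1 r = exp ((\<bar>a\<bar> + 1) * C) * (\<bar>k r\<bar> * exp (b * r + 1 * \<bar>r\<bar>))" for r
  define h2 where "h2 \<tau> = indicator {0..1} \<tau> * (1::real)" for \<tau> :: real
  have i1: "integrable lborel h1" unfolding h1_def[abs_def]
    by (intro integrable_mult_right theta_dominated_moments)
      (use log_theta_nonneg log_theta_le in \<open>auto simp: k_def indicator_def\<close>)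
  have i2: "integrable lborel h2" unfolding h2_def[abs_def] by simp
  show ?thesis
  proof (rule integrable_pair_bound[OF i1 i2])
    fix r \<tau> :: real
    show "\<bar>\<bar>indicator {0<..} (fst (r, \<tau>)) * indicator {0..1} (snd (r, \<tau>)) * log_theta (fst (r, \<tau>))\<bar> *
      exp (a * (log_theta (fst (r, \<tau>)) * snd (r, \<tau>)) + b * fst (r, \<tau>) +
        1 * (\<bar>log_theta (fst (r, \<tau>)) * snd (r, \<tau>)\<bar> + \<bar>fst (r, \<tau>)\<bar>))\<bar> \<le> \<bar>h1 r\<bar> * \<bar>h2 \<tau>\<bar>"
    proof (cases "r > 0 \<and> 0 \<le> \<tau> \<and> \<tau> \<le> 1")
      case True
      define y where "y = log_theta r * \<tau>"
      have y: "0 \<le> y" "y \<le> C" unfolding y_def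
        using True log_theta_nonneg[of r] C[of r] mult_mono[of "log_theta r" C \<tau> 1] order_trans[OF log_theta_nonneg C, of r] by auto
      have "a * y + y \<le> (\<bar>a\<bar> + 1) * y" using y by (simp add: distrib_right mult_right_mono)
      also have "\<dots> \<le> (\<bar>a\<bar> + 1) * C" using y by (intro mult_left_mono) auto
      finally have "a * y + b * r + 1 * (\<bar>y\<bar> + \<bar>r\<bar>) \<le> (\<bar>a\<bar> + 1) * C + (b * r + 1 * \<bar>r\<bar>)" using y by simp
      then have "exp (a * y + b * r + 1 * (\<bar>y\<bar> + \<bar>r\<bar>)) \<le> exp ((\<bar>a\<bar> + 1) * C) * exp (b * r + 1 * \<bar>r\<bar>)"
        by (simp only: exp_add[symmetric] exp_le_cancel_iff)
      then have "\<bar>log_theta r\<bar> * exp (a * y + b * r + 1 * (\<bar>y\<bar> + \<bar>r\<bar>)) \<le> \<bar>log_theta r\<bar> * (exp ((\<bar>a\<bar> + 1) * C) * exp (b * r + 1 * \<bar>r\<bar>))"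
        by (rule mult_left_mono) simp
      moreover have "\<bar>h1 r\<bar> * \<bar>h2 \<tau>\<bar> = \<bar>log_theta r\<bar> * (exp ((\<bar>a\<bar> + 1) * C) * exp (b * r + 1 * \<bar>r\<bar>))"
        using True by (simp add: h1_def h2_def k_def abs_mult)
      ultimately show ?thesis using True by (simp add: y_def[symmetric] abs_mult)
    qed auto
  qed measurable
qed

lemma theta_laplace_fubini:
  fixes w z :: complex
  defines "E \<equiv> \<lambda>r. LINT \<tau>:{0..1}|lborel. exp (w * of_real (log_theta r) * of_real \<tau>)"
  shows "theta_laplace w z = (LINT r:{0<..}|lborel. of_real (log_theta r) * E r * exp (z * of_real r))"
    and "set_integrable lborel {0<..} (\<lambda>r. of_real (log_theta r) * E r * exp (z * of_real r))"
proof -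
  let ?F = "\<lambda>x. of_real (indicator {0<..} (fst x) * indicator {0..1} (snd x) * log_theta (fst x)) *
    exp (w * of_real (log_theta (fst x) * snd x) + z * of_real (fst x))"
  have int: "integrable (lborel \<Otimes>\<^sub>M lborel) ?F"
    by (rule laplace_has_derivative(1)[OF theta_laplace_measurable zero_less_one theta_laplace_moments])
  have inner: "(LINT \<tau>|lborel. ?F (r, \<tau>)) = indicator {0<..} r *\<^sub>R (of_real (log_theta r) * E r * exp (z * of_real r))" for r
  proof -
    have "(LINT \<tau>|lborel. ?F (r, \<tau>)) = (LINT \<tau>|lborel. (indicator {0<..} r *\<^sub>R (of_real (log_theta r) * exp (z * of_real r))) *
       (indicator {0..1} \<tau> *\<^sub>R exp (w * of_real (log_theta r) * of_real \<tau>)))"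
      by (intro Bochner_Integration.integral_cong refl) (simp add: exp_add scaleR_conv_of_real mult_ac)
    also have "\<dots> = (indicator {0<..} r *\<^sub>R (of_real (log_theta r) * exp (z * of_real r))) * E r"
      unfolding E_def set_lebesgue_integral_def by (rule integral_mult_right_zero)
    finally show ?thesis by (simp only: scaleR_conv_of_real mult_ac)
  qed
  show "theta_laplace w z = (LINT r:{0<..}|lborel. of_real (log_theta r) * E r * exp (z * of_real r))"
    unfolding theta_laplace_def set_lebesgue_integral_def inner[symmetric]
    using lborel_pair.integral_fst'[OF int] by simp
  show "set_integrable lborel {0<..} (\<lambda>r. of_real (log_theta r) * E r * exp (z * of_real r))"
    unfolding set_integrable_def inner[symmetric] by (rule lborel_pair.integrable_fst'[OF int])
qed

lemma theta_laplace:
  shows "\<exists>a b. ((\<lambda>(w, z). theta_laplace w z) has_derivative (\<lambda>(h, k). a * h + b * k)) (at (w, z))"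
    and "w * theta_laplace w z = (LINT r:{0<..}|lborel. (exp (w * of_real (log_theta r)) - 1) * exp (z * of_real r))"
    and "set_integrable lborel {0<..} (\<lambda>r. (exp (w * of_real (log_theta r)) - 1) * exp (z * of_real r))"
    and "theta_laplace 0 z = log_theta_half z"
proof -
  show "\<exists>a b. ((\<lambda>(w, z). theta_laplace w z) has_derivative (\<lambda>(h, k). a * h + b * k)) (at (w, z))"
    unfolding theta_laplace_def
    using laplace_has_derivative(3)[OF theta_laplace_measurable zero_less_one theta_laplace_moments] by blast
  let ?E = "\<lambda>r. LINT \<tau>:{0..1}|lborel. exp (w * of_real (log_theta r) * of_real \<tau>)"
  have wE: "w * (of_real (log_theta r) * ?E r * exp (z * of_real r)) = (exp (w * of_real (log_theta r)) - 1) * exp (z * of_real r)" for r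
    using integral_exp_unit[of "w * of_real (log_theta r)"] by (simp add: mult.assoc[symmetric])
  show "w * theta_laplace w z = (LINT r:{0<..}|lborel. (exp (w * of_real (log_theta r)) - 1) * exp (z * of_real r))"
    unfolding theta_laplace_fubini(1) wE[symmetric] by simp
  show "set_integrable lborel {0<..} (\<lambda>r. (exp (w * of_real (log_theta r)) - 1) * exp (z * of_real r))"
    unfolding wE[symmetric] using theta_laplace_fubini(2) by (rule set_integrable_mult_right)
  have "(LINT \<tau>:{0..1}|lborel. exp (0 * of_real (log_theta r) * of_real \<tau>)) = (1::complex)" for r
    unfolding set_lebesgue_integral_def by (simp only: mult_zero_left exp_zero, subst integral_scaleR_left) auto
  then show "theta_laplace 0 z = log_theta_half z"
    unfolding theta_laplace_fubini(1) log_theta_half(2) by simp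
qed

lemma entire2_holomorphic:
  assumes "entire2 F"
  shows "(\<lambda>w. F w s) holomorphic_on A" "(\<lambda>s. F w s) holomorphic_on A"
proof -
  have "\<exists>D. ((\<lambda>w. F w s) has_field_derivative D) (at w)" for w
  proof -
    obtain a b where D: "((\<lambda>(x, y). F x y) has_derivative (\<lambda>(h, k). a * h + b * k)) (at (w, s))"
      using assms unfolding entire2_def by blast
    have "((\<lambda>w. (w, s)) has_derivative (\<lambda>h. (h, 0))) (at w)" by (intro derivative_intros)
    from has_derivative_compose[OF this D] show ?thesis by (auto simp: has_field_derivative_def)
  qed
  then show "(\<lambda>w. F w s) holomorphic_on A"
    by (auto simp: holomorphic_on_def field_differentiable_def intro: has_field_derivative_at_within)
  have "\<exists>D. ((\<lambda>s. F w s) has_field_derivative D) (at s)" for s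
  proof -
    obtain a b where D: "((\<lambda>(x, y). F x y) has_derivative (\<lambda>(h, k). a * h + b * k)) (at (w, s))"
      using assms unfolding entire2_def by blast
    have "((\<lambda>s. (w, s)) has_derivative (\<lambda>h. (0, h))) (at s)" by (intro derivative_intros)
    from has_derivative_compose[OF this D] show ?thesis by (auto simp: has_field_derivative_def)
  qed
  then show "(\<lambda>s. F w s) holomorphic_on A"
    by (auto simp: holomorphic_on_def field_differentiable_def intro: has_field_derivative_at_within)
qed

text \<open>Identity theorem one variable at a time: first in \<open>s\<close> for fixed
  \<open>w\<close> with \<open>Re w < 0\<close>, where the region is a nonempty strip, then in
  \<open>w\<close> from that half-plane.\<close>

lemma entire2_unique:
  assumes F: "entire2 F" and G: "entire2 G"
    and eq: "\<And>w s. Re w < Re s \<Longrightarrow> Re s < 0 \<Longrightarrow> F w s = G w s"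
  shows "F = G"
proof (intro ext)
  fix w s
  have 1: "F w s = G w s" if w: "Re w < 0" for w s
  proof (rule analytic_continuation_open[of "{s. Re w < Re s} \<inter> {s. Re s < 0}" UNIV "F w" "G w"])
    have "of_real (Re w / 2) \<in> {s. Re w < Re s} \<inter> {s. Re s < 0}" using w by simp
    then show "{s. Re w < Re s} \<inter> {s. Re s < 0} \<noteq> {}" by blast
  qed (use eq entire2_holomorphic[OF F] entire2_holomorphic[OF G] in
      \<open>auto simp: open_halfspace_Re_gt open_halfspace_Re_lt\<close>)
  show "F w s = G w s"
  proof (rule analytic_continuation_open[of "{w. Re w < 0}" UNIV "\<lambda>w. F w s" "\<lambda>w. G w s"])
    have "-1 \<in> {w. Re w < 0}" by simp
    then show "{w. Re w < 0} \<noteq> {}" by blast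
  qed (use 1 entire2_holomorphic[OF F] entire2_holomorphic[OF G] in \<open>auto simp: open_halfspace_Re_lt\<close>)
qed

text \<open>Folding \<open>Z_Q\<close> at the origin gives two terms
  \<open>w * theta_laplace\<close> plus \<open>1 / (s - w) - 1 / s = w / (s * (s - w))\<close>. The
  prefactor turns the latter into the constant \<open>1 / 2\<close> and cancels the \<open>w\<close>
  in the former, so nothing is singular at \<open>w = 0\<close>.\<close>

lemma xi_Q_eq: "xi_Q = (\<lambda>w s. 1 / 2 + s * (s - w) / 2 * (theta_laplace w (w - s) + theta_laplace w s))" (is "_ = ?X")
proof -
  have ent: "entire2 ?X"
    unfolding entire2_def
  proof (intro allI)
    fix w s
    obtain a b where 1: "((\<lambda>(x, y). theta_laplace x y) has_derivative (\<lambda>(h, k). a * h + b * k)) (at (w, w - s))"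
      using theta_laplace(1) by blast
    obtain c d where 2: "((\<lambda>(x, y). theta_laplace x y) has_derivative (\<lambda>(h, k). c * h + d * k)) (at (w, s))"
      using theta_laplace(1) by blast
    have "((\<lambda>z::complex \<times> complex. (fst z, fst z - snd z)) has_derivative (\<lambda>z. (fst z, fst z - snd z))) (at (w, s))"
      by (auto intro!: derivative_eq_intros)
    from has_derivative_compose[OF this, of "\<lambda>(x, y). theta_laplace x y" "\<lambda>(h, k). a * h + b * k"] 1
    have 3: "((\<lambda>z. theta_laplace (fst z) (fst z - snd z)) has_derivative (\<lambda>z. a * fst z + b * (fst z - snd z))) (at (w, s))"
      by (simp add: case_prod_beta)
    have 4: "((\<lambda>z. theta_laplace (fst z) (snd z)) has_derivative (\<lambda>z. c * fst z + d * snd z)) (at (w, s))"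
      using 2 unfolding case_prod_unfold .
    define T where "T = theta_laplace w (w - s) + theta_laplace w s"
    have 5: "((\<lambda>z::complex \<times> complex. snd z * (snd z - fst z) / 2) has_derivative (\<lambda>z. ((2 * s - w) * snd z - s * fst z) / 2)) (at (w, s))"
      by (auto intro!: derivative_eq_intros simp: fun_eq_iff algebra_simps diff_divide_distrib add_divide_distrib)
    have "((\<lambda>z. 1 / 2 + snd z * (snd z - fst z) / 2 * (theta_laplace (fst z) (fst z - snd z) + theta_laplace (fst z) (snd z)))
       has_derivative (\<lambda>z. 0 + (snd (w, s) * (snd (w, s) - fst (w, s)) / 2 * (a * fst z + b * (fst z - snd z) + (c * fst z + d * snd z)) +
         ((2 * s - w) * snd z - s * fst z) / 2 * (theta_laplace (fst (w, s)) (fst (w, s) - snd (w, s)) + theta_laplace (fst (w, s)) (snd (w, s)))))) (at (w, s))"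
      by (intro has_derivative_add has_derivative_const has_derivative_mult 3 4 5)
    also have "(\<lambda>z. 0 + (snd (w, s) * (snd (w, s) - fst (w, s)) / 2 * (a * fst z + b * (fst z - snd z) + (c * fst z + d * snd z)) +
         ((2 * s - w) * snd z - s * fst z) / 2 * (theta_laplace (fst (w, s)) (fst (w, s) - snd (w, s)) + theta_laplace (fst (w, s)) (snd (w, s))))) =
       (\<lambda>z. (s * (s - w) / 2 * (a + b + c) - s / 2 * T) * fst z + (s * (s - w) / 2 * (d - b) + (2 * s - w) / 2 * T) * snd z)"
      by (auto simp: T_def fun_eq_iff field_simps)
    finally have "((\<lambda>z. 1 / 2 + snd z * (snd z - fst z) / 2 * (theta_laplace (fst z) (fst z - snd z) + theta_laplace (fst z) (snd z)))
       has_derivative (\<lambda>z. (s * (s - w) / 2 * (a + b + c) - s / 2 * T) * fst z + (s * (s - w) / 2 * (d - b) + (2 * s - w) / 2 * T) * snd z)) (at (w, s))" .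
    then show "\<exists>a b. ((\<lambda>(w, s). ?X w s) has_derivative (\<lambda>(h, k). a * h + b * k)) (at (w, s))"
      unfolding case_prod_unfold by blast
  qed
  have val: "?X w s = s * (s - w) / (2 * w) * Z_Q w s" if ws: "Re w < Re s" "Re s < 0" for w s
  proof -
    define f where "f r = exp (w * of_real (log_theta r) + (w - s) * of_real r)" for r
    have [measurable]: "f \<in> borel_measurable borel" unfolding f_def[abs_def] by measurable
    have fneg: "f (- r) = exp (w * of_real (log_theta r) + s * of_real r)" for r
      by (simp add: f_def log_theta_uminus algebra_simps)
    have "integrable lborel f"
    proof (rule integrable_unfold)
      have le: "Re w * log_theta r \<le> 0" for r
        using ws log_theta_nonneg[of r] by (intro mult_nonpos_nonneg) auto
      show "set_integrable lborel {0<..} f"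
        by (rule set_integrable_exp_bound[where K=1 and a = "Re (s - w)"])
          (use ws le in \<open>auto simp: f_def algebra_simps\<close>)
      show "set_integrable lborel {0<..} (\<lambda>r. f (- r))"
        by (rule set_integrable_exp_bound[where K=1 and a = "- Re s"])
          (use ws le in \<open>auto simp: fneg\<close>)
    qed measurable
    note fold = integral_fold(3)[OF this]
    have z1: "Re (s - w) > 0" and z2: "Re (- s) > 0" using ws by auto
    note E1 = integral_exp_neg_complex[OF z1] and E2 = integral_exp_neg_complex[OF z2]
    note A1 = theta_laplace(3)[of w "w - s"] and A2 = theta_laplace(3)[of w s]
    note B1 = set_integral_add[OF A1 E1(1)] and B2 = set_integral_add[OF A2 E2(1)]
    have "Z_Q w s = (LINT r:{0<..}|lborel. f r + f (- r))" unfolding Z_Q_eq using fold by (simp add: f_def)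
    also have "\<dots> = (LINT r:{0<..}|lborel. ((exp (w * of_real (log_theta r)) - 1) * exp ((w - s) * of_real r) + exp (- (s - w) * of_real r))
       + ((exp (w * of_real (log_theta r)) - 1) * exp (s * of_real r) + exp (- (- s) * of_real r)))"
    proof -
      have a: "f r = (exp (w * of_real (log_theta r)) - 1) * exp ((w - s) * of_real r) + exp (- (s - w) * of_real r)" for r
        unfolding f_def exp_add minus_diff_eq by (simp only: left_diff_distrib mult_1_left diff_add_cancel)
      have b: "f (- r) = (exp (w * of_real (log_theta r)) - 1) * exp (s * of_real r) + exp (- (- s) * of_real r)" for r
        unfolding fneg exp_add minus_minus by (simp only: left_diff_distrib mult_1_left diff_add_cancel)
      show ?thesis unfolding b unfolding a ..
    qed
    also have "\<dots> = w * theta_laplace w (w - s) + 1 / (s - w) + (w * theta_laplace w s + 1 / (- s))"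
      unfolding set_integral_add(2)[OF B1(1) B2(1)] B1(2) B2(2) E1(2) E2(2) theta_laplace(2) ..
    finally have Z: "Z_Q w s = w * theta_laplace w (w - s) + 1 / (s - w) + (w * theta_laplace w s + 1 / (- s))" .
    have nz: "w \<noteq> 0" "s \<noteq> 0" "s - w \<noteq> 0" using ws by auto
    then have "1 / (s - w) + 1 / (- s) = w / (s * (s - w))" by (simp add: field_simps)
    then have "Z_Q w s = w * (theta_laplace w (w - s) + theta_laplace w s) + w / (s * (s - w))"
      unfolding Z by (simp add: algebra_simps)
    then have "s * (s - w) / (2 * w) * Z_Q w s = s * (s - w) / (2 * w) * (w * (theta_laplace w (w - s) + theta_laplace w s)) + s * (s - w) / (2 * w) * (w / (s * (s - w)))"
      by (simp only: distrib_left)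
    also have "s * (s - w) / (2 * w) * (w * (theta_laplace w (w - s) + theta_laplace w s)) = s * (s - w) / 2 * (theta_laplace w (w - s) + theta_laplace w s)"
      using nz by simp
    also have "s * (s - w) / (2 * w) * (w / (s * (s - w))) = 1 / 2" using nz by simp
    finally show ?thesis by simp
  qed
  show ?thesis unfolding xi_Q_def
  proof (rule the_equality)
    show "entire2 ?X \<and> (\<forall>w s. Re w < Re s \<and> Re s < 0 \<longrightarrow> ?X w s = s * (s - w) / (2 * w) * Z_Q w s)"
      using ent val by blast
    fix F assume F: "entire2 F \<and> (\<forall>w s. Re w < Re s \<and> Re s < 0 \<longrightarrow> F w s = s * (s - w) / (2 * w) * Z_Q w s)"
    show "F = ?X" by (rule entire2_unique) (use F ent val in auto)
  qed
qed

lemma xi_Q_0: "xi_Q 0 s = 1 / 2 + s\<^sup>2 / 2 * (log_theta_half (- s) + log_theta_half s)"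
  by (simp add: xi_Q_eq theta_laplace(4) power2_eq_square)

section \<open>The Mellin transform of the logarithm of theta\<close>

lemma sums_times_unique:
  fixes f :: "nat \<Rightarrow> complex"
  assumes "(\<lambda>n. f n * c) sums I" "summable f"
  shows "I = (\<Sum>n. f n) * c"
  using sums_unique2[OF assms(1) sums_mult2[OF summable_sums[OF assms(2)]]] .

definition log_one_minus :: "real \<Rightarrow> real" where
  "log_one_minus x = - ln (1 - exp (- pi * exp x))"

lemma exp_shift_ln: "exp (- pi * exp (x + ln (real (Suc n)))) = exp (- pi * exp x) ^ Suc n"
proof -
  have "- pi * exp (x + ln (real (Suc n))) = real (Suc n) * (- pi * exp x)"
    by (simp only: exp_add exp_ln of_nat_0_less_iff zero_less_Suc mult_ac)
  then show ?thesis by (simp only: exp_of_nat_mult)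
qed

text \<open>The logarithmic series at \<open>y = exp (- pi * exp x)\<close>; its powers
  \<open>y ^ (n + 1)\<close> are dilates, that is, shifts of \<open>x\<close> by
  \<open>ln (n + 1)\<close>.\<close>

lemma log_one_minus_sums:
  "(\<lambda>n. 1 / real (Suc n) * exp (- pi * exp (x + ln (real (Suc n))))) sums log_one_minus x"
proof -
  define y where "y = exp (- pi * exp x)"
  have y: "0 < y" "y < 1" by (auto simp: y_def)
  have "(\<lambda>n. 1 / real (Suc n) * y ^ Suc n) sums - ln (1 - y)"
  proof -
    have sm: "summable (\<lambda>n. 1 / real (Suc n) * y ^ Suc n)"
    proof (rule summable_comparison_test')
      show "summable (\<lambda>n. y ^ Suc n)" using y by (subst summable_Suc_iff) (simp add: summable_geometric)
      show "norm (1 / real (Suc n) * y ^ Suc n) \<le> y ^ Suc n" for n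
        using y by (simp add: mult_left_le_one_le divide_le_eq)
    qed
    have "ln (1 - y) = (\<Sum>n. (- 1) ^ n * (1 / real (n + 1)) * (1 - y - 1) ^ Suc n)"
      by (rule ln_series) (use y in auto)
    also have "\<dots> = (\<Sum>n. - (1 / real (Suc n) * y ^ Suc n))"
    proof (rule suminf_cong)
      fix n
      have a: "(- 1) ^ n * (- y) ^ Suc n = - (y ^ Suc n)"
        unfolding power_minus[of y "Suc n"] by (simp add: mult.assoc[symmetric])
      have b: "1 - y - 1 = - y" "real (n + 1) = real (Suc n)" by simp_all
      have "(- 1) ^ n * (1 / real (Suc n)) * (- y) ^ Suc n = 1 / real (Suc n) * ((- 1) ^ n * (- y) ^ Suc n)"
        by (simp only: mult_ac)
      then show "(- 1) ^ n * (1 / real (n + 1)) * (1 - y - 1) ^ Suc n = - (1 / real (Suc n) * y ^ Suc n)"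
        unfolding b a by (simp only: mult_minus_right)
    qed
    also have "\<dots> = - (\<Sum>n. 1 / real (Suc n) * y ^ Suc n)" by (rule suminf_minus[OF sm])
    finally show ?thesis using summable_sums[OF sm] by simp
  qed
  then show ?thesis unfolding exp_shift_ln y_def log_one_minus_def .
qed

lemma log_one_minus_measurable [measurable]: "log_one_minus \<in> borel_measurable borel"
  unfolding log_one_minus_def[abs_def] by measurable

lemma log_one_minus_nonneg: "0 \<le> log_one_minus x"
  by (rule sums_le[OF _ sums_zero log_one_minus_sums]) auto

text \<open>The weights \<open>1 / n\<close> of the logarithmic series raise the exponent of the
  Dirichlet series to \<open>s + 1\<close>.\<close>

lemma log_one_minus_mellin:
  assumes s: "Re s > 0"
  shows "integrable lborel (\<lambda>x. of_real (log_one_minus x) * exp (s * of_real x))"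
    and "(\<integral>x. of_real (log_one_minus x) * exp (s * of_real x) \<partial>lborel) =
      (\<Sum>n. 1 / of_nat (Suc n) powr (s + 1)) * (of_real pi powr (- s) * Gamma s)"
proof -
  define c where "c x = exp (- pi * exp x)" for x
  have [measurable]: "c \<in> borel_measurable borel" unfolding c_def[abs_def] by measurable
  have S: "(\<Sum>n. 1 / real (Suc n) * c (x + ln (real (Suc n)))) = log_one_minus x" for x
    unfolding c_def using log_one_minus_sums[of x] by (rule sums_unique[symmetric])
  have pt: "summable (\<lambda>n. 1 / real (Suc n) * c (x + ln (real (Suc n))))" for x
    unfolding c_def using log_one_minus_sums[of x] by (rule sums_summable)
  note G = Gamma_mellin_pi[OF s zero_less_one, unfolded mult_1_left of_real_1 div_by_1]
  have int: "integrable lborel (\<lambda>x. of_real (c x) * exp (s * of_real x))" using G(1) unfolding c_def .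
  have sm: "summable (\<lambda>n. 1 / real (Suc n) * real (Suc n) powr (- Re s))"
  proof -
    have "1 / real (Suc n) * real (Suc n) powr (- Re s) = real (Suc n) powr (- (Re s + 1))" for n
      by (simp add: powr_diff powr_minus divide_inverse)
    then show ?thesis using summable_real_zeta[of "Re s + 1"] s by (simp only:)
  qed
  have n1: "0 \<le> c x" and n2: "0 \<le> 1 / real (Suc n)" for x n by (simp_all add: c_def)
  note M = mellin_sum[of c "\<lambda>n. 1 / real (Suc n)" s, OF _ n1 n2 int sm pt, unfolded S]
  show "integrable lborel (\<lambda>x. of_real (log_one_minus x) * exp (s * of_real x))"
    by (rule M(1)) measurable
  have "of_real (1 / real (Suc n)) / of_nat (Suc n) powr s = 1 / of_nat (Suc n) powr (s + 1)" for n
    by (simp add: powr_add)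
  then have "(\<lambda>n. 1 / of_nat (Suc n) powr (s + 1) * (of_real pi powr (- s) * Gamma s)) sums
      (\<integral>x. of_real (log_one_minus x) * exp (s * of_real x) \<partial>lborel)"
    using M(2) unfolding c_def G(2) by simp
  then show "(\<integral>x. of_real (log_one_minus x) * exp (s * of_real x) \<partial>lborel) =
      (\<Sum>n. 1 / of_nat (Suc n) powr (s + 1)) * (of_real pi powr (- s) * Gamma s)"
    by (rule sums_times_unique) (rule summable_zeta, use s in simp)
qed

text \<open>The unit factors are kept to match the pattern of \<open>mellin_sum\<close> with all
  weights equal to 1.\<close>

lemma euler_log_exp: 
  "(\<Sum>n. 1 * log_one_minus (x + ln (real (Suc n)))) = euler_log (exp x)"
  "summable (\<lambda>n. 1 * log_one_minus (x + ln (real (Suc n))))"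
proof -
  have e: "1 * log_one_minus (x + ln (real (Suc n))) = - ln (1 - exp (- pi * real (Suc n) * exp x))" for n
    by (simp only: log_one_minus_def mult_1_left exp_add exp_ln of_nat_0_less_iff zero_less_Suc mult_ac)
  show "(\<Sum>n. 1 * log_one_minus (x + ln (real (Suc n)))) = euler_log (exp x)"
    unfolding e euler_log_def ..
  show "summable (\<lambda>n. 1 * log_one_minus (x + ln (real (Suc n))))"
    unfolding e by (rule summable_euler_log) simp
qed

text \<open>A second pass of \<open>mellin_sum\<close>, now over the factors of the product, brings
  in the other Dirichlet series; its convergence asks for \<open>Re s > 1\<close>.\<close>

lemma euler_log_mellin:
  assumes s: "Re s > 1"
  shows "integrable lborel (\<lambda>x. of_real (euler_log (exp x)) * exp (s * of_real x))"
    and "(\<integral>x. of_real (euler_log (exp x)) * exp (s * of_real x) \<partial>lborel) =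
      (\<Sum>n. 1 / of_nat (Suc n) powr s) * ((\<Sum>n. 1 / of_nat (Suc n) powr (s + 1)) * (of_real pi powr (- s) * Gamma s))"
proof -
  have s0: "Re s > 0" using s by simp
  have sm: "summable (\<lambda>n. 1 * real (Suc n) powr (- Re s))"
    using summable_real_zeta[OF s] by simp
  have n1: "0 \<le> (1::real)" for n :: nat by simp
  note L = log_one_minus_mellin[OF s0]
  note M = mellin_sum[of log_one_minus "\<lambda>n. 1" s, OF log_one_minus_measurable log_one_minus_nonneg n1 L(1) sm euler_log_exp(2),
      unfolded euler_log_exp(1)]
  show "integrable lborel (\<lambda>x. of_real (euler_log (exp x)) * exp (s * of_real x))" by (rule M(1))
  show "(\<integral>x. of_real (euler_log (exp x)) * exp (s * of_real x) \<partial>lborel) =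
      (\<Sum>n. 1 / of_nat (Suc n) powr s) * ((\<Sum>n. 1 / of_nat (Suc n) powr (s + 1)) * (of_real pi powr (- s) * Gamma s))"
    by (rule sums_times_unique[OF _ summable_zeta[OF s]]) (use M(2) in \<open>simp add: L(2) del: of_nat_Suc\<close>)
qed

text \<open>The scales 1, 2, 4 of the product formula are shifts by 0, \<open>ln 2\<close>,
  \<open>ln 4\<close>, worth the factors 1, \<open>q\<close> and \<open>q^2\<close> for
  \<open>q = 2 powr (- s)\<close>. The argument \<open>x / 2\<close> undoes the scale
  \<open>exp (2 * r)\<close> in \<open>log_theta\<close>.\<close>

lemma log_theta_mellin:
  assumes s: "Re s > 1"
  shows "integrable lborel (\<lambda>x. of_real (log_theta (x / 2)) * exp (s * of_real x))"
    and "(\<integral>x. of_real (log_theta (x / 2)) * exp (s * of_real x) \<partial>lborel) =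
      (2 - 5 * 2 powr (- s) + 2 * (2 powr (- s))\<^sup>2) *
      ((\<Sum>n. 1 / of_nat (Suc n) powr s) * ((\<Sum>n. 1 / of_nat (Suc n) powr (s + 1)) * (of_real pi powr (- s) * Gamma s)))"
proof -
  define g where "g x = of_real (euler_log (exp x)) * exp (s * of_real x)" for x :: real
  define q where "q = (2::complex) powr (- s)"
  have lt: "log_theta (x / 2) = 2 * euler_log (exp x) - 5 * euler_log (exp (x + ln 2)) + 2 * euler_log (exp (x + ln 4))" for x
  proof -
    have a: "exp (x + ln 2) = 2 * exp x" "exp (x + ln 4) = 4 * exp x" "2 * (x / 2) = x" by (simp_all add: exp_add)
    show ?thesis unfolding log_theta_def a theta_eq_euler[OF exp_gt_zero] ln_exp ..
  qed
  have q: "q = exp (- s * of_real (ln 2))" by (simp add: q_def powr_def Ln_of_real[of 2, simplified])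
  have "ln (4::real) = 2 * ln 2" using ln_realpow[of 2 2] by simp
  then have q2: "q\<^sup>2 = exp (- s * of_real (ln 4))"
    unfolding q by (simp add: exp_double[symmetric] mult_ac)
  have e: "of_real (log_theta (x / 2)) * exp (s * of_real x) = 2 * g x - 5 * q * g (x + ln 2) + 2 * q\<^sup>2 * g (x + ln 4)" for x
  proof -
    have a: "g (x + ln 2) = of_real (euler_log (exp (x + ln 2))) * exp (s * of_real x) * exp (s * of_real (ln 2))"
      and b: "g (x + ln 4) = of_real (euler_log (exp (x + ln 4))) * exp (s * of_real x) * exp (s * of_real (ln 4))"
      unfolding g_def of_real_add distrib_left exp_add[of "s * _"] by (simp_all only: mult.assoc)
    have c: "q * exp (s * of_real (ln 2)) = 1" "q\<^sup>2 * exp (s * of_real (ln 4)) = 1"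
      unfolding q q2[unfolded q] exp_add[symmetric] by simp_all
    have "5 * q * g (x + ln 2) = 5 * (of_real (euler_log (exp (x + ln 2))) * exp (s * of_real x)) * (q * exp (s * of_real (ln 2)))"
      unfolding a by (simp only: mult_ac)
    moreover have "2 * q\<^sup>2 * g (x + ln 4) = 2 * (of_real (euler_log (exp (x + ln 4))) * exp (s * of_real x)) * (q\<^sup>2 * exp (s * of_real (ln 4)))"
      unfolding b by (simp only: mult_ac)
    ultimately show ?thesis unfolding c lt by (simp only: g_def mult_1_right) (simp add: algebra_simps)
  qed
  have ig: "integrable lborel g" unfolding g_def[abs_def] by (rule euler_log_mellin(1)[OF s])
  note i2 = integrable_translate[OF ig]
  show "integrable lborel (\<lambda>x. of_real (log_theta (x / 2)) * exp (s * of_real x))"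
    unfolding e by (intro Bochner_Integration.integrable_add Bochner_Integration.integrable_diff integrable_mult_right ig i2)
  have "(\<integral>x. of_real (log_theta (x / 2)) * exp (s * of_real x) \<partial>lborel) =
     2 * integral\<^sup>L lborel g - 5 * q * integral\<^sup>L lborel g + 2 * q\<^sup>2 * integral\<^sup>L lborel g"
    unfolding e using ig i2 by (simp add: integral_translate[of g])
  also have "\<dots> = (2 - 5 * q + 2 * q\<^sup>2) * integral\<^sup>L lborel g" by (simp add: algebra_simps)
  finally show "(\<integral>x. of_real (log_theta (x / 2)) * exp (s * of_real x) \<partial>lborel) =
      (2 - 5 * 2 powr (- s) + 2 * (2 powr (- s))\<^sup>2) *
      ((\<Sum>n. 1 / of_nat (Suc n) powr s) * ((\<Sum>n. 1 / of_nat (Suc n) powr (s + 1)) * (of_real pi powr (- s) * Gamma s)))"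
    unfolding q_def[symmetric] using euler_log_mellin(2)[OF s] by (simp only: g_def[abs_def])
qed

text \<open>Legendre duplication merges the Gamma factors at \<open>s\<close> and
  \<open>s + 1\<close> into \<open>Gamma s\<close>; it leaves \<open>2 * 2 powr (- s)\<close>, while
  its \<open>sqrt pi\<close> corrects the power of \<open>pi\<close>.\<close>

lemma completed_zeta_mult:
  assumes s: "Re s > 1"
  shows "completed_zeta s * completed_zeta (s + 1) = 2 * 2 powr (- s) *
     ((\<Sum>n. 1 / of_nat (Suc n) powr s) * ((\<Sum>n. 1 / of_nat (Suc n) powr (s + 1)) * (of_real pi powr (- s) * Gamma s)))"
proof -
  have s1: "Re (s + 1) > 1" using s by simp
  have np: "z \<notin> \<int>\<^sub>\<le>\<^sub>0" if "Re z > 0" for z :: complex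
    using that by (auto elim!: nonpos_Ints_cases)
  have G: "Gamma (s / 2) * Gamma (s / 2 + 1 / 2) = exp ((1 - 2 * (s / 2)) * of_real (ln 2)) * of_real (sqrt pi) * Gamma (2 * (s / 2))"
    by (rule Gamma_legendre_duplication) (use s in \<open>auto intro!: np\<close>)
  have two: "exp ((1 - 2 * (s / 2)) * of_real (ln 2)) = 2 * 2 powr (- s)"
  proof -
    have "(1 - 2 * (s / 2)) * of_real (ln 2) = of_real (ln 2) + - s * of_real (ln 2)" by (simp add: algebra_simps)
    moreover have "exp (complex_of_real (ln 2)) = 2" unfolding exp_of_real by simp
    moreover have "(2::complex) powr (- s) = exp (- s * of_real (ln 2))"
      by (simp add: powr_def Ln_of_real[of 2, simplified])
    ultimately show ?thesis by (simp only: exp_add)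
  qed
  have pi1: "of_real pi powr (- s / 2) * of_real pi powr (- (s + 1) / 2) * of_real (sqrt pi) = of_real pi powr (- s)"
  proof -
    have "complex_of_real (sqrt pi) = of_real pi powr (1 / 2)"
      by (simp add: powr_half_sqrt[symmetric] powr_of_real[symmetric])
    then have "of_real pi powr (- s / 2) * of_real pi powr (- (s + 1) / 2) * complex_of_real (sqrt pi) =
        of_real pi powr (- s / 2 + - (s + 1) / 2 + 1 / 2)" by (simp only: powr_add)
    also have "- s / 2 + - (s + 1) / 2 + 1 / 2 = - s" by (simp add: field_simps)
    finally show ?thesis .
  qed
  have "completed_zeta s * completed_zeta (s + 1) = (of_real pi powr (- s / 2) * of_real pi powr (- (s + 1) / 2)) *
     (Gamma (s / 2) * Gamma (s / 2 + 1 / 2)) * ((\<Sum>n. 1 / of_nat (Suc n) powr s) * (\<Sum>n. 1 / of_nat (Suc n) powr (s + 1)))"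
    unfolding completed_zeta_eq[OF s] completed_zeta_eq[OF s1] add_divide_distrib by (simp only: mult_ac)
  also have "\<dots> = 2 * 2 powr (- s) * (of_real pi powr (- s / 2) * of_real pi powr (- (s + 1) / 2) * of_real (sqrt pi)) * Gamma s *
      ((\<Sum>n. 1 / of_nat (Suc n) powr s) * (\<Sum>n. 1 / of_nat (Suc n) powr (s + 1)))"
    unfolding G two by (simp add: mult_ac)
  finally show ?thesis unfolding pi1 by (simp only: mult_ac)
qed

text \<open>The left side is \<open>xi_Q 0 z\<close>: folding the two-sided transform of
  \<open>log_theta\<close> produces \<open>1 / z^2\<close> from the summand \<open>r\<close>, and
  this becomes the \<open>1 / 2\<close>. For \<open>Re z > 2\<close> the Mellin formula applies at
  \<open>s = z / 2\<close>.\<close>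

lemma log_theta_half_sum:
  assumes z: "Re z > 2"
  shows "1 / 2 + z\<^sup>2 / 2 * (log_theta_half (- z) + log_theta_half z) =
    z\<^sup>2 / 8 * (completed_zeta (z / 2) * completed_zeta (z / 2 + 1)) * ((2 * 2 powr (z / 2) - 1) * (1 - 2 * 2 powr (- (z / 2))))"
proof -
  define s where "s = z / 2"
  have s: "Re s > 1" using z by (simp add: s_def)
  define f where "f r = of_real (log_theta r) * exp (z * of_real r)" for r
  define g where "g x = of_real (log_theta (x / 2)) * exp (s * of_real x)" for x
  have gf: "g (0 + 2 * r) = f r" for r by (simp add: g_def f_def s_def)
  have ig: "integrable lborel g" unfolding g_def[abs_def] by (rule log_theta_mellin(1)[OF s])
  have "integrable lborel f" using lborel_integrable_real_affine[OF ig, of 2 0] unfolding gf by simp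
  note fold = integral_fold(3)[OF this]
  have If: "integral\<^sup>L lborel g = 2 * integral\<^sup>L lborel f"
    using lborel_integral_real_affine[of 2 g 0] unfolding gf by (simp add: scaleR_conv_of_real)
  have fneg: "f (- r) = of_real (log_theta r) * exp (- z * of_real r) + of_real r * exp (- z * of_real r)" for r
    by (simp add: f_def log_theta_uminus algebra_simps)
  have z0: "Re z > 0" using z by simp
  note E = integral_exp_neg_complex[OF z0]
  have "integral\<^sup>L lborel f = log_theta_half z + (log_theta_half (- z) + 1 / z\<^sup>2)"
    unfolding fold fneg unfolding f_def
    unfolding set_integral_add(2)[OF log_theta_half(1) set_integral_add(1)[OF log_theta_half(1) E(3)]]
      set_integral_add(2)[OF log_theta_half(1) E(3)] E(4) log_theta_half(2) ..
  then have "1 / 2 + z\<^sup>2 / 2 * (log_theta_half (- z) + log_theta_half z) = z\<^sup>2 / 2 * integral\<^sup>L lborel f"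
    using z0 by (cases "z = 0") (auto simp: field_simps)
  also have "\<dots> = z\<^sup>2 / 4 * integral\<^sup>L lborel g" by (simp add: If)
  finally have 1: "1 / 2 + z\<^sup>2 / 2 * (log_theta_half (- z) + log_theta_half z) = z\<^sup>2 / 4 * integral\<^sup>L lborel g" .
  define Y where "Y = ((\<Sum>n. 1 / of_nat (Suc n) powr s) * ((\<Sum>n. 1 / of_nat (Suc n) powr (s + 1)) * (of_real pi powr (- s) * Gamma s)))"
  define q where "q = (2::complex) powr (- s)"
  have q: "2 powr s * q = 1" by (simp add: q_def powr_minus)
  have Ig: "integral\<^sup>L lborel g = (2 - 5 * q + 2 * q\<^sup>2) * Y"
    unfolding Y_def q_def g_def[abs_def] by (rule log_theta_mellin(2)[OF s])
  have cz: "completed_zeta s * completed_zeta (s + 1) = 2 * q * Y"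
    unfolding Y_def q_def by (rule completed_zeta_mult[OF s])
  \<comment> \<open>The factorisation \<open>(2 - q) * (1 - 2 * q)\<close>, with
    \<open>2 - q\<close> written as \<open>q * (2 * 2 powr s - 1)\<close>, which uses up the
    \<open>q\<close> from duplication and prepares conjugate factors.\<close>
  have "q * ((2 * 2 powr s - 1) * (1 - 2 * q)) = (2 * (2 powr s * q) - q) * (1 - 2 * q)" by (simp add: algebra_simps)
  also have "\<dots> = 2 - 5 * q + 2 * q\<^sup>2" unfolding q by (simp add: algebra_simps power2_eq_square)
  finally have qW: "q * ((2 * 2 powr s - 1) * (1 - 2 * q)) = 2 - 5 * q + 2 * q\<^sup>2" .
  have "z\<^sup>2 / 8 * (2 * q * Y) * ((2 * 2 powr s - 1) * (1 - 2 * q)) = z\<^sup>2 / 4 * ((q * ((2 * 2 powr s - 1) * (1 - 2 * q))) * Y)"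
    by simp
  then have "z\<^sup>2 / 8 * (2 * q * Y) * ((2 * 2 powr s - 1) * (1 - 2 * q)) = z\<^sup>2 / 4 * ((2 - 5 * q + 2 * q\<^sup>2) * Y)"
    unfolding qW .
  then show ?thesis unfolding 1 Ig s_def[symmetric] cz q_def[symmetric] by (rule sym)
qed

text \<open>The excluded points are those where \<open>z / 2\<close> or \<open>z / 2 + 1\<close>
  meets one of the singularities 0 and 1 of \<open>completed_zeta\<close>; the plane without them is
  still connected.\<close>

lemma log_theta_half_sum_continuation:
  assumes z: "z \<noteq> 0" "z \<noteq> 2" "z \<noteq> -2"
  shows "1 / 2 + z\<^sup>2 / 2 * (log_theta_half (- z) + log_theta_half z) =
    z\<^sup>2 / 8 * (completed_zeta (z / 2) * completed_zeta (z / 2 + 1)) * ((2 * 2 powr (z / 2) - 1) * (1 - 2 * 2 powr (- (z / 2))))"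
proof (rule analytic_continuation_open[of "{z. Re z > 2}" "- {0, 2, -2}"
    "\<lambda>z. 1 / 2 + z\<^sup>2 / 2 * (log_theta_half (- z) + log_theta_half z)"
    "\<lambda>z. z\<^sup>2 / 8 * (completed_zeta (z / 2) * completed_zeta (z / 2 + 1)) * ((2 * 2 powr (z / 2) - 1) * (1 - 2 * 2 powr (- (z / 2))))"])
  have "3 \<in> {z. Re z > 2}" by simp
  then show "{z. Re z > 2} \<noteq> {}" by blast
  show "connected (- {0, 2, -2 :: complex})"
    using connected_open_delete_finite[of UNIV "{0, 2, -2 :: complex}"] connected_UNIV by (simp add: Compl_eq_Diff_UNIV)
  have c: "(\<lambda>z. completed_zeta (f z)) holomorphic_on - {0, 2, -2}"
    if "f holomorphic_on - {0, 2, -2}" "f ` (- {0, 2, -2}) \<subseteq> - {0, 1}" for f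
    using holomorphic_on_compose_gen[OF that(1) completed_zeta_holomorphic that(2)] by (simp add: o_def)
  show "(\<lambda>z. z\<^sup>2 / 8 * (completed_zeta (z / 2) * completed_zeta (z / 2 + 1)) * ((2 * 2 powr (z / 2) - 1) * (1 - 2 * 2 powr (- (z / 2)))))
     holomorphic_on - {0, 2, -2}"
    by (intro holomorphic_intros c, auto simp: field_simps add_eq_0_iff) (metis minus_minus)
  show "(\<lambda>z. 1 / 2 + z\<^sup>2 / 2 * (log_theta_half (- z) + log_theta_half z)) holomorphic_on - {0, 2, -2}"
    by (intro holomorphic_intros) auto
qed (use z log_theta_half_sum in \<open>auto simp: open_halfspace_Re_gt open_Diff finite_imp_closed intro!: open_Compl\<close>)

text \<open>The integral form of \<open>xi_Q 0 (\<i> * x) / pi\<close>, real and defined for all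
  \<open>x\<close>. Evenness is visible here, whereas the sign is visible only in
  \<open>theta_density_formula\<close>.\<close>

definition levy_density :: "real \<Rightarrow> real" where
  "levy_density x = 1 / pi * (1 / 2 - x\<^sup>2 * (LINT r:{0<..}|lborel. log_theta r * cos (x * r)))"

lemma log_theta_half_cos:
  shows "set_integrable lborel {0<..} (\<lambda>r. log_theta r * cos (x * r))"
    and "log_theta_half (- (\<i> * of_real x)) + log_theta_half (\<i> * of_real x) = of_real (2 * (LINT r:{0<..}|lborel. log_theta r * cos (x * r)))"
proof -
  have e: "of_real (log_theta r) * exp (- (\<i> * of_real x) * of_real r) + of_real (log_theta r) * exp ((\<i> * of_real x) * of_real r)
     = complex_of_real (2 * (log_theta r * cos (x * r)))" for r
  proof -
    have "exp (- (\<i> * of_real x) * of_real r) + exp ((\<i> * of_real x) * of_real r) = complex_of_real (2 * cos (x * r))"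
      by (simp add: complex_eq_iff Re_exp Im_exp)
    then show ?thesis by (simp only: distrib_left[symmetric] of_real_mult) simp
  qed
  note i = set_integral_add[OF log_theta_half(1)[of "- (\<i> * of_real x)"] log_theta_half(1)[of "\<i> * of_real x"], unfolded e log_theta_half(2)[symmetric]]
  have "set_integrable lborel {0<..} (\<lambda>r. 2 * (log_theta r * cos (x * r)))"
    using i(1) unfolding set_integrable_def by (auto dest: integrable_Re)
  then show "set_integrable lborel {0<..} (\<lambda>r. log_theta r * cos (x * r))" by simp
  have "(LINT r:{0<..}|lborel. complex_of_real (2 * (log_theta r * cos (x * r)))) = of_real (LINT r:{0<..}|lborel. 2 * (log_theta r * cos (x * r)))"
    by (rule set_integral_complex_of_real)
  then show "log_theta_half (- (\<i> * of_real x)) + log_theta_half (\<i> * of_real x) = of_real (2 * (LINT r:{0<..}|lborel. log_theta r * cos (x * r)))"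
    using i(2) by simp
qed

lemma xi_Q_levy_density: "xi_Q 0 (\<i> * of_real x) = of_real (pi * levy_density x)"
  unfolding xi_Q_0 log_theta_half_cos(2) by (simp add: levy_density_def power_mult_distrib)

text \<open>At \<open>s = \<i> * x / 2\<close> one has \<open>cnj s = - s\<close>, so reflection
  gives \<open>completed_zeta (s + 1) = cnj (completed_zeta s)\<close>, and with
  \<open>A = 2 powr (1 + s)\<close> the other factor is
  \<open>(A - 1) * (1 - cnj A) = - \<bar>1 - A\<bar>^2\<close>. The minus sign cancels that of
  \<open>(\<i> * x)^2\<close>.\<close>

lemma theta_density_formula_eq:
  assumes x: "x \<noteq> 0"
  shows "theta_density_formula x = levy_density x"
proof -
  define s where "s = \<i> * of_real x / 2"
  have s0: "s \<noteq> 0" "s \<noteq> 1" using x by (auto simp: s_def complex_eq_iff)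
  have zh: "zeta_hat s = completed_zeta s"
  proof (rule zeta_hat_eq[OF s0(2)])
    show "s / 2 \<notin> \<int>\<^sub>\<le>\<^sub>0" using x by (auto simp: s_def complex_eq_iff elim!: nonpos_Ints_cases)
  qed
  have cs: "cnj s = - s" by (simp add: s_def complex_eq_iff)
  have cz: "completed_zeta (s + 1) = cnj (completed_zeta s)"
    using completed_zeta_reflect[of "- s"] completed_zeta_cnj[of s] by (simp add: cs add.commute)
  define A where "A = (2::complex) powr (1 + s)"
  have A: "A = 2 * 2 powr s" by (simp add: A_def powr_add)
  have cA: "cnj A = 2 * 2 powr (- s)" unfolding A using cs by (simp add: cnj_powr)
  have "2 * s = \<i> * of_real x" by (simp add: s_def)
  then have z: "\<i> * of_real x \<noteq> 0" "\<i> * of_real x \<noteq> 2" "\<i> * of_real x \<noteq> -2" "\<i> * of_real x / 2 = s"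
    using x by (auto simp: complex_eq_iff s_def)
  have "of_real (pi * levy_density x) = (\<i> * of_real x)\<^sup>2 / 8 * (completed_zeta s * cnj (completed_zeta s)) * ((A - 1) * (1 - cnj A))"
    unfolding xi_Q_levy_density[symmetric] xi_Q_0 log_theta_half_sum_continuation[OF z(1-3)] z(4) cz A cA[unfolded A] ..
  also have "(A - 1) * (1 - cnj A) = - ((1 - A) * cnj (1 - A))" by (simp add: algebra_simps)
  also have "(\<i> * of_real x)\<^sup>2 / 8 * (completed_zeta s * cnj (completed_zeta s)) * - ((1 - A) * cnj (1 - A)) =
      of_real (x\<^sup>2 / 8 * (cmod (completed_zeta s))\<^sup>2 * (cmod (1 - A))\<^sup>2)"
    unfolding complex_norm_square[symmetric] by (simp add: power_mult_distrib)
  finally have "pi * levy_density x = x\<^sup>2 / 8 * (cmod (completed_zeta s))\<^sup>2 * (cmod (1 - A))\<^sup>2"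
    using of_real_eq_iff by blast
  then have "levy_density x = x\<^sup>2 / 8 * (cmod (completed_zeta s))\<^sup>2 * (cmod (1 - A))\<^sup>2 / pi"
    by (metis nonzero_mult_div_cancel_left pi_neq_zero)
  then show ?thesis
    unfolding theta_density_formula_def s_def[symmetric] zh A_def by simp
qed

lemma continuous_levy_density: "continuous_on UNIV levy_density"
proof -
  have "continuous_on UNIV (\<lambda>x. Re (1 / of_real pi * xi_Q 0 (\<i> * of_real x)))"
    unfolding xi_Q_0
    by (intro continuous_intros continuous_on_compose2[OF holomorphic_on_imp_continuous_on[OF log_theta_half(3)]]) auto
  then show ?thesis unfolding xi_Q_levy_density by simp
qed

lemma theta_density_eq: "theta_density x = levy_density x"
proof (cases "x = 0")
  case True
  have "levy_density \<midarrow>0\<rightarrow> levy_density 0"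
    using continuous_levy_density by (simp add: continuous_on_eq_continuous_at isCont_def)
  then have "theta_density_formula \<midarrow>0\<rightarrow> levy_density 0"
    by (rule Lim_transform_eventually) (auto simp: eventually_at_filter theta_density_formula_eq)
  then have "Lim (at 0) theta_density_formula = levy_density 0" by (intro tendsto_Lim) auto
  then show ?thesis using True by (simp add: theta_density_def)
qed (simp add: theta_density_def theta_density_formula_eq)

text \<open>At 0 the integral form gives \<open>1 / (2 * pi)\<close> directly; elsewhere the squares
  in \<open>theta_density_formula\<close> decide the sign.\<close>

lemma levy_density_nonneg: "0 \<le> levy_density x"
proof (cases "x = 0")
  case False
  have "0 \<le> theta_density_formula x" unfolding theta_density_formula_def by (intro mult_nonneg_nonneg) auto
  then show ?thesis using theta_density_formula_eq[OF False] by simp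
qed (simp add: levy_density_def)

lemma levy_density_uminus: "levy_density (- x) = levy_density x"
  by (simp add: levy_density_def)

section \<open>Cosine transforms\<close>

text \<open>Normalised by its value 1 at the origin rather than by mass, so that it increases to 1
  as the width \<open>n\<close> grows.\<close>

definition gauss :: "real \<Rightarrow> real \<Rightarrow> real" where
  "gauss n t = exp (- (t / n)\<^sup>2 / 2)"

lemma gauss_measurable [measurable]: "gauss n \<in> borel_measurable borel"
  unfolding gauss_def[abs_def] by measurable

lemma gauss_pos: "0 < gauss n t" and gauss_le_1: "gauss n t \<le> 1"
  by (auto simp: gauss_def)

lemma gauss_nonneg [simp]: "0 \<le> gauss n t"
  by (simp add: gauss_def)

lemma gauss_integrable_1: "integrable lborel (gauss 1)"
proof -
  have "integrable lborel (\<lambda>t. sqrt (2 * pi) * std_normal_density t)"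
    by (intro integrable_mult_right integrable_normal_density) simp
  then show ?thesis by (simp add: std_normal_density_def gauss_def[abs_def])
qed

lemma gauss_integrable: "n > 0 \<Longrightarrow> integrable lborel (gauss n)"
  using lborel_integrable_real_affine[OF gauss_integrable_1, of "1 / n" 0]
  by (simp add: gauss_def[abs_def])

lemma gauss_cos_1: "(\<integral>t. gauss 1 t * cos (y * t) \<partial>lborel) = sqrt (2 * pi) * gauss 1 y"
proof -
  have c: "char std_normal_distribution y = (\<integral>t. std_normal_density t *\<^sub>R exp (\<i> * of_real (y * t)) \<partial>lborel)"
    unfolding char_def by (rule integral_density) auto
  have i: "integrable lborel (\<lambda>t. std_normal_density t *\<^sub>R exp (\<i> * of_real (y * t)))"
  proof (rule Bochner_Integration.integrable_bound)
    show "integrable lborel std_normal_density" by (rule integrable_normal_density) simp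
  qed auto
  have "exp (- y\<^sup>2 / 2) = Re (char std_normal_distribution y)"
    by (simp add: char_std_normal_distribution)
  also have "\<dots> = (\<integral>t. Re (std_normal_density t *\<^sub>R exp (\<i> * of_real (y * t))) \<partial>lborel)"
    unfolding c using i by (rule integral_Re[symmetric])
  also have "\<dots> = (\<integral>t. 1 / sqrt (2 * pi) * (gauss 1 t * cos (y * t)) \<partial>lborel)"
    by (intro Bochner_Integration.integral_cong refl) (simp add: std_normal_density_def gauss_def Re_exp)
  also have "\<dots> = 1 / sqrt (2 * pi) * (\<integral>t. gauss 1 t * cos (y * t) \<partial>lborel)"
    by (rule integral_mult_right_zero)
  finally show ?thesis by (simp add: gauss_def field_simps)
qed

lemma gauss_cos:
  assumes n: "n > 0"
  shows "(\<integral>t. gauss n t * cos (y * t) \<partial>lborel) = n * sqrt (2 * pi) * gauss 1 (n * y)"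
proof -
  have "(\<integral>t. gauss n t * cos (y * t) \<partial>lborel) = n * (\<integral>t. gauss n (0 + n * t) * cos (y * (0 + n * t)) \<partial>lborel)"
    using lborel_integral_real_affine[of n "\<lambda>t. gauss n t * cos (y * t)" 0] n by simp
  also have "(\<lambda>t. gauss n (0 + n * t) * cos (y * (0 + n * t))) = (\<lambda>t. gauss 1 t * cos ((n * y) * t))"
    using n by (simp add: gauss_def mult_ac)
  finally show ?thesis unfolding gauss_cos_1 by simp
qed

lemma integrable_cos_mult:
  fixes f :: "real \<Rightarrow> real"
  assumes "integrable lborel f"
  shows "integrable lborel (\<lambda>r. f r * cos (t * r))"
proof (rule Bochner_Integration.integrable_bound[OF assms])
  have [measurable]: "f \<in> borel_measurable borel" using assms by auto
  show "(\<lambda>r. f r * cos (t * r)) \<in> borel_measurable lborel" by measurable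
  show "AE r in lborel. norm (f r * cos (t * r)) \<le> norm (f r)"
    by (intro AE_I2) (simp add: abs_mult mult_left_le)
qed

lemma integral_swap:
  fixes f :: "real \<times> real \<Rightarrow> real"
  assumes "integrable (lborel \<Otimes>\<^sub>M lborel) f"
  shows "(\<integral>y. (\<integral>x. f (x, y) \<partial>lborel) \<partial>lborel) = (\<integral>x. (\<integral>y. f (x, y) \<partial>lborel) \<partial>lborel)"
  using lborel_pair.Fubini_integral[of "\<lambda>x y. f (x, y)"] assms by simp

section \<open>Fourier inversion by Gaussian damping\<close>

definition cos_transform :: "(real \<Rightarrow> real) \<Rightarrow> real \<Rightarrow> real" where
  "cos_transform h t = (\<integral>r. h r * cos (t * r) \<partial>lborel)"

lemma cos_transform_measurable:
  assumes [measurable]: "h \<in> borel_measurable borel"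
  shows "cos_transform h \<in> borel_measurable borel"
  unfolding cos_transform_def[abs_def] by measurable

lemma cos_transform_bound:
  assumes "integrable lborel h"
  shows "\<bar>cos_transform h t\<bar> \<le> (\<integral>r. \<bar>h r\<bar> \<partial>lborel)"
proof -
  have "norm (\<integral>r. h r * cos (t * r) \<partial>lborel) \<le> (\<integral>r. norm (h r * cos (t * r)) \<partial>lborel)" by (rule integral_norm_bound)
  also have "\<dots> \<le> (\<integral>r. \<bar>h r\<bar> \<partial>lborel)"
    using assms by (intro integral_mono integrable_norm integrable_cos_mult) (auto simp: abs_mult mult_left_le)
  finally show ?thesis by (simp add: cos_transform_def)
qed

lemma cos_transform_uminus: "cos_transform h (- t) = cos_transform h t"
  by (simp add: cos_transform_def)

lemma cos_transform_continuous:
  assumes h: "integrable lborel h"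
  shows "continuous_on UNIV (cos_transform h)"
proof (rule continuous_at_imp_continuous_on, intro ballI)
  fix t
  have [measurable]: "h \<in> borel_measurable borel" using h by auto
  show "isCont (cos_transform h) t"
    unfolding continuous_at_sequentially comp_def cos_transform_def
  proof (intro allI impI)
    fix x :: "nat \<Rightarrow> real" assume "x \<longlonglongrightarrow> t"
    then have "(\<lambda>n. h r * cos (x n * r)) \<longlonglongrightarrow> h r * cos (t * r)" for r by (intro tendsto_intros)
    then show "(\<lambda>n. \<integral>r. h r * cos (x n * r) \<partial>lborel) \<longlonglongrightarrow> (\<integral>r. h r * cos (t * r) \<partial>lborel)"
      by (intro integral_dominated_convergence[where w = "\<lambda>r. \<bar>h r\<bar>"])
        (use h in \<open>auto simp: abs_mult mult_left_le\<close>)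
  qed
qed

lemma gauss_tendsto_1: "(\<lambda>k. gauss (real (Suc k)) t) \<longlonglongrightarrow> 1"
proof -
  have "(\<lambda>k. exp (- (t * (1 / real (Suc k)))\<^sup>2 / 2)) \<longlonglongrightarrow> exp (- (t * 0)\<^sup>2 / 2)"
    by (intro tendsto_intros LIMSEQ_Suc[OF lim_1_over_n]) simp
  then show ?thesis by (simp add: gauss_def)
qed

text \<open>Damping the transform by a Gaussian of width \<open>n\<close> smooths the function at
  scale \<open>1 / n\<close>, by Fubini and the self-duality of the Gaussian. Evenness merges the
  two shifts from the product of cosines.\<close>

lemma gauss_smoothing:
  fixes h :: "real \<Rightarrow> real"
  assumes h: "integrable lborel h" and even: "\<And>x. h (- x) = h x" and n: "n > 0"
  shows "(\<integral>t. cos_transform h t * gauss n t * cos (s * t) \<partial>lborel) =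
    sqrt (2 * pi) * (\<integral>z. h (s + z / n) * gauss 1 z \<partial>lborel)"
proof -
  have [measurable]: "h \<in> borel_measurable borel" using h by auto
  define f where "f = (\<lambda>(r, t). h r * cos (t * r) * gauss n t * cos (s * t))"
  have intf: "integrable (lborel \<Otimes>\<^sub>M lborel) f"
  proof (rule integrable_pair_bound[OF h gauss_integrable[OF n]])
    show "f \<in> borel_measurable (borel \<Otimes>\<^sub>M borel)" unfolding f_def by measurable
    fix x y
    have "\<bar>f (x, y)\<bar> = \<bar>h x\<bar> * \<bar>gauss n y\<bar> * (\<bar>cos (y * x)\<bar> * \<bar>cos (s * y)\<bar>)" by (simp add: f_def abs_mult)
    also have "\<dots> \<le> \<bar>h x\<bar> * \<bar>gauss n y\<bar> * 1" by (intro mult_left_mono mult_le_one) auto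
    finally show "\<bar>f (x, y)\<bar> \<le> \<bar>h x\<bar> * \<bar>gauss n y\<bar>" by simp
  qed
  have ig: "integrable lborel (\<lambda>t. gauss n t * cos (y * t))" for y
    by (rule integrable_cos_mult[OF gauss_integrable[OF n]])
  have inner: "(\<integral>t. f (r, t) \<partial>lborel) = n * sqrt (2 * pi) / 2 * (h r * gauss 1 (n * (r - s)) + h r * gauss 1 (n * (r + s)))" for r
  proof -
    have fe: "f (r, t) = h r / 2 * (gauss n t * cos ((r - s) * t) + gauss n t * cos ((r + s) * t))" for t
    proof -
      have c: "cos (t * r) * cos (s * t) = (cos ((r - s) * t) + cos ((r + s) * t)) / 2"
        unfolding cos_times_cos by (simp add: algebra_simps)
      have "f (r, t) = h r * gauss n t * (cos (t * r) * cos (s * t))" by (simp add: f_def)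
      then show ?thesis unfolding c by (simp add: distrib_left)
    qed
    show ?thesis
      unfolding fe integral_mult_right_zero Bochner_Integration.integral_add[OF ig ig] gauss_cos[OF n]
      by (simp add: algebra_simps)
  qed
  have i1: "integrable lborel (\<lambda>r. h r * gauss 1 (n * (r - c)))" for c
  proof (rule Bochner_Integration.integrable_bound[OF h])
    show "AE r in lborel. norm (h r * gauss 1 (n * (r - c))) \<le> norm (h r)"
      using gauss_le_1[of 1] gauss_pos[of 1] by (intro AE_I2) (simp add: abs_mult mult_left_le less_imp_le)
  qed measurable
  have refl: "(\<integral>r. h r * gauss 1 (n * (r + s)) \<partial>lborel) = (\<integral>r. h r * gauss 1 (n * (r - s)) \<partial>lborel)"
  proof -
    have "(\<integral>r. h r * gauss 1 (n * (r + s)) \<partial>lborel) = (\<integral>r. h (- r) * gauss 1 (n * (- r + s)) \<partial>lborel)"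
      by (rule integral_reflect_lborel[symmetric])
    also have "\<dots> = (\<integral>r. h r * gauss 1 (n * (r - s)) \<partial>lborel)"
    proof (rule Bochner_Integration.integral_cong[OF refl])
      fix r
      have "gauss 1 (n * (- r + s)) = gauss 1 (n * (r - s))"
        unfolding gauss_def by (rule arg_cong[where f = "\<lambda>x. exp (- x / 2)"]) (simp add: power2_eq_square algebra_simps)
      then show "h (- r) * gauss 1 (n * (- r + s)) = h r * gauss 1 (n * (r - s))" by (simp only: even)
    qed
    finally show ?thesis .
  qed
  have "(\<integral>t. cos_transform h t * gauss n t * cos (s * t) \<partial>lborel) = (\<integral>t. (\<integral>r. f (r, t) \<partial>lborel) \<partial>lborel)"
    unfolding cos_transform_def f_def by simp
  also have "\<dots> = (\<integral>r. (\<integral>t. f (r, t) \<partial>lborel) \<partial>lborel)" by (rule integral_swap[OF intf])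
  also have "\<dots> = n * sqrt (2 * pi) / 2 * ((\<integral>r. h r * gauss 1 (n * (r - s)) \<partial>lborel) + (\<integral>r. h r * gauss 1 (n * (r + s)) \<partial>lborel))"
    unfolding inner using i1[of s] i1[of "- s"] by simp
  also have "\<dots> = n * sqrt (2 * pi) * (\<integral>r. h r * gauss 1 (n * (r - s)) \<partial>lborel)" unfolding refl by simp
  also have "(\<integral>r. h r * gauss 1 (n * (r - s)) \<partial>lborel) = \<bar>1 / n\<bar> *\<^sub>R (\<integral>z. h (s + 1 / n * z) * gauss 1 (n * ((s + 1 / n * z) - s)) \<partial>lborel)"
    by (rule lborel_integral_real_affine) (use n in simp)
  finally show ?thesis using n by (simp add: mult.commute)
qed

lemma gauss_smoothing_limit:
  fixes h :: "real \<Rightarrow> real"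
  assumes h: "integrable lborel h" and even: "\<And>x. h (- x) = h x"
    and cont: "continuous_on UNIV h" and bd: "\<And>x. \<bar>h x\<bar> \<le> B"
  shows "(\<lambda>k. \<integral>t. cos_transform h t * gauss (real (Suc k)) t * cos (s * t) \<partial>lborel) \<longlonglongrightarrow> 2 * pi * h s"
proof -
  have [measurable]: "h \<in> borel_measurable borel" using h by auto
  have "(\<lambda>k. \<integral>z. h (s + z / real (Suc k)) * gauss 1 z \<partial>lborel) \<longlonglongrightarrow> (\<integral>z. h s * gauss 1 z \<partial>lborel)"
  proof (rule integral_dominated_convergence[where w = "\<lambda>z. B * gauss 1 z"])
    show "integrable lborel (\<lambda>z. B * gauss 1 z)" using gauss_integrable_1 by simp
    have "(\<lambda>k. h (s + z * (1 / real (Suc k)))) \<longlonglongrightarrow> h (s + z * 0)" for z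
    proof (rule continuous_on_tendsto_compose[OF cont])
      show "(\<lambda>k. s + z * (1 / real (Suc k))) \<longlonglongrightarrow> s + z * 0"
        by (intro tendsto_intros LIMSEQ_Suc[OF lim_1_over_n])
    qed auto
    then show "AE z in lborel. (\<lambda>k. h (s + z / real (Suc k)) * gauss 1 z) \<longlonglongrightarrow> h s * gauss 1 z"
      by (intro AE_I2 tendsto_intros) simp
    show "AE z in lborel. norm (h (s + z / real (Suc k)) * gauss 1 z) \<le> B * gauss 1 z" for k
      using bd gauss_pos[of 1] by (intro AE_I2) (simp add: abs_mult mult_right_mono less_imp_le)
  qed measurable
  then have "(\<lambda>k. sqrt (2 * pi) * (\<integral>z. h (s + z / real (Suc k)) * gauss 1 z \<partial>lborel)) \<longlonglongrightarrow> sqrt (2 * pi) * (\<integral>z. h s * gauss 1 z \<partial>lborel)"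
    by (intro tendsto_intros)
  moreover have "(\<integral>z. h s * gauss 1 z \<partial>lborel) = h s * sqrt (2 * pi)"
    using gauss_cos_1[of 0] by (simp add: gauss_def)
  moreover have "sqrt (2 * pi) * (h s * sqrt (2 * pi)) = 2 * pi * h s" by simp
  moreover have "(\<integral>t. cos_transform h t * gauss (real (Suc k)) t * cos (s * t) \<partial>lborel) =
      sqrt (2 * pi) * (\<integral>z. h (s + z / real (Suc k)) * gauss 1 z \<partial>lborel)" for k
    by (rule gauss_smoothing[OF h even]) simp
  ultimately show ?thesis by (simp only:)
qed

text \<open>For a nonnegative transform the damped integrals at \<open>s = 0\<close> increase to
  \<open>2 * pi * h 0\<close>, so monotone convergence makes the transform integrable; then
  dominated convergence removes the damping for every \<open>s\<close>.\<close>

lemma fourier_inversion_nonneg: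
  fixes h :: "real \<Rightarrow> real"
  assumes h: "integrable lborel h" and even: "\<And>x. h (- x) = h x"
    and cont: "continuous_on UNIV h" and bd: "\<And>x. \<bar>h x\<bar> \<le> B"
    and nonneg: "\<And>t. 0 \<le> cos_transform h t"
  shows "integrable lborel (cos_transform h)"
    and "(\<integral>t. cos_transform h t * cos (s * t) \<partial>lborel) = 2 * pi * h s"
proof -
  have [measurable]: "cos_transform h \<in> borel_measurable borel"
    by (rule cos_transform_measurable) (use h in auto)
  have ik: "integrable lborel (\<lambda>t. cos_transform h t * gauss (real (Suc k)) t)" for k
  proof (rule Bochner_Integration.integrable_bound[OF integrable_mult_right[OF gauss_integrable]])
    show "AE t in lborel. norm (cos_transform h t * gauss (real (Suc k)) t) \<le> norm ((\<integral>r. \<bar>h r\<bar> \<partial>lborel) * gauss (real (Suc k)) t)"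
      using cos_transform_bound[OF h] by (intro AE_I2) (auto simp: abs_mult intro!: mult_right_mono order_trans[OF _ abs_ge_self])
  qed auto
  have mono: "gauss (real (Suc k)) t \<le> gauss (real (Suc l)) t" if "k \<le> l" for k l t
  proof -
    have "(t / real (Suc l))\<^sup>2 \<le> (t / real (Suc k))\<^sup>2"
      unfolding power_divide using that by (intro divide_left_mono power_mono) auto
    then show ?thesis by (simp add: gauss_def)
  qed
  show int: "integrable lborel (cos_transform h)"
  proof (rule integrable_monotone_convergence[where f = "\<lambda>k t. cos_transform h t * gauss (real (Suc k)) t" and x = "2 * pi * h 0"])
    show "AE t in lborel. mono (\<lambda>k. cos_transform h t * gauss (real (Suc k)) t)"
      using mono nonneg by (intro AE_I2 monoI mult_left_mono) auto
    show "AE t in lborel. (\<lambda>k. cos_transform h t * gauss (real (Suc k)) t) \<longlonglongrightarrow> cos_transform h t"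
      using tendsto_mult[OF tendsto_const gauss_tendsto_1] by (intro AE_I2) simp
    show "(\<lambda>k. \<integral>t. cos_transform h t * gauss (real (Suc k)) t \<partial>lborel) \<longlonglongrightarrow> 2 * pi * h 0"
      using gauss_smoothing_limit[OF h even cont bd, of 0] by simp
  qed (use ik in auto)
  have "(\<lambda>k. \<integral>t. cos_transform h t * gauss (real (Suc k)) t * cos (s * t) \<partial>lborel) \<longlonglongrightarrow> (\<integral>t. cos_transform h t * cos (s * t) \<partial>lborel)"
  proof (rule integral_dominated_convergence[where w = "\<lambda>t. cos_transform h t"])
    show "AE t in lborel. (\<lambda>k. cos_transform h t * gauss (real (Suc k)) t * cos (s * t)) \<longlonglongrightarrow> cos_transform h t * cos (s * t)"
    proof (intro AE_I2)
      fix t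
      have "(\<lambda>k. cos_transform h t * gauss (real (Suc k)) t * cos (s * t)) \<longlonglongrightarrow> cos_transform h t * 1 * cos (s * t)"
        by (intro tendsto_intros gauss_tendsto_1)
      then show "(\<lambda>k. cos_transform h t * gauss (real (Suc k)) t * cos (s * t)) \<longlonglongrightarrow> cos_transform h t * cos (s * t)" by simp
    qed
    show "AE t in lborel. norm (cos_transform h t * gauss (real (Suc k)) t * cos (s * t)) \<le> cos_transform h t" for k
    proof (intro AE_I2)
      fix t
      have "cos_transform h t * (gauss (real (Suc k)) t * \<bar>cos (s * t)\<bar>) \<le> cos_transform h t * 1"
        using gauss_le_1 gauss_pos[of "real (Suc k)" t] nonneg by (intro mult_left_mono mult_le_one) auto
      then show "norm (cos_transform h t * gauss (real (Suc k)) t * cos (s * t)) \<le> cos_transform h t"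
        using nonneg[of t] gauss_pos[of "real (Suc k)" t] by (simp add: abs_mult mult.assoc)
    qed
  qed (use int in auto)
  then show "(\<integral>t. cos_transform h t * cos (s * t) \<partial>lborel) = 2 * pi * h s"
    using gauss_smoothing_limit[OF h even cont bd] LIMSEQ_unique by blast
qed

text \<open>Positive definiteness in the weak form needed below: all Gaussian-damped cosine
  transforms are nonnegative. Unlike positivity of the transform itself, this makes sense for
  constants and survives bounded pointwise limits.\<close>

definition pos_ft :: "(real \<Rightarrow> real) \<Rightarrow> bool" where
  "pos_ft h \<longleftrightarrow> h \<in> borel_measurable borel \<and> (\<exists>B. \<forall>r. \<bar>h r\<bar> \<le> B) \<and>
     (\<forall>n>0. \<forall>t. 0 \<le> (\<integral>r. h r * gauss n r * cos (t * r) \<partial>lborel))"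

lemma integrable_bounded_gauss_cos:
  assumes [measurable]: "h \<in> borel_measurable borel" and B: "\<And>r. \<bar>h r\<bar> \<le> B" and n: "n > 0"
  shows "integrable lborel (\<lambda>r. h r * gauss n r)" "integrable lborel (\<lambda>r. h r * gauss n r * cos (t * r))"
proof -
  show "integrable lborel (\<lambda>r. h r * gauss n r)"
  proof (rule Bochner_Integration.integrable_bound[OF integrable_mult_right[OF gauss_integrable[OF n], of B]])
    show "AE r in lborel. norm (h r * gauss n r) \<le> norm (B * gauss n r)"
      using B by (intro AE_I2) (auto simp: abs_mult intro!: mult_right_mono order_trans[OF _ abs_ge_self])
  qed auto
  then show "integrable lborel (\<lambda>r. h r * gauss n r * cos (t * r))" by (rule integrable_cos_mult)
qed

lemma pos_ft_const: "0 \<le> c \<Longrightarrow> pos_ft (\<lambda>_. c)"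
  using gauss_pos[of 1] by (auto simp: pos_ft_def mult.assoc gauss_cos intro!: mult_nonneg_nonneg less_imp_le)

lemma pos_ft_cmult:
  assumes "0 \<le> c" "pos_ft h"
  shows "pos_ft (\<lambda>r. c * h r)"
proof -
  obtain B where B: "\<And>r. \<bar>h r\<bar> \<le> B" using assms(2) unfolding pos_ft_def by blast
  have "\<bar>c * h r\<bar> \<le> c * B" for r using B[of r] assms(1) by (simp add: abs_mult mult_left_mono)
  then show ?thesis using assms by (auto simp: pos_ft_def mult.assoc)
qed

lemma pos_ft_add:
  assumes f: "pos_ft f" and g: "pos_ft g"
  shows "pos_ft (\<lambda>r. f r + g r)"
proof -
  obtain B where B: "\<And>r. \<bar>f r\<bar> \<le> B" using f unfolding pos_ft_def by blast
  obtain C where C: "\<And>r. \<bar>g r\<bar> \<le> C" using g unfolding pos_ft_def by blast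
  have m: "f \<in> borel_measurable borel" "g \<in> borel_measurable borel" using f g by (auto simp: pos_ft_def)
  have "\<bar>f r + g r\<bar> \<le> B + C" for r using B[of r] C[of r] by linarith
  moreover have "0 \<le> (\<integral>r. (f r + g r) * gauss n r * cos (t * r) \<partial>lborel)" if n: "n > 0" for n t
  proof -
    have "(\<integral>r. (f r + g r) * gauss n r * cos (t * r) \<partial>lborel) =
       (\<integral>r. f r * gauss n r * cos (t * r) \<partial>lborel) + (\<integral>r. g r * gauss n r * cos (t * r) \<partial>lborel)"
      using integrable_bounded_gauss_cos(2)[OF m(1) B n, of t] integrable_bounded_gauss_cos(2)[OF m(2) C n, of t]
      by (simp add: distrib_right)
    then show ?thesis using f g n by (simp add: pos_ft_def)
  qed
  ultimately show ?thesis using m by (auto simp: pos_ft_def)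
qed

lemma pos_ft_limit:
  assumes f: "\<And>k. pos_ft (f k)" and B: "\<And>k r. \<bar>f k r\<bar> \<le> B" and lim: "\<And>r. (\<lambda>k. f k r) \<longlonglongrightarrow> h r"
  shows "pos_ft h"
proof -
  have m: "f k \<in> borel_measurable borel" for k using f by (simp add: pos_ft_def)
  have [measurable]: "h \<in> borel_measurable borel" by (rule borel_measurable_LIMSEQ_real[OF lim m])
  have hB: "\<bar>h r\<bar> \<le> B" for r
    by (rule LIMSEQ_le_const2[OF tendsto_rabs[OF lim]]) (use B in auto)
  have "0 \<le> (\<integral>r. h r * gauss n r * cos (t * r) \<partial>lborel)" if n: "n > 0" for n t
  proof (rule LIMSEQ_le_const)
    show "(\<lambda>k. \<integral>r. f k r * gauss n r * cos (t * r) \<partial>lborel) \<longlonglongrightarrow> (\<integral>r. h r * gauss n r * cos (t * r) \<partial>lborel)"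
    proof (rule integral_dominated_convergence[where w = "\<lambda>r. B * gauss n r"])
      show "integrable lborel (\<lambda>r. B * gauss n r)" using gauss_integrable[OF n] by simp
      show "AE r in lborel. (\<lambda>k. f k r * gauss n r * cos (t * r)) \<longlonglongrightarrow> h r * gauss n r * cos (t * r)"
        by (intro AE_I2 tendsto_intros lim)
      show "AE r in lborel. norm (f k r * gauss n r * cos (t * r)) \<le> B * gauss n r" for k
      proof (intro AE_I2)
        fix r
        have "\<bar>f k r\<bar> * gauss n r * \<bar>cos (t * r)\<bar> \<le> B * gauss n r * 1"
          using B[of k r] gauss_pos[of n r] by (intro mult_mono) auto
        then show "norm (f k r * gauss n r * cos (t * r)) \<le> B * gauss n r" using gauss_pos[of n r] by (simp add: abs_mult)
      qed
      show "(\<lambda>r. h r * gauss n r * cos (t * r)) \<in> borel_measurable lborel" by measurable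
      show "(\<lambda>r. f k r * gauss n r * cos (t * r)) \<in> borel_measurable lborel" for k
        using m[of k] by measurable
    qed
    show "\<exists>N. \<forall>k\<ge>N. 0 \<le> (\<integral>r. f k r * gauss n r * cos (t * r) \<partial>lborel)"
      using f n by (auto simp: pos_ft_def)
  qed
  then show ?thesis using hB unfolding pos_ft_def by auto
qed

text \<open>The product of cosines turns multiplication by \<open>cos_transform k\<close> into an
  average, with weight \<open>k \<ge> 0\<close>, of the damped transforms of \<open>h\<close> at
  \<open>t - x\<close> and \<open>t + x\<close>, which are nonnegative.\<close>

lemma pos_ft_mult_cos_transform:
  assumes h: "pos_ft h" and k: "integrable lborel k" and k0: "\<And>x. 0 \<le> k x"
  shows "pos_ft (\<lambda>r. h r * cos_transform k r)"
proof -
  obtain B where B: "\<And>r. \<bar>h r\<bar> \<le> B" using h unfolding pos_ft_def by blast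
  have B0: "0 \<le> B" using B[of 0] by linarith
  have [measurable]: "h \<in> borel_measurable borel" using h by (simp add: pos_ft_def)
  have [measurable]: "k \<in> borel_measurable borel" using k by auto
  have [measurable]: "cos_transform k \<in> borel_measurable borel" by (rule cos_transform_measurable) simp
  have bd: "\<bar>h r * cos_transform k r\<bar> \<le> B * (\<integral>r. \<bar>k r\<bar> \<partial>lborel)" for r
    unfolding abs_mult using B cos_transform_bound[OF k] B0 by (intro mult_mono) auto
  have "0 \<le> (\<integral>r. h r * cos_transform k r * gauss n r * cos (t * r) \<partial>lborel)" if n: "n > 0" for n t
  proof -
    define f where "f = (\<lambda>(x, r). k x * cos (r * x) * (h r * gauss n r) * cos (t * r))"
    note hg = integrable_bounded_gauss_cos[of h B n, OF _ B n]
    have intf: "integrable (lborel \<Otimes>\<^sub>M lborel) f"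
    proof (rule integrable_pair_bound[OF k hg(1)])
      show "f \<in> borel_measurable (borel \<Otimes>\<^sub>M borel)" unfolding f_def by measurable
      fix x y
      have "\<bar>f (x, y)\<bar> = \<bar>k x\<bar> * \<bar>h y * gauss n y\<bar> * (\<bar>cos (y * x)\<bar> * \<bar>cos (t * y)\<bar>)" by (simp add: f_def abs_mult)
      also have "\<dots> \<le> \<bar>k x\<bar> * \<bar>h y * gauss n y\<bar> * 1" by (intro mult_left_mono mult_le_one) auto
      finally show "\<bar>f (x, y)\<bar> \<le> \<bar>k x\<bar> * \<bar>h y * gauss n y\<bar>" by simp
    qed simp
    have inner: "(\<integral>r. f (x, r) \<partial>lborel) = k x / 2 * ((\<integral>r. h r * gauss n r * cos ((t - x) * r) \<partial>lborel) + (\<integral>r. h r * gauss n r * cos ((t + x) * r) \<partial>lborel))" for x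
    proof -
      have fe: "f (x, r) = k x / 2 * (h r * gauss n r * cos ((t - x) * r) + h r * gauss n r * cos ((t + x) * r))" for r
      proof -
        have c: "cos (t * r) * cos (r * x) = (cos ((t - x) * r) + cos ((t + x) * r)) / 2"
          unfolding cos_times_cos by (simp add: algebra_simps)
        have "f (x, r) = k x * (h r * gauss n r) * (cos (t * r) * cos (r * x))" by (simp add: f_def)
        then show ?thesis unfolding c by (simp add: distrib_left mult.assoc)
      qed
      have i: "integrable lborel (\<lambda>r. h r * gauss n r * cos (t * r))" for t
        by (rule integrable_bounded_gauss_cos(2)[OF _ B n]) simp
      show ?thesis unfolding fe integral_mult_right_zero Bochner_Integration.integral_add[OF i i] ..
    qed
    have "(\<integral>r. h r * cos_transform k r * gauss n r * cos (t * r) \<partial>lborel) = (\<integral>r. (\<integral>x. f (x, r) \<partial>lborel) \<partial>lborel)"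
    proof (rule Bochner_Integration.integral_cong[OF refl])
      fix r
      have "f (x, r) = (k x * cos (r * x)) * (h r * gauss n r * cos (t * r))" for x by (simp add: f_def)
      then have "(\<integral>x. f (x, r) \<partial>lborel) = cos_transform k r * (h r * gauss n r * cos (t * r))"
        unfolding cos_transform_def by (simp only: integral_mult_left_zero)
      then show "h r * cos_transform k r * gauss n r * cos (t * r) = (\<integral>x. f (x, r) \<partial>lborel)" by simp
    qed
    also have "\<dots> = (\<integral>x. (\<integral>r. f (x, r) \<partial>lborel) \<partial>lborel)" by (rule integral_swap[OF intf])
    also have "0 \<le> \<dots>"
    proof -
      have hp: "0 \<le> (\<integral>r. h r * gauss n r * cos (t * r) \<partial>lborel)" for t using h n by (simp add: pos_ft_def)
      show ?thesis unfolding inner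
        by (rule integral_nonneg_AE, rule AE_I2, rule mult_nonneg_nonneg[OF _ add_nonneg_nonneg[OF hp hp]]) (simp add: k0)
    qed
    finally show ?thesis .
  qed
  then show ?thesis using bd unfolding pos_ft_def by auto
qed

text \<open>For even \<open>k\<close> this is, up to a constant factor, the characteristic function
  of a compound Poisson law with jump intensity \<open>k\<close>. The partial sums of the
  exponential series satisfy \<open>pos_ft\<close> and are bounded by \<open>exp A\<close>.\<close>

lemma pos_ft_exp_cos_transform:
  assumes k: "integrable lborel k" and k0: "\<And>x. 0 \<le> k x"
  shows "pos_ft (\<lambda>r. exp (cos_transform k r))"
proof (rule pos_ft_limit)
  define A where "A = (\<integral>r. \<bar>k r\<bar> \<partial>lborel)"
  have A: "\<bar>cos_transform k r\<bar> \<le> A" for r unfolding A_def by (rule cos_transform_bound[OF k])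
  have pw: "pos_ft (\<lambda>r. cos_transform k r ^ j)" for j
  proof (induction j)
    case (Suc j)
    show ?case using pos_ft_mult_cos_transform[OF Suc k k0] by (simp add: mult.commute)
  qed (use pos_ft_const[of 1] in simp)
  show "pos_ft (\<lambda>r. \<Sum>j<N. inverse (fact j) * cos_transform k r ^ j)" for N
  proof (induction N)
    case (Suc N)
    show ?case using pos_ft_add[OF Suc pos_ft_cmult[OF _ pw[of N], of "inverse (fact N)"]] by simp
  qed (use pos_ft_const[of 0] in simp)
  have exps: "(\<lambda>j. inverse (fact j) * x ^ j) sums exp x" for x :: real
    using exp_converges[of x] by (simp add: scaleR_conv_of_real)
  show "\<bar>\<Sum>j<N. inverse (fact j) * cos_transform k r ^ j\<bar> \<le> exp A" for N r
  proof -
    have "\<bar>\<Sum>j<N. inverse (fact j) * cos_transform k r ^ j\<bar> \<le> (\<Sum>j<N. \<bar>inverse (fact j) * cos_transform k r ^ j\<bar>)"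
      by (rule sum_abs)
    also have "\<dots> \<le> (\<Sum>j<N. inverse (fact j) * A ^ j)"
      using A by (intro sum_mono) (auto simp: abs_mult power_abs intro!: mult_left_mono power_mono)
    also have "\<dots> \<le> exp A"
      unfolding sums_unique[OF exps[of A]] using A[of 0] exps[of A]
      by (intro sum_le_suminf) (auto simp: sums_iff)
    finally show ?thesis .
  qed
  show "(\<lambda>N. \<Sum>j<N. inverse (fact j) * cos_transform k r ^ j) \<longlonglongrightarrow> exp (cos_transform k r)" for r
    using exps[of "cos_transform k r"] by (simp add: sums_def)
qed

text \<open>For integrable functions dominated convergence removes the damping, and the weak notion
  yields the sign of the transform itself.\<close>

lemma pos_ft_cos_transform_nonneg:
  assumes h: "pos_ft h" and int: "integrable lborel h"
  shows "0 \<le> cos_transform h t"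
proof (rule LIMSEQ_le_const)
  have [measurable]: "h \<in> borel_measurable borel" using h by (simp add: pos_ft_def)
  show "(\<lambda>k. \<integral>r. h r * gauss (real (Suc k)) r * cos (t * r) \<partial>lborel) \<longlonglongrightarrow> cos_transform h t"
    unfolding cos_transform_def
  proof (rule integral_dominated_convergence[where w = "\<lambda>r. \<bar>h r\<bar>"])
    show "AE r in lborel. (\<lambda>k. h r * gauss (real (Suc k)) r * cos (t * r)) \<longlonglongrightarrow> h r * cos (t * r)"
    proof (intro AE_I2)
      fix r
      have "(\<lambda>k. h r * gauss (real (Suc k)) r * cos (t * r)) \<longlonglongrightarrow> h r * 1 * cos (t * r)"
        by (intro tendsto_intros gauss_tendsto_1)
      then show "(\<lambda>k. h r * gauss (real (Suc k)) r * cos (t * r)) \<longlonglongrightarrow> h r * cos (t * r)" by simp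
    qed
    show "AE r in lborel. norm (h r * gauss (real (Suc k)) r * cos (t * r)) \<le> \<bar>h r\<bar>" for k
    proof (intro AE_I2)
      fix r
      have "\<bar>h r\<bar> * (gauss (real (Suc k)) r * \<bar>cos (t * r)\<bar>) \<le> \<bar>h r\<bar> * 1"
        using gauss_le_1 gauss_pos[of "real (Suc k)" r] by (intro mult_left_mono mult_le_one) auto
      then show "norm (h r * gauss (real (Suc k)) r * cos (t * r)) \<le> \<bar>h r\<bar>"
        using gauss_pos[of "real (Suc k)" r] by (simp add: abs_mult mult.assoc)
    qed
  qed (use int in auto)
  show "\<exists>N. \<forall>k\<ge>N. 0 \<le> (\<integral>r. h r * gauss (real (Suc k)) r * cos (t * r) \<partial>lborel)"
    using h by (auto simp: pos_ft_def)
qed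

section \<open>The Levy-Khintchine representation\<close>

text \<open>The \<open>\<phi>\<close> of the overview. The term \<open>v / 2\<close> makes it even,
  since \<open>log_theta (- v) = log_theta v + v\<close>, and the constant makes it vanish at
  0.\<close>

definition theta_exponent :: "real \<Rightarrow> real" where
  "theta_exponent v = v / 2 + log_theta v - log_theta 0"

lemma theta_exponent_uminus: "theta_exponent (- v) = theta_exponent v"
  by (simp add: theta_exponent_def log_theta_uminus)

lemma theta_exponent_0 [simp]: "theta_exponent 0 = 0"
  by (simp add: theta_exponent_def)

lemma continuous_log_theta: "continuous_on UNIV log_theta"
proof -
  have "continuous_on {1..} (ln :: real \<Rightarrow> real)" by (intro continuous_intros) auto
  moreover have "range (\<lambda>r. theta (exp (2 * r))) \<subseteq> {1..}" using theta_ge_1 by auto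
  ultimately show ?thesis
    unfolding log_theta_def[abs_def] by (rule continuous_on_compose2[OF _ continuous_theta_exp])
qed

lemma continuous_theta_exponent: "continuous_on UNIV theta_exponent"
  unfolding theta_exponent_def[abs_def] by (intro continuous_intros continuous_log_theta) simp

lemma theta_cf_eq: "theta_cf r = exp (- theta_exponent r)"
proof -
  have "theta 1 = exp (log_theta 0)" using exp_log_theta[of 0] by simp
  moreover have "theta (exp (- 2 * r)) = exp (log_theta (- r))" using exp_log_theta[of "- r"] by simp
  ultimately have "theta_cf r = exp (log_theta 0 + r / 2 - log_theta (- r))"
    by (simp add: theta_cf_def exp_add exp_diff)
  then show ?thesis by (simp add: log_theta_uminus theta_exponent_def)
qed

lemma theta_exponent_abs: "theta_exponent v = \<bar>v\<bar> / 2 + log_theta \<bar>v\<bar> - log_theta 0"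
  using theta_exponent_uminus[of v] by (cases "v \<ge> 0") (auto simp: theta_exponent_def)

lemma theta_exponent_ge: "\<bar>v\<bar> / 2 - log_theta 0 \<le> theta_exponent v"
  using log_theta_nonneg[of "\<bar>v\<bar>"] by (simp add: theta_exponent_abs)

text \<open>By evenness \<open>theta_exponent v\<close> is \<open>\<bar>v\<bar> / 2\<close> plus
  this integrable function minus a constant: the part of the exponent that has a cosine
  transform.\<close>

lemma log_theta_abs:
  shows "integrable lborel (\<lambda>v. log_theta \<bar>v\<bar>)"
    and "cos_transform (\<lambda>v. log_theta \<bar>v\<bar>) x = 2 * (LINT r:{0<..}|lborel. log_theta r * cos (x * r))"
    and "\<exists>C. \<forall>v. \<bar>log_theta \<bar>v\<bar>\<bar> \<le> C"
    and "continuous_on UNIV (\<lambda>v. log_theta \<bar>v\<bar>)"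
proof -
  have [measurable]: "(\<lambda>v. log_theta \<bar>v\<bar>) \<in> borel_measurable borel" by measurable
  have "set_integrable lborel {0<..} (\<lambda>r. log_theta r)" using log_theta_half_cos(1)[of 0] by simp
  then have "set_integrable lborel {0<..} (\<lambda>r. log_theta \<bar>r\<bar>)"
    by (rule set_integrable_cong[THEN iffD1, rotated 3]) auto
  then show int: "integrable lborel (\<lambda>v. log_theta \<bar>v\<bar>)"
    by (intro integrable_unfold) auto
  have "cos_transform (\<lambda>v. log_theta \<bar>v\<bar>) x = (LINT r:{0<..}|lborel. log_theta \<bar>r\<bar> * cos (x * r) + log_theta \<bar>- r\<bar> * cos (x * - r))"
    unfolding cos_transform_def by (rule integral_fold(3)[OF integrable_cos_mult[OF int]])
  also have "\<dots> = (LINT r:{0<..}|lborel. 2 * (log_theta r * cos (x * r)))"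
    by (rule set_lebesgue_integral_cong) auto
  finally show "cos_transform (\<lambda>v. log_theta \<bar>v\<bar>) x = 2 * (LINT r:{0<..}|lborel. log_theta r * cos (x * r))" by simp
  obtain C where "\<And>r. r \<ge> 0 \<Longrightarrow> log_theta r \<le> C" using log_theta_bounded by blast
  then show "\<exists>C. \<forall>v. \<bar>log_theta \<bar>v\<bar>\<bar> \<le> C" using log_theta_nonneg by (intro exI[of _ C]) auto
  show "continuous_on UNIV (\<lambda>v. log_theta \<bar>v\<bar>)"
    by (rule continuous_on_compose2[OF continuous_log_theta]) (auto intro!: continuous_intros)
qed

lemma cos_transform_second_difference:
  assumes f: "integrable lborel f"
  shows "integrable lborel (\<lambda>r. f (r + a) + f (r - a) - 2 * f r)"
    and "cos_transform (\<lambda>r. f (r + a) + f (r - a) - 2 * f r) x = 2 * (cos (a * x) - 1) * cos_transform f x"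
proof -
  have i: "integrable lborel (\<lambda>r. f (r + a))" for a by (rule integrable_translate[OF f])
  note i2 = i[of a] i[of "- a", simplified]
  show "integrable lborel (\<lambda>r. f (r + a) + f (r - a) - 2 * f r)" using i2 f by simp
  have t: "(\<integral>r. f (r + a) * cos (x * r) \<partial>lborel) = (\<integral>r. f r * cos (x * (r - a)) \<partial>lborel)" for a
    using integral_translate[of "\<lambda>r. f r * cos (x * (r - a))" a] by simp
  have j: "integrable lborel (\<lambda>r. f r * cos (x * (r - a)))" for a
    using integrable_translate[OF integrable_cos_mult[OF i[of a], of x], of "- a"] by simp
  have c: "f r * cos (x * (r - a)) + f r * cos (x * (r + a)) = 2 * cos (a * x) * (f r * cos (x * r))" for r
  proof -
    have "cos (x * r) * cos (a * x) = (cos (x * (r - a)) + cos (x * (r + a))) / 2"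
      unfolding cos_times_cos by (simp add: algebra_simps)
    then show ?thesis by (simp add: field_simps)
  qed
  have "cos_transform (\<lambda>r. f (r + a) + f (r - a) - 2 * f r) x =
     (\<integral>r. f (r + a) * cos (x * r) \<partial>lborel) + (\<integral>r. f (r - a) * cos (x * r) \<partial>lborel) - 2 * cos_transform f x"
    unfolding cos_transform_def
    using integrable_cos_mult[OF i2(1), of x] integrable_cos_mult[OF i2(2), of x] integrable_cos_mult[OF f, of x]
    by (simp add: left_diff_distrib distrib_right mult.assoc)
  also have "(\<integral>r. f (r + a) * cos (x * r) \<partial>lborel) + (\<integral>r. f (r - a) * cos (x * r) \<partial>lborel) =
     (\<integral>r. f r * cos (x * (r - a)) + f r * cos (x * (r + a)) \<partial>lborel)"
    using t[of a] t[of "- a"] j[of a] j[of "- a"] by simp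
  also have "\<dots> = 2 * cos (a * x) * cos_transform f x"
    unfolding c cos_transform_def by (rule integral_mult_right_zero)
  finally show "cos_transform (\<lambda>r. f (r + a) + f (r - a) - 2 * f r) x = 2 * (cos (a * x) - 1) * cos_transform f x"
    by (simp add: algebra_simps)
qed

text \<open>What the second difference with step \<open>a\<close> makes of
  \<open>\<bar>r\<bar> / 2\<close>, the growing part of \<open>theta_exponent\<close>.\<close>

definition tent :: "real \<Rightarrow> real \<Rightarrow> real" where
  "tent a r = max (a - \<bar>r\<bar>) 0"

lemma tent_second_difference: "a > 0 \<Longrightarrow> tent a r = \<bar>r + a\<bar> / 2 + \<bar>r - a\<bar> / 2 - 2 * (\<bar>r\<bar> / 2)"
  unfolding tent_def by (simp add: abs_if max_def) argo

text \<open>The transform is the Fejer kernel. At \<open>x = 0\<close> the quotient would be 0 by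
  the convention for division, so only the sign of the true value is recorded there.\<close>

lemma tent_cos:
  assumes a: "a > 0"
  shows "integrable lborel (tent a)"
    and "x \<noteq> 0 \<Longrightarrow> cos_transform (tent a) x = 2 * (1 - cos (a * x)) / x\<^sup>2"
    and "0 \<le> cos_transform (tent a) 0"
proof -
  have [measurable]: "tent a \<in> borel_measurable borel" unfolding tent_def[abs_def] by measurable
  have eq: "indicator {0<..} r *\<^sub>R (tent a r * c) = indicator {0<..a} r *\<^sub>R ((a - r) * c)" for r c
    by (auto simp: tent_def indicator_def)
  have "set_integrable lborel {0..a} (\<lambda>r. a - r)"
    by (rule borel_integrable_atLeastAtMost') (auto intro!: continuous_intros)
  then have "set_integrable lborel {0<..a} (\<lambda>r. a - r)" by (rule set_integrable_subset) auto
  then have i: "set_integrable lborel {0<..} (tent a)"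
    using eq[of _ 1] by (simp add: set_integrable_def)
  moreover have te: "tent a (- r) = tent a r" for r by (simp add: tent_def)
  ultimately show int: "integrable lborel (tent a)"
    by (intro integrable_unfold) simp_all
  show "0 \<le> cos_transform (tent a) 0"
    unfolding cos_transform_def by (intro integral_nonneg_AE AE_I2) (simp add: tent_def)
  assume x: "x \<noteq> 0"
  have "cos_transform (tent a) x = (LINT r:{0<..}|lborel. tent a r * cos (x * r) + tent a (- r) * cos (x * - r))"
    unfolding cos_transform_def by (rule integral_fold(3)[OF integrable_cos_mult[OF int]])
  also have "\<dots> = (LINT r:{0<..}|lborel. tent a r * (2 * cos (x * r)))"
    by (rule set_lebesgue_integral_cong) (auto simp: tent_def)
  also have "\<dots> = (LINT r|lborel. indicator {0<..a} r *\<^sub>R ((a - r) * (2 * cos (x * r))))"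
    unfolding set_lebesgue_integral_def eq ..
  also have "\<dots> = (LINT r|lborel. indicator {0..a} r *\<^sub>R ((a - r) * (2 * cos (x * r))))"
    by (rule integral_cong_AE) (use AE_neq_0_lborel in \<open>auto simp: indicator_def\<close>)
  also have "\<dots> = (2 * ((a - a) * sin (x * a) / x - cos (x * a) / x\<^sup>2)) - (2 * ((a - 0) * sin (x * 0) / x - cos (x * 0) / x\<^sup>2))"
  proof (rule integral_FTC_Icc)
    fix r
    show "((\<lambda>r. 2 * ((a - r) * sin (x * r) / x - cos (x * r) / x\<^sup>2)) has_vector_derivative (a - r) * (2 * cos (x * r))) (at r within {0..a})"
      unfolding has_real_derivative_iff_has_vector_derivative[symmetric]
      using x by (auto intro!: derivative_eq_intros simp: field_simps power2_eq_square)
  qed (use a in \<open>auto intro!: continuous_intros\<close>)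
  finally show "cos_transform (tent a) x = 2 * (1 - cos (a * x)) / x\<^sup>2"
    by (simp add: diff_divide_distrib mult.commute right_diff_distrib)
qed

text \<open>At \<open>x = 0\<close> division by zero makes this 0 rather than the limit; a single
  point does not affect the integrals.\<close>

definition levy_kernel :: "real \<Rightarrow> real \<Rightarrow> real" where
  "levy_kernel a x = (1 - cos (a * x)) / x\<^sup>2 * levy_density x"

lemma levy_density_measurable [measurable]: "levy_density \<in> borel_measurable borel"
  by (rule borel_measurable_continuous_onI[OF continuous_levy_density])

lemma levy_kernel_measurable [measurable]: "levy_kernel a \<in> borel_measurable borel"
  unfolding levy_kernel_def[abs_def] by measurable

lemma levy_kernel_nonneg: "0 \<le> levy_kernel a x"
  unfolding levy_kernel_def using levy_density_nonneg[of x] by (intro mult_nonneg_nonneg divide_nonneg_nonneg) auto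

lemma theta_exponent_levy_pos:
  assumes a: "a > 0"
  shows "integrable lborel (levy_kernel a)" "theta_exponent a = (\<integral>x. levy_kernel a x \<partial>lborel)"
proof -
  define E where "E v = log_theta \<bar>v\<bar>" for v
  define D where "D r = theta_exponent (r + a) + theta_exponent (r - a) - 2 * theta_exponent r" for r
  define D' where "D' r = E (r + a) + E (r - a) - 2 * E r" for r
  have D: "D = (\<lambda>r. tent a r + D' r)"
    unfolding D_def D'_def E_def theta_exponent_abs tent_second_difference[OF a] by (simp add: fun_eq_iff)
  have iE: "integrable lborel E" unfolding E_def[abs_def] by (rule log_theta_abs)
  note sd = cos_transform_second_difference[OF iE, of a]
  have iD': "integrable lborel D'" unfolding D'_def[abs_def] by (rule sd)
  have iD: "integrable lborel D" unfolding D using tent_cos(1)[OF a] iD' by simp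
  have tr: "cos_transform D x = cos_transform (tent a) x + 2 * (cos (a * x) - 1) * cos_transform E x" for x
  proof -
    have "cos_transform D x = cos_transform (tent a) x + cos_transform D' x"
      unfolding D cos_transform_def
      using integrable_cos_mult[OF tent_cos(1)[OF a], of x] integrable_cos_mult[OF iD', of x]
      by (simp add: distrib_right)
    then show ?thesis unfolding D'_def[abs_def] sd(2) .
  qed
  have tr1: "cos_transform D x = 4 * pi * levy_kernel a x" if "x \<noteq> 0" for x
  proof -
    have "cos_transform D x = 2 * (1 - cos (a * x)) * (1 / x\<^sup>2 - cos_transform E x)"
      unfolding tr tent_cos(2)[OF a that] by (simp add: algebra_simps diff_divide_distrib)
    \<comment> \<open>The tent contributes \<open>1 / x^2\<close>, which is the summand
      \<open>1 / 2\<close> of \<open>levy_density\<close>; the integrable part contributes the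
      cosine integral.\<close>
    also have "1 / x\<^sup>2 - cos_transform E x = 2 * pi * levy_density x / x\<^sup>2"
      using that unfolding E_def[abs_def] log_theta_abs(2) by (simp add: levy_density_def field_simps)
    finally show ?thesis by (simp add: levy_kernel_def)
  qed
  have nonneg: "0 \<le> cos_transform D x" for x
    using tr1[of x] levy_kernel_nonneg[of a x] tent_cos(3)[OF a] by (cases "x = 0") (simp_all add: tr)
  obtain C where C: "\<And>v. \<bar>E v\<bar> \<le> C" using log_theta_abs(3) unfolding E_def by blast
  have bd: "\<bar>D r\<bar> \<le> a + 4 * C" for r
  proof -
    have "\<bar>tent a r\<bar> \<le> a" using a by (simp add: tent_def)
    then show ?thesis using C[of "r + a"] C[of "r - a"] C[of r] unfolding D D'_def by linarith
  qed
  have cont: "continuous_on UNIV D" unfolding D_def[abs_def]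
    by (intro continuous_intros continuous_on_compose2[OF continuous_theta_exponent]) auto
  have even: "D (- r) = D r" for r
    using theta_exponent_uminus[of "r - a"] theta_exponent_uminus[of "r + a"] theta_exponent_uminus[of r]
    by (simp add: D_def)
  note inv = fourier_inversion_nonneg[OF iD even cont bd nonneg]
  have ae: "AE x in lborel. 1 / (4 * pi) * cos_transform D x = levy_kernel a x"
    using AE_neq_0_lborel by eventually_elim (simp add: tr1)
  have m: "cos_transform D \<in> borel_measurable borel" by (rule cos_transform_measurable) (use iD in auto)
  show "integrable lborel (levy_kernel a)"
    by (rule integrable_cong_AE_imp[OF integrable_mult_right[OF inv(1), of "1 / (4 * pi)"] _ ae]) simp
  \<comment> \<open>The inversion is read at the origin only, where the two outer values agree by
    evenness and the middle one is 0.\<close>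
  have "D 0 = 2 * theta_exponent a" using theta_exponent_uminus[of a] by (simp add: D_def)
  then have "theta_exponent a = 1 / (4 * pi) * (\<integral>t. cos_transform D t * cos (0 * t) \<partial>lborel)"
    unfolding inv(2) by simp
  also have "\<dots> = (\<integral>x. 1 / (4 * pi) * cos_transform D x \<partial>lborel)" by simp
  also have "\<dots> = (\<integral>x. levy_kernel a x \<partial>lborel)"
    by (rule integral_cong_AE) (use ae m in auto)
  finally show "theta_exponent a = (\<integral>x. levy_kernel a x \<partial>lborel)" .
qed

lemma theta_exponent_levy:
  shows "integrable lborel (levy_kernel a)" "theta_exponent a = (\<integral>x. levy_kernel a x \<partial>lborel)"
proof -
  have u: "levy_kernel (- a) = levy_kernel a" by (simp add: levy_kernel_def fun_eq_iff)
  have z: "levy_kernel 0 = (\<lambda>_. 0)" by (simp add: levy_kernel_def fun_eq_iff)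
  consider "a > 0" | "a < 0" | "a = 0" by linarith
  then have "integrable lborel (levy_kernel a) \<and> theta_exponent a = (\<integral>x. levy_kernel a x \<partial>lborel)"
  proof cases
    case 2
    then show ?thesis using theta_exponent_levy_pos[of "- a"] by (simp add: u theta_exponent_uminus)
  qed (use theta_exponent_levy_pos[of a] in \<open>simp_all add: z\<close>)
  then show "integrable lborel (levy_kernel a)" "theta_exponent a = (\<integral>x. levy_kernel a x \<partial>lborel)" by auto
qed

lemma theta_exponent_nonneg: "0 \<le> theta_exponent a"
  unfolding theta_exponent_levy(2) by (intro integral_nonneg_AE AE_I2 levy_kernel_nonneg)

section \<open>Quadratic behaviour at the origin and second moments\<close>

lemma second_difference_bound:
  fixes f :: "real \<Rightarrow> real"
  assumes "\<And>x. (f has_real_derivative f' x) (at x)" "\<And>x. (f' has_real_derivative f'' x) (at x)"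
    and B: "\<And>x. \<bar>x\<bar> \<le> \<bar>v\<bar> \<Longrightarrow> f'' x \<le> B"
  shows "f v + f (- v) - 2 * f 0 \<le> B * v\<^sup>2"
proof -
  have half: "f w \<le> f 0 + f' 0 * w + B / 2 * w\<^sup>2" if w: "\<bar>w\<bar> = \<bar>v\<bar>" for w
  proof (cases "w = 0")
    case False
    define d where "d = (\<lambda>m::nat. if m = 0 then f else if m = 1 then f' else f'')"
    have "\<exists>t. (if w < 0 then w < t \<and> t < 0 else 0 < t \<and> t < w) \<and>
        f w = (\<Sum>m<2. (d m 0 / fact m) * (w - 0) ^ m) + (d 2 t / fact 2) * (w - 0) ^ 2"
    proof (rule Taylor[where a = "- \<bar>w\<bar>" and b = "\<bar>w\<bar>"])
      show "\<forall>m t. m < 2 \<and> - \<bar>w\<bar> \<le> t \<and> t \<le> \<bar>w\<bar> \<longrightarrow> (d m has_real_derivative d (Suc m) t) (at t)"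
        using assms(1,2) by (auto simp: d_def less_2_cases_iff)
    qed (use False in \<open>auto simp: d_def\<close>)
    then obtain t where "if w < 0 then w < t \<and> t < 0 else 0 < t \<and> t < w"
      and e: "f w = (\<Sum>m<2. (d m 0 / fact m) * (w - 0) ^ m) + (d 2 t / fact 2) * (w - 0) ^ 2" by blast
    then have t: "\<bar>t\<bar> \<le> \<bar>w\<bar>" "f w = f 0 + f' 0 * w + f'' t / 2 * w\<^sup>2"
      by (auto simp: d_def numeral_2_eq_2 split: if_splits)
    have "f'' t / 2 * w\<^sup>2 \<le> B / 2 * w\<^sup>2" using B[of t] t(1) w by (intro mult_right_mono divide_right_mono) auto
    then show ?thesis using t(2) by simp
  qed simp
  show ?thesis using half[of v] half[of "- v"] by simp
qed

text \<open>\<open>F v = exp (v / 2) * theta (exp (2 * v))\<close> is even, so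
  \<open>F v - F 0\<close> is half a second difference, which is bounded term by term without
  differentiating the series. Then \<open>\<phi> + 1 \<le> exp \<phi> = F v / F 0\<close> and
  \<open>F 0 \<ge> 1\<close> carry the bound over to the exponent.\<close>

lemma theta_exponent_quadratic: obtains C where "C \<ge> 0" "\<And>v. \<bar>v\<bar> \<le> 1 \<Longrightarrow> theta_exponent v \<le> C * v\<^sup>2"
proof -
  define g where "g b v = exp (v / 2 - b * exp (2 * v))" for b v :: real
  define b where "b n = pi * (real (Suc n))\<^sup>2" for n
  define F where "F v = exp (v / 2 + log_theta v)" for v
  have F: "F v = g 0 v + 2 * (\<Sum>n. g (b n) v)" and sg: "summable (\<lambda>n. g (b n) v)" for v
  proof -
    have e: "g (b n) v = exp (v / 2) * exp (- pi * (real (Suc n))\<^sup>2 * exp (2 * v))" for n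
      by (simp only: g_def b_def exp_add[symmetric]) simp
    have th: "summable (\<lambda>n. exp (- pi * (real (Suc n))\<^sup>2 * exp (2 * v)))" by (rule summable_theta) simp
    show "summable (\<lambda>n. g (b n) v)" unfolding e by (rule summable_mult[OF th])
    have "(\<Sum>n. g (b n) v) = exp (v / 2) * (\<Sum>n. exp (- pi * (real (Suc n))\<^sup>2 * exp (2 * v)))"
      unfolding e by (rule suminf_mult[OF th])
    moreover have "F v = exp (v / 2) * (1 + 2 * (\<Sum>n. exp (- pi * (real (Suc n))\<^sup>2 * exp (2 * v))))"
      unfolding F_def exp_add exp_log_theta theta_eq[OF exp_gt_zero] ..
    ultimately show "F v = g 0 v + 2 * (\<Sum>n. g (b n) v)"
      by (simp add: g_def distrib_left)
  qed
  \<comment> \<open>With \<open>y = b n * exp (2 * x)\<close> the second derivative is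
    \<open>(1/4 - 6 * y + 4 * y^2) * g\<close>, and 32 makes the quadratic Taylor term of
    \<open>32 * exp (y / 2)\<close> equal to \<open>4 * y^2\<close>. The remaining
    \<open>exp (- y / 2)\<close>, with \<open>y \<ge> b n * exp (-2)\<close>, is summable over
    \<open>n\<close>.\<close>
  define B where "B n = 32 * exp (1 / 2 - b n * exp (-2) / 2)" for n
  have Bn: "g (b n) v + g (b n) (- v) - 2 * g (b n) 0 \<le> B n * v\<^sup>2" if v: "\<bar>v\<bar> \<le> 1" for n v
  proof (rule second_difference_bound)
    define \<beta> where "\<beta> = b n"
    show "(g (b n) has_real_derivative (1 / 2 - 2 * \<beta> * exp (2 * x)) * g \<beta> x) (at x)" for x
      unfolding g_def \<beta>_def by (auto intro!: derivative_eq_intros)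
    show "((\<lambda>x. (1 / 2 - 2 * \<beta> * exp (2 * x)) * g \<beta> x) has_real_derivative
        ((1 / 2 - 2 * \<beta> * exp (2 * x))\<^sup>2 - 4 * \<beta> * exp (2 * x)) * g \<beta> x) (at x)" for x
      unfolding g_def by (auto intro!: derivative_eq_intros simp: power2_eq_square field_simps)
    fix x :: real assume x: "\<bar>x\<bar> \<le> \<bar>v\<bar>"
    define y where "y = \<beta> * exp (2 * x)"
    have y0: "y \<ge> 0" by (simp add: y_def \<beta>_def b_def)
    have "(1 / 2 - 2 * \<beta> * exp (2 * x))\<^sup>2 - 4 * \<beta> * exp (2 * x) = 1 / 4 - 6 * y + 4 * y\<^sup>2"
      by (simp add: y_def power2_eq_square algebra_simps)
    also have "\<dots> \<le> 32 * exp (y / 2)"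
      using exp_lower_Taylor_quadratic[of "y / 2"] y0 by (simp add: power2_eq_square)
    finally have 1: "(1 / 2 - 2 * \<beta> * exp (2 * x))\<^sup>2 - 4 * \<beta> * exp (2 * x) \<le> 32 * exp (y / 2)" .
    have "\<beta> * exp (-2) \<le> y" unfolding y_def using x v by (intro mult_left_mono) (auto simp: \<beta>_def b_def)
    then have 2: "y / 2 + (x / 2 - y) \<le> 1 / 2 - b n * exp (-2) / 2" using x v by (simp add: \<beta>_def)
    have "((1 / 2 - 2 * \<beta> * exp (2 * x))\<^sup>2 - 4 * \<beta> * exp (2 * x)) * g \<beta> x \<le> 32 * exp (y / 2) * g \<beta> x"
      using 1 by (rule mult_right_mono) (simp add: g_def)
    also have "\<dots> = 32 * exp (y / 2 + (x / 2 - y))"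
    proof -
      have "g \<beta> x = exp (x / 2 - y)" by (simp add: g_def y_def)
      then show ?thesis by (simp only: mult.assoc exp_add)
    qed
    also have "\<dots> \<le> B n" unfolding B_def using 2 by simp
    finally show "((1 / 2 - 2 * \<beta> * exp (2 * x))\<^sup>2 - 4 * \<beta> * exp (2 * x)) * g \<beta> x \<le> B n" .
  qed
  have B0: "g 0 v + g 0 (- v) - 2 * g 0 0 \<le> exp (1 / 2) * v\<^sup>2" if v: "\<bar>v\<bar> \<le> 1" for v
  proof (rule second_difference_bound)
    show "(g 0 has_real_derivative exp (x / 2) / 2) (at x)" for x
      unfolding g_def by (auto intro!: derivative_eq_intros)
    show "((\<lambda>x. exp (x / 2) / 2) has_real_derivative exp (x / 2) / 4) (at x)" for x
      by (auto intro!: derivative_eq_intros)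
    fix x :: real assume "\<bar>x\<bar> \<le> \<bar>v\<bar>"
    then have "exp (x / 2) \<le> exp (1 / 2)" using v by simp
    then show "exp (x / 2) / 4 \<le> exp (1 / 2)" using exp_gt_zero[of "x / 2"] by linarith
  qed
  have sB: "summable B"
  proof -
    have "summable (\<lambda>n. 32 * exp (1 / 2) * exp (- (pi * exp (-2) / 2) * (real (Suc n))\<^sup>2))"
      by (intro summable_mult summable_gaussian_Suc) simp
    moreover have "32 * exp (1 / 2) * exp (- (pi * exp (-2) / 2) * (real (Suc n))\<^sup>2) = B n" for n
      by (simp only: B_def b_def mult.assoc exp_add[symmetric]) (simp add: mult_ac)
    ultimately show ?thesis by (simp only:)
  qed
  define C where "C = (exp (1 / 2) + 2 * suminf B) / 2"
  have F2: "F v - F 0 \<le> C * v\<^sup>2" if v: "\<bar>v\<bar> \<le> 1" for v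
  proof -
    have ev: "F (- v) = F v" by (simp add: F_def log_theta_uminus)
    have "(\<Sum>n. g (b n) v) + (\<Sum>n. g (b n) (- v)) - 2 * (\<Sum>n. g (b n) 0) = (\<Sum>n. g (b n) v + g (b n) (- v) - 2 * g (b n) 0)"
      by (rule sums_unique, intro sums_diff sums_add sums_mult summable_sums sg)
    also have "\<dots> \<le> (\<Sum>n. B n * v\<^sup>2)"
      using Bn[OF v] sg sB by (intro suminf_le summable_diff summable_add summable_mult summable_mult2)
    also have "\<dots> = suminf B * v\<^sup>2" using suminf_mult2[OF sB, of "v\<^sup>2"] by simp
    finally have s: "(\<Sum>n. g (b n) v) + (\<Sum>n. g (b n) (- v)) - 2 * (\<Sum>n. g (b n) 0) \<le> suminf B * v\<^sup>2" .
    have "2 * (F v - F 0) = F v + F (- v) - 2 * F 0" unfolding ev by simp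
    also have "\<dots> = (g 0 v + g 0 (- v) - 2 * g 0 0) + 2 * ((\<Sum>n. g (b n) v) + (\<Sum>n. g (b n) (- v)) - 2 * (\<Sum>n. g (b n) 0))"
      unfolding F by simp
    also have "\<dots> \<le> exp (1 / 2) * v\<^sup>2 + 2 * (suminf B * v\<^sup>2)" using s B0[OF v] by simp
    finally show ?thesis by (simp add: C_def field_simps)
  qed
  have C: "C \<ge> 0" unfolding C_def using sB by (intro divide_nonneg_nonneg add_nonneg_nonneg mult_nonneg_nonneg suminf_nonneg) (auto simp: B_def)
  have F0: "F 0 \<ge> 1" using log_theta_nonneg[of 0] by (simp add: F_def)
  show ?thesis
  proof
    show "C \<ge> 0" by (rule C)
    fix v :: real assume v: "\<bar>v\<bar> \<le> 1"
    have "theta_exponent v + 1 \<le> exp (theta_exponent v)" using exp_ge_add_one_self[of "theta_exponent v"] by linarith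
    also have "exp (theta_exponent v) = F v / F 0" by (simp add: F_def theta_exponent_def exp_diff exp_add)
    finally have "theta_exponent v \<le> (F v - F 0) / F 0" using F0 by (simp add: field_simps)
    also have "\<dots> \<le> C * v\<^sup>2 / F 0" using F2[OF v] F0 by (intro divide_right_mono) auto
    also have "\<dots> \<le> C * v\<^sup>2 / 1" using F0 C by (intro divide_left_mono mult_nonneg_nonneg) auto
    finally show "theta_exponent v \<le> C * v\<^sup>2" by simp
  qed
qed

lemma one_minus_cos_limit: "(\<lambda>k. 2 * (real (Suc k))\<^sup>2 * (1 - cos (1 / real (Suc k) * x))) \<longlonglongrightarrow> (x::real)\<^sup>2"
proof -
  have "1 - cos y = 2 * (sin (y / 2))\<^sup>2" for y :: real
    using cos_double_sin[of "y / 2"] by simp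
  then have e: "2 * (real (Suc k))\<^sup>2 * (1 - cos (1 / real (Suc k) * x)) = (2 * (real (Suc k) * sin (x / 2 * (1 / real (Suc k)))))\<^sup>2" for k
    by (simp add: power_mult_distrib mult_ac)
  have "(\<lambda>k. real (Suc k) * sin (x / 2 * (1 / real (Suc k)))) \<longlonglongrightarrow> x / 2"
  proof -
    have "(\<lambda>n. real n * sin (x / 2 * (1 / real n))) \<longlonglongrightarrow> x / 2" by real_asymp
    then show ?thesis by (rule LIMSEQ_Suc)
  qed
  then have "(\<lambda>k. (2 * (real (Suc k) * sin (x / 2 * (1 / real (Suc k)))))\<^sup>2) \<longlonglongrightarrow> (2 * (x / 2))\<^sup>2"
    by (intro tendsto_intros)
  then show ?thesis unfolding e by simp
qed

text \<open>Fatou along \<open>a = 1 / k\<close>, where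
  \<open>2 * k^2 * (1 - cos (x / k)) \<rightarrow> x^2\<close>. Applied to the measure with density
  \<open>levy_density x / x^2\<close> it gives integrability of \<open>levy_density\<close>, applied
  to \<open>theta_distribution 1\<close> the second moment.\<close>

lemma second_moment_fatou:
  assumes [measurable_cong]: "sets N = sets borel"
    and C: "\<And>a::real. 0 < a \<Longrightarrow> a \<le> 1 \<Longrightarrow> (\<integral>\<^sup>+x. ennreal (1 - cos (a * x)) \<partial>N) \<le> ennreal (C * a\<^sup>2)"
  shows "(\<integral>\<^sup>+x. ennreal (x\<^sup>2) \<partial>N) \<le> ennreal (2 * C)"
proof -
  let ?f = "\<lambda>k x. 2 * (real (Suc k))\<^sup>2 * (1 - cos (1 / real (Suc k) * x))"
  have "(\<integral>\<^sup>+x. ennreal (x\<^sup>2) \<partial>N) = (\<integral>\<^sup>+x. liminf (\<lambda>k. ennreal (?f k x)) \<partial>N)"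
  proof (rule nn_integral_cong)
    fix x
    have "(\<lambda>k. ennreal (?f k x)) \<longlonglongrightarrow> ennreal (x\<^sup>2)" by (intro tendsto_ennrealI one_minus_cos_limit)
    from lim_imp_Liminf[OF trivial_limit_sequentially this]
    show "ennreal (x\<^sup>2) = liminf (\<lambda>k. ennreal (?f k x))" by (rule sym)
  qed
  also have "\<dots> \<le> liminf (\<lambda>k. \<integral>\<^sup>+x. ennreal (?f k x) \<partial>N)" by (rule nn_integral_liminf) measurable
  also have "\<dots> \<le> liminf (\<lambda>k. ennreal (2 * C))"
  proof (intro Liminf_mono always_eventually allI)
    fix k
    have "(\<integral>\<^sup>+x. ennreal (?f k x) \<partial>N) = ennreal (2 * (real (Suc k))\<^sup>2) * (\<integral>\<^sup>+x. ennreal (1 - cos (1 / real (Suc k) * x)) \<partial>N)"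
      by (subst nn_integral_cmult[symmetric]) (auto simp: ennreal_mult intro!: nn_integral_cong)
    also have "\<dots> \<le> ennreal (2 * (real (Suc k))\<^sup>2) * ennreal (C * (1 / real (Suc k))\<^sup>2)"
      by (intro mult_left_mono C) auto
    also have "\<dots> = ennreal (2 * (real (Suc k))\<^sup>2 * (C * (1 / real (Suc k))\<^sup>2))"
      by (rule ennreal_mult'[symmetric]) simp
    also have "2 * (real (Suc k))\<^sup>2 * (C * (1 / real (Suc k))\<^sup>2) = 2 * C" by (simp add: power_divide)
    finally show "(\<integral>\<^sup>+x. ennreal (?f k x) \<partial>N) \<le> ennreal (2 * C)" .
  qed
  finally show ?thesis by (simp only: Liminf_const[OF trivial_limit_sequentially])
qed

text \<open>For the measure with density \<open>levy_density x / x^2\<close> the integral of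
  \<open>1 - cos (a * x)\<close> is \<open>theta_exponent a\<close>, which is quadratically small;
  its second moment is the integral in question.\<close>

lemma levy_density_integrable: "integrable lborel levy_density"
proof -
  obtain C where C: "C \<ge> 0" "\<And>v. \<bar>v\<bar> \<le> 1 \<Longrightarrow> theta_exponent v \<le> C * v\<^sup>2" using theta_exponent_quadratic by blast
  define N where "N = density lborel (\<lambda>x. ennreal (levy_density x / x\<^sup>2))"
  have "(\<integral>\<^sup>+x. ennreal (x\<^sup>2) \<partial>N) \<le> ennreal (2 * C)"
  proof (rule second_moment_fatou)
    show "sets N = sets borel" by (simp add: N_def)
    fix a :: real assume a: "0 < a" "a \<le> 1"
    have "(\<integral>\<^sup>+x. ennreal (1 - cos (a * x)) \<partial>N) = (\<integral>\<^sup>+x. ennreal (levy_kernel a x) \<partial>lborel)"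
      unfolding N_def by (subst nn_integral_density)
        (auto simp: levy_kernel_def levy_density_nonneg ennreal_mult[symmetric] mult.commute intro!: nn_integral_cong)
    also have "\<dots> = ennreal (theta_exponent a)"
      unfolding theta_exponent_levy(2) by (rule nn_integral_eq_integral[OF theta_exponent_levy(1)]) (simp add: levy_kernel_nonneg)
    also have "\<dots> \<le> ennreal (C * a\<^sup>2)" using C(2)[of a] a by (intro ennreal_leI) auto
    finally show "(\<integral>\<^sup>+x. ennreal (1 - cos (a * x)) \<partial>N) \<le> ennreal (C * a\<^sup>2)" .
  qed
  moreover have "(\<integral>\<^sup>+x. ennreal (x\<^sup>2) \<partial>N) = (\<integral>\<^sup>+x. ennreal (levy_density x) \<partial>lborel)"
  proof -
    have "(\<integral>\<^sup>+x. ennreal (x\<^sup>2) \<partial>N) = (\<integral>\<^sup>+x. ennreal (levy_density x / x\<^sup>2) * ennreal (x\<^sup>2) \<partial>lborel)"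
      unfolding N_def by (subst nn_integral_density) auto
    also have "\<dots> = (\<integral>\<^sup>+x. ennreal (levy_density x) \<partial>lborel)"
      by (rule nn_integral_cong_AE) (use AE_neq_0_lborel in eventually_elim, simp add: levy_density_nonneg ennreal_mult[symmetric])
    finally show ?thesis .
  qed
  ultimately have "(\<integral>\<^sup>+x. ennreal (norm (levy_density x)) \<partial>lborel) < \<infinity>"
    by (simp add: levy_density_nonneg) (metis ennreal_less_top order_le_less_trans)
  then show ?thesis by (intro integrableI_bounded) auto
qed

text \<open>\<open>levy_density x / x^2\<close> is not integrable at 0, where
  \<open>levy_density\<close> has the value \<open>1 / (2 * pi)\<close>. Jumps of size at most
  \<open>1 / (m + 1)\<close> are therefore cut off, which leaves compound Poisson laws, and
  dominated convergence restores them.\<close>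

lemma pos_ft_exp_theta_exponent:
  assumes u: "u > 0"
  shows "pos_ft (\<lambda>r. exp (- u * theta_exponent r))"
proof (rule pos_ft_limit)
  define k where "k m x = indicator {x. 1 / real (Suc m) < \<bar>x\<bar>} x * (u * levy_density x / x\<^sup>2)" for m and x :: real
  have [measurable]: "k m \<in> borel_measurable borel" for m unfolding k_def[abs_def] by measurable
  have k0: "0 \<le> k m x" for m x using u levy_density_nonneg[of x] by (simp add: k_def)
  have ik: "integrable lborel (k m)" for m
  proof (rule Bochner_Integration.integrable_bound[OF integrable_mult_right[OF levy_density_integrable, of "u * (real (Suc m))\<^sup>2"]])
    show "AE x in lborel. norm (k m x) \<le> norm (u * (real (Suc m))\<^sup>2 * levy_density x)"
    proof (intro AE_I2)
      fix x
      show "norm (k m x) \<le> norm (u * (real (Suc m))\<^sup>2 * levy_density x)"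
      proof (cases "1 / real (Suc m) < \<bar>x\<bar>")
        case True
        have "(1 / real (Suc m))\<^sup>2 \<le> \<bar>x\<bar>\<^sup>2" using True by (intro power_mono) auto
        moreover have "x \<noteq> 0" using True by auto
        ultimately have "1 / x\<^sup>2 \<le> (real (Suc m))\<^sup>2" by (simp add: power_divide field_simps)
        then have "u * levy_density x * (1 / x\<^sup>2) \<le> u * levy_density x * (real (Suc m))\<^sup>2"
          using u levy_density_nonneg[of x] by (intro mult_left_mono) auto
        then show ?thesis using True u levy_density_nonneg[of x] by (simp add: k_def abs_mult mult_ac)
      qed (simp add: k_def)
    qed
  qed auto
  have e: "exp (- (\<integral>x. k m x * (1 - cos (r * x)) \<partial>lborel)) = exp (- (\<integral>x. k m x \<partial>lborel)) * exp (cos_transform (k m) r)" for m r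
    using ik[of m] integrable_cos_mult[OF ik[of m], of r]
    by (simp add: cos_transform_def right_diff_distrib exp_add[symmetric])
  show "pos_ft (\<lambda>r. exp (- (\<integral>x. k m x * (1 - cos (r * x)) \<partial>lborel)))" for m
    unfolding e by (intro pos_ft_cmult pos_ft_exp_cos_transform ik k0) simp
  show "\<bar>exp (- (\<integral>x. k m x * (1 - cos (r * x)) \<partial>lborel))\<bar> \<le> 1" for m r
    using k0 by (simp add: integral_nonneg_AE)
  fix r
  have "(\<lambda>m. \<integral>x. k m x * (1 - cos (r * x)) \<partial>lborel) \<longlonglongrightarrow> (\<integral>x. u * levy_kernel r x \<partial>lborel)"
  proof (rule integral_dominated_convergence[where w = "\<lambda>x. u * levy_kernel r x"])
    show "integrable lborel (\<lambda>x. u * levy_kernel r x)" using theta_exponent_levy(1) by simp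
    have kk: "k m x * (1 - cos (r * x)) = indicator {x. 1 / real (Suc m) < \<bar>x\<bar>} x * (u * levy_kernel r x)" for m x
      by (simp add: k_def levy_kernel_def)
    show "AE x in lborel. (\<lambda>m. k m x * (1 - cos (r * x))) \<longlonglongrightarrow> u * levy_kernel r x"
      using AE_neq_0_lborel
    proof eventually_elim
      case (elim x)
      have "\<forall>\<^sub>F m in sequentially. 1 / real (Suc m) < \<bar>x\<bar>"
        using order_tendstoD(2)[OF LIMSEQ_Suc[OF lim_1_over_n], of "\<bar>x\<bar>"] elim by simp
      then have "\<forall>\<^sub>F m in sequentially. u * levy_kernel r x = k m x * (1 - cos (r * x))"
        by eventually_elim (simp add: kk)
      then show ?case by (rule Lim_transform_eventually[OF tendsto_const])
    qed
    show "AE x in lborel. norm (k m x * (1 - cos (r * x))) \<le> u * levy_kernel r x" for m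
      unfolding kk using u levy_kernel_nonneg[of r] by (intro AE_I2) (simp add: indicator_def)
  qed measurable
  then have "(\<lambda>m. exp (- (\<integral>x. k m x * (1 - cos (r * x)) \<partial>lborel))) \<longlonglongrightarrow> exp (- (\<integral>x. u * levy_kernel r x \<partial>lborel))"
    by (intro tendsto_intros)
  then show "(\<lambda>m. exp (- (\<integral>x. k m x * (1 - cos (r * x)) \<partial>lborel))) \<longlonglongrightarrow> exp (- u * theta_exponent r)"
    by (simp add: theta_exponent_levy(2))
qed

section \<open>The infinitely divisible law\<close>

lemma continuous_AE_zero:
  fixes f :: "real \<Rightarrow> real"
  assumes c: "continuous_on UNIV f" and ae: "AE x in lborel. f x = 0"
  shows "f x = 0"
proof (rule ccontr)
  assume "f x \<noteq> 0"
  have o: "open {x. f x \<noteq> 0}"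
    using open_Collect_neq[OF c continuous_on_const] by simp
  then have "{x. f x \<noteq> 0} \<in> sets lborel" by simp
  from AE_iff_null_sets[OF this] ae have "{x. f x \<noteq> 0} \<in> null_sets lborel" by simp
  then have "negligible {x. f x \<noteq> 0}"
    by (simp add: negligible_iff_null_sets null_sets_completionI)
  with o have "{x. f x \<noteq> 0} = {}" using open_not_negligible by blast
  then show False using \<open>f x \<noteq> 0\<close> by blast
qed

definition theta_cf_powr :: "real \<Rightarrow> real \<Rightarrow> real" where
  "theta_cf_powr u r = exp (- u * theta_exponent r)"

lemma theta_cf_powr_eq: "theta_cf r powr u = theta_cf_powr u r"
  by (simp add: theta_cf_eq powr_def theta_cf_powr_def)

lemma theta_cf_powr_even: "theta_cf_powr u (- r) = theta_cf_powr u r"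
  by (simp add: theta_cf_powr_def theta_exponent_uminus)

lemma continuous_theta_cf_powr: "continuous_on UNIV (theta_cf_powr u)"
  unfolding theta_cf_powr_def[abs_def] by (intro continuous_intros continuous_theta_exponent)

lemma theta_cf_powr_measurable [measurable]: "theta_cf_powr u \<in> borel_measurable borel"
  by (rule borel_measurable_continuous_onI[OF continuous_theta_cf_powr])

lemma theta_cf_powr_pos: "0 < theta_cf_powr u r"
  by (simp add: theta_cf_powr_def)

lemma theta_cf_powr_0 [simp]: "theta_cf_powr u 0 = 1"
  by (simp add: theta_cf_powr_def)

lemma theta_cf_powr_exp_bound:
  assumes "u > 0"
  shows "theta_cf_powr u r \<le> exp (u * log_theta 0) * exp (- (u / 2) * \<bar>r\<bar>)"
proof -
  have "u * (\<bar>r\<bar> / 2 - log_theta 0) \<le> u * theta_exponent r"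
    using assms theta_exponent_ge by (intro mult_left_mono) auto
  then show ?thesis unfolding theta_cf_powr_def exp_add[symmetric] by (simp add: algebra_simps)
qed

definition theta_ft :: "real \<Rightarrow> real \<Rightarrow> real" where
  "theta_ft u = cos_transform (theta_cf_powr u)"

definition theta_distribution :: "real \<Rightarrow> real measure" where
  "theta_distribution u = density lborel (\<lambda>x. ennreal (theta_ft u x / (2 * pi)))"

context
  fixes u :: real
  assumes u: "u > 0"
begin

lemma theta_cf_powr_abs_le_1: "\<bar>theta_cf_powr u r\<bar> \<le> 1"
  using u theta_exponent_nonneg[of r] by (simp add: theta_cf_powr_def)

text \<open>The decay rate \<open>u / 2\<close> of \<open>f^u\<close> is the width available for the
  analytic continuation of its transform.\<close>

lemma theta_cf_powr_exp_moment:
  assumes "c < u / 2"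
  shows "integrable lborel (\<lambda>r. theta_cf_powr u r * exp (c * \<bar>r\<bar>))"
proof -
  have "set_integrable lborel {0<..} (\<lambda>r. theta_cf_powr u r * exp (c * \<bar>r\<bar>))"
  proof (rule set_integrable_exp_bound)
    show "u / 2 - c > 0" using assms by simp
    fix r :: real assume "r > 0"
    have "theta_cf_powr u r * exp (c * \<bar>r\<bar>) \<le> (exp (u * log_theta 0) * exp (- (u / 2) * \<bar>r\<bar>)) * exp (c * \<bar>r\<bar>)"
      by (intro mult_right_mono theta_cf_powr_exp_bound u) simp
    also have "\<dots> = exp (u * log_theta 0) * exp (- (u / 2 - c) * r)"
      using \<open>r > 0\<close> by (simp add: exp_add[symmetric] mult.assoc) (simp add: algebra_simps)
    finally show "norm (theta_cf_powr u r * exp (c * \<bar>r\<bar>)) \<le> exp (u * log_theta 0) * exp (- (u / 2 - c) * r)"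
      using theta_cf_powr_pos[of u r] by (simp add: abs_mult)
  qed measurable
  then show ?thesis by (intro integrable_unfold) (simp_all add: theta_cf_powr_even)
qed

lemma theta_cf_powr_integrable: "integrable lborel (theta_cf_powr u)"
  using theta_cf_powr_exp_moment[of 0] u by simp

lemma theta_ft_nonneg: "0 \<le> theta_ft u t"
  unfolding theta_ft_def
  by (rule pos_ft_cos_transform_nonneg[OF _ theta_cf_powr_integrable])
    (use pos_ft_exp_theta_exponent[OF u] in \<open>simp add: theta_cf_powr_def[abs_def]\<close>)

lemma theta_ft_inversion:
  shows "integrable lborel (theta_ft u)" "(\<integral>t. theta_ft u t * cos (s * t) \<partial>lborel) = 2 * pi * theta_cf_powr u s"
  using fourier_inversion_nonneg[OF theta_cf_powr_integrable theta_cf_powr_even continuous_theta_cf_powr theta_cf_powr_abs_le_1]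
    theta_ft_nonneg unfolding theta_ft_def by auto

lemma theta_ft_uminus: "theta_ft u (- t) = theta_ft u t"
  unfolding theta_ft_def by (rule cos_transform_uminus)

lemma theta_ft_continuous: "continuous_on UNIV (theta_ft u)"
  unfolding theta_ft_def by (rule cos_transform_continuous[OF theta_cf_powr_integrable])

lemma theta_ft_measurable [measurable]: "(theta_ft u) \<in> borel_measurable borel"
  by (rule borel_measurable_continuous_onI[OF theta_ft_continuous])

lemma theta_ft_complex:
  shows "integrable lborel (\<lambda>r. of_real (theta_cf_powr u r) * exp (- \<i> * of_real (r * t)))"
    and "(LINT r|lborel. of_real (theta_cf_powr u r) * exp (- \<i> * of_real (r * t))) = of_real (theta_ft u t)"
proof -
  show i: "integrable lborel (\<lambda>r. of_real (theta_cf_powr u r) * exp (- \<i> * of_real (r * t)))"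
  proof (rule Bochner_Integration.integrable_bound[OF theta_cf_powr_integrable])
    show "AE r in lborel. norm (of_real (theta_cf_powr u r) * exp (- \<i> * of_real (r * t))) \<le> norm (theta_cf_powr u r)"
      by (intro AE_I2) (simp add: norm_mult)
  qed measurable
  have "Re (LINT r|lborel. of_real (theta_cf_powr u r) * exp (- \<i> * of_real (r * t))) = theta_ft u t"
    unfolding integral_Re[OF i, symmetric] theta_ft_def cos_transform_def
    by (intro Bochner_Integration.integral_cong refl) (simp add: Re_exp mult.commute)
  moreover have "Im (LINT r|lborel. of_real (theta_cf_powr u r) * exp (- \<i> * of_real (r * t))) = 0"
  proof -
    have "Im (LINT r|lborel. of_real (theta_cf_powr u r) * exp (- \<i> * of_real (r * t))) = (LINT r|lborel. - (theta_cf_powr u r * sin (r * t)))"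
      unfolding integral_Im[OF i, symmetric]
      by (intro Bochner_Integration.integral_cong refl) (simp add: Im_exp)
    moreover have "(LINT r|lborel. - (theta_cf_powr u r * sin (r * t))) = (LINT r|lborel. - (theta_cf_powr u (- r) * sin (- r * t)))"
      by (rule integral_reflect_lborel[symmetric])
    ultimately show ?thesis by (simp add: theta_cf_powr_even)
  qed
  ultimately show "(LINT r|lborel. of_real (theta_cf_powr u r) * exp (- \<i> * of_real (r * t))) = of_real (theta_ft u t)"
    by (simp add: complex_eq_iff)
qed

lemma theta_distribution_sets [measurable_cong, simp]: "sets (theta_distribution u) = sets borel"
  by (simp add: theta_distribution_def)

lemma real_distribution_theta: "real_distribution (theta_distribution u)"
proof -
  have "prob_space (theta_distribution u)"
  proof (rule prob_spaceI)
    have "emeasure (theta_distribution u) (space (theta_distribution u)) = (\<integral>\<^sup>+x. ennreal (theta_ft u x / (2 * pi)) \<partial>lborel)"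
      by (simp add: theta_distribution_def emeasure_density)
    also have "\<dots> = ennreal (\<integral>x. theta_ft u x / (2 * pi) \<partial>lborel)"
      using theta_ft_inversion(1) theta_ft_nonneg by (intro nn_integral_eq_integral) auto
    also have "(\<integral>x. theta_ft u x / (2 * pi) \<partial>lborel) = 1" using theta_ft_inversion(2)[of 0] by simp
    finally show "emeasure (theta_distribution u) (space (theta_distribution u)) = 1" by simp
  qed
  then interpret prob_space "theta_distribution u" .
  show ?thesis by unfold_locales simp
qed

lemma char_theta_distribution: "char (theta_distribution u) t = of_real (theta_cf_powr u t)"
proof -
  have c: "char (theta_distribution u) t = (LINT x|lborel. (theta_ft u x / (2 * pi)) *\<^sub>R exp (\<i> * of_real (t * x)))"
    unfolding char_def theta_distribution_def
    by (rule integral_density) (use theta_ft_nonneg in auto)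
  have i: "integrable lborel (\<lambda>x. (theta_ft u x / (2 * pi)) *\<^sub>R exp (\<i> * of_real (t * x)))"
  proof (rule Bochner_Integration.integrable_bound)
    show "integrable lborel (\<lambda>x. theta_ft u x / (2 * pi))" using theta_ft_inversion(1) by simp
    show "AE x in lborel. norm ((theta_ft u x / (2 * pi)) *\<^sub>R exp (\<i> * of_real (t * x))) \<le> norm (theta_ft u x / (2 * pi))"
      by (intro AE_I2) simp
  qed measurable
  have "Re (char (theta_distribution u) t) = (LINT x|lborel. 1 / (2 * pi) * (theta_ft u x * cos (t * x)))"
    unfolding c integral_Re[OF i, symmetric]
    by (intro Bochner_Integration.integral_cong refl) (simp add: Re_exp)
  also have "\<dots> = 1 / (2 * pi) * (2 * pi * theta_cf_powr u t)"
    unfolding integral_mult_right_zero theta_ft_inversion(2) ..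
  also have "\<dots> = theta_cf_powr u t" by simp
  finally have re: "Re (char (theta_distribution u) t) = theta_cf_powr u t" .
  have "Im (char (theta_distribution u) t) = (LINT x|lborel. theta_ft u x / (2 * pi) * sin (t * x))"
    unfolding c integral_Im[OF i, symmetric]
    by (intro Bochner_Integration.integral_cong refl) (simp add: Im_exp)
  moreover have "(LINT x|lborel. theta_ft u x / (2 * pi) * sin (t * x)) = (LINT x|lborel. theta_ft u (- x) / (2 * pi) * sin (t * - x))"
    by (rule integral_reflect_lborel[symmetric])
  ultimately have "Im (char (theta_distribution u) t) = 0" by (simp add: theta_ft_uminus)
  with re show ?thesis by (simp add: complex_eq_iff)
qed

lemma theta_ft_0_pos: "0 < theta_ft u 0"
proof -
  have "0 \<le> (\<integral>r. theta_cf_powr u r \<partial>lborel)" by (intro integral_nonneg_AE AE_I2) (simp add: theta_cf_powr_pos less_imp_le)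
  moreover have "(\<integral>r. theta_cf_powr u r \<partial>lborel) \<noteq> 0"
  proof
    assume "(\<integral>r. theta_cf_powr u r \<partial>lborel) = 0"
    then have "AE r in lborel. theta_cf_powr u r = 0"
      using integral_nonneg_eq_0_iff_AE[OF theta_cf_powr_integrable] theta_cf_powr_pos by (simp add: less_imp_le)
    from continuous_AE_zero[OF continuous_theta_cf_powr this, of 0] show False by simp
  qed
  ultimately show ?thesis by (simp add: theta_ft_def cos_transform_def)
qed

text \<open>Exponential moments below \<open>u / 2\<close> make the transform analytic in a strip;
  half-width \<open>u / 4\<close> plus slack \<open>u / 8\<close> stays below that bound.\<close>

lemma theta_ft_holomorphic:
  obtains G where "G holomorphic_on {z. \<bar>Im z\<bar> < u / 4}" "\<And>t. G (of_real t) = of_real (theta_ft u t)"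
proof -
  define H where "H s = (LINT r|lborel. of_real (theta_cf_powr u r) * exp (s * of_real r))" for s :: complex
  have D: "\<exists>D. (H has_field_derivative D) (at s)" "integrable lborel (\<lambda>r. of_real (theta_cf_powr u r) * exp (s * of_real r))"
    if s: "\<bar>Re s\<bar> < u / 4" for s
  proof -
    have "integrable lborel (\<lambda>r. \<bar>theta_cf_powr u r\<bar> * exp (Re s * r + u / 8 * \<bar>r\<bar>))"
    proof (rule Bochner_Integration.integrable_bound[OF theta_cf_powr_exp_moment[of "3 * u / 8"]])
      show "AE r in lborel. norm (\<bar>theta_cf_powr u r\<bar> * exp (Re s * r + u / 8 * \<bar>r\<bar>)) \<le> norm (theta_cf_powr u r * exp (3 * u / 8 * \<bar>r\<bar>))"
      proof (intro AE_I2)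
        fix r
        have "Re s * r \<le> \<bar>Re s\<bar> * \<bar>r\<bar>" by (simp add: abs_mult[symmetric])
        also have "\<dots> \<le> u / 4 * \<bar>r\<bar>" using s by (intro mult_right_mono) auto
        finally have "Re s * r + u / 8 * \<bar>r\<bar> \<le> 3 * u / 8 * \<bar>r\<bar>" by (simp add: algebra_simps)
        then show "norm (\<bar>theta_cf_powr u r\<bar> * exp (Re s * r + u / 8 * \<bar>r\<bar>)) \<le> norm (theta_cf_powr u r * exp (3 * u / 8 * \<bar>r\<bar>))"
          by (simp add: abs_mult mult_left_mono)
      qed
    qed (use u in auto)
    from laplace_has_field_derivative[OF _ _ _ this] u
    show "\<exists>D. (H has_field_derivative D) (at s)" "integrable lborel (\<lambda>r. of_real (theta_cf_powr u r) * exp (s * of_real r))"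
      unfolding H_def[abs_def] by auto
  qed
  have Hhol: "H holomorphic_on {s. \<bar>Re s\<bar> < u / 4}"
    using D(1) by (auto simp: holomorphic_on_def field_differentiable_def intro: has_field_derivative_at_within)
  have "(\<lambda>z. H (- (\<i> * z))) holomorphic_on {z. \<bar>Im z\<bar> < u / 4}"
  proof -
    have "(\<lambda>z. - (\<i> * z)) ` {z. \<bar>Im z\<bar> < u / 4} \<subseteq> {s. \<bar>Re s\<bar> < u / 4}" by auto
    moreover have "(\<lambda>z. - (\<i> * z)) holomorphic_on {z. \<bar>Im z\<bar> < u / 4}" by (intro holomorphic_intros)
    ultimately show ?thesis using holomorphic_on_compose_gen[OF _ Hhol] by (simp add: o_def)
  qed
  moreover have "H (- (\<i> * of_real t)) = of_real (theta_ft u t)" for t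
    unfolding H_def theta_ft_complex(2)[symmetric]
    by (intro Bochner_Integration.integral_cong refl) (simp add: mult_ac)
  ultimately show ?thesis using that by blast
qed

end

section \<open>Convolution and strict positivity\<close>

text \<open>In \<open>f^(2 v) = f^v * f^v\<close> inversion replaces one factor by an integral of
  \<open>theta_ft v\<close>; Fubini and the cosine product formula do the rest. The two shifts
  contribute equally by evenness, so this is the convolution with constant
  \<open>1 / (2 * pi)\<close>.\<close>

lemma theta_ft_convolution:
  assumes v: "v > 0"
  shows "integrable lborel (\<lambda>x. theta_ft v x * (theta_ft v (t - x) + theta_ft v (t + x)))"
    and "theta_ft (2 * v) t = 1 / (4 * pi) * (\<integral>x. theta_ft v x * (theta_ft v (t - x) + theta_ft v (t + x)) \<partial>lborel)"
proof -
  note ft_bound = cos_transform_bound[OF theta_cf_powr_integrable[OF v], folded theta_ft_def]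
  note [measurable] = theta_ft_measurable[OF v]
  let ?g = "theta_ft v"
  define f where "f = (\<lambda>(x, r). ?g x * cos (r * x) * (theta_cf_powr v r * cos (t * r)))"
  have intf: "integrable (lborel \<Otimes>\<^sub>M lborel) f"
  proof (rule integrable_pair_bound[OF theta_ft_inversion(1)[OF v] theta_cf_powr_integrable[OF v]])
    show "f \<in> borel_measurable (borel \<Otimes>\<^sub>M borel)" unfolding f_def by measurable
    fix x y
    have "\<bar>f (x, y)\<bar> = \<bar>?g x\<bar> * \<bar>theta_cf_powr v y\<bar> * (\<bar>cos (y * x)\<bar> * \<bar>cos (t * y)\<bar>)" by (simp add: f_def abs_mult)
    also have "\<dots> \<le> \<bar>?g x\<bar> * \<bar>theta_cf_powr v y\<bar> * 1" by (intro mult_left_mono mult_le_one) auto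
    finally show "\<bar>f (x, y)\<bar> \<le> \<bar>?g x\<bar> * \<bar>theta_cf_powr v y\<bar>" by simp
  qed
  have i: "integrable lborel (\<lambda>r. theta_cf_powr v r * cos (t * r))" for t
    by (rule integrable_cos_mult[OF theta_cf_powr_integrable[OF v]])
  have inner: "(\<integral>r. f (x, r) \<partial>lborel) = ?g x / 2 * (?g (t - x) + ?g (t + x))" for x
  proof -
    have fe: "f (x, r) = ?g x / 2 * (theta_cf_powr v r * cos ((t - x) * r) + theta_cf_powr v r * cos ((t + x) * r))" for r
    proof -
      have c: "cos (t * r) * cos (r * x) = (cos ((t - x) * r) + cos ((t + x) * r)) / 2"
        unfolding cos_times_cos by (simp add: algebra_simps)
      have "f (x, r) = ?g x * theta_cf_powr v r * (cos (t * r) * cos (r * x))" by (simp add: f_def)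
      then show ?thesis unfolding c by (simp add: distrib_left)
    qed
    show ?thesis unfolding fe integral_mult_right_zero Bochner_Integration.integral_add[OF i i]
      by (simp add: theta_ft_def cos_transform_def)
  qed
  have "integrable lborel (\<lambda>x. \<integral>r. f (x, r) \<partial>lborel)" by (rule lborel_pair.integrable_fst'[OF intf])
  from integrable_mult_right[OF this, of 2]
  show "integrable lborel (\<lambda>x. ?g x * (?g (t - x) + ?g (t + x)))" unfolding inner by simp
  have "theta_ft (2 * v) t = (\<integral>r. theta_cf_powr v r * theta_cf_powr v r * cos (t * r) \<partial>lborel)"
    by (simp add: theta_ft_def cos_transform_def theta_cf_powr_def exp_add[symmetric] mult.assoc)
  also have "\<dots> = (\<integral>r. 1 / (2 * pi) * (\<integral>x. f (x, r) \<partial>lborel) \<partial>lborel)"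
  proof (rule Bochner_Integration.integral_cong[OF refl])
    fix r
    have "(\<integral>x. f (x, r) \<partial>lborel) = (\<integral>x. ?g x * cos (r * x) * (theta_cf_powr v r * cos (t * r)) \<partial>lborel)"
      by (simp add: f_def)
    also have "\<dots> = 2 * pi * theta_cf_powr v r * (theta_cf_powr v r * cos (t * r))"
      unfolding integral_mult_left_zero theta_ft_inversion(2)[OF v] ..
    finally show "theta_cf_powr v r * theta_cf_powr v r * cos (t * r) = 1 / (2 * pi) * (\<integral>x. f (x, r) \<partial>lborel)" by simp
  qed
  also have "\<dots> = 1 / (2 * pi) * (\<integral>x. (\<integral>r. f (x, r) \<partial>lborel) \<partial>lborel)"
    unfolding integral_mult_right_zero integral_swap[OF intf] ..
  also have "\<dots> = 1 / (4 * pi) * (\<integral>x. ?g x * (?g (t - x) + ?g (t + x)) \<partial>lborel)"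
    unfolding inner by simp
  finally show "theta_ft (2 * v) t = 1 / (4 * pi) * (\<integral>x. ?g x * (?g (t - x) + ?g (t + x)) \<partial>lborel)" .
qed

lemma theta_ft_pos:
  assumes u: "u > 0"
  shows "0 < theta_ft u t"
proof (rule ccontr)
  assume "\<not> 0 < theta_ft u t"
  define v where "v = u / 2"
  have v: "v > 0" and uv: "u = 2 * v" using u by (simp_all add: v_def)
  note nn = theta_ft_nonneg[OF v]
  note c = theta_ft_continuous[OF v]
  note conv = theta_ft_convolution[OF v, of t]
  let ?p = "\<lambda>x. theta_ft v x * (theta_ft v (t - x) + theta_ft v (t + x))"
  have p0: "0 \<le> ?p x" for x using nn by (intro mult_nonneg_nonneg add_nonneg_nonneg)
  have "(\<integral>x. ?p x \<partial>lborel) \<le> 0" using \<open>\<not> 0 < theta_ft u t\<close> unfolding uv conv(2) using pi_gt_zero by (auto simp: not_less divide_le_0_iff)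
  then have "(\<integral>x. ?p x \<partial>lborel) = 0" using p0 by (intro antisym integral_nonneg_AE) auto
  then have "AE x in lborel. ?p x = 0"
    using integral_nonneg_eq_0_iff_AE[OF conv(1)] p0 by simp
  moreover have "continuous_on UNIV ?p"
    by (intro continuous_intros continuous_on_compose2[OF c]) auto
  \<comment> \<open>A nonnegative integrand with integral 0 vanishes almost everywhere, and by
    continuity everywhere; nonnegativity of the two shifts then allows one of them to be
    dropped.\<close>
  ultimately have z: "?p x = 0" for x using continuous_AE_zero[of ?p] by blast
  have zero: "theta_ft v x = 0 \<or> theta_ft v (t - x) = 0" for x
    using z[of x] nn[of "t - x"] nn[of "t + x"] by auto
  have "isCont (theta_ft v) 0" using c by (simp add: continuous_on_eq_continuous_at)
  then have "\<forall>\<^sub>F x in at 0. 0 < theta_ft v x"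
    unfolding isCont_def by (rule order_tendstoD) (rule theta_ft_0_pos[OF v])
  then obtain d where d: "d > 0" "\<And>x. x \<noteq> 0 \<Longrightarrow> \<bar>x\<bar> < d \<Longrightarrow> 0 < theta_ft v x"
    by (auto simp: eventually_at dist_real_def)
  have z2: "theta_ft v (t - x) = 0" if "\<bar>x\<bar> < d" "x \<noteq> 0" for x using zero[of x] d(2)[of x] that by auto
  obtain G where G: "G holomorphic_on {z. \<bar>Im z\<bar> < v / 4}" "\<And>t. G (of_real t) = of_real (theta_ft v t)"
    using theta_ft_holomorphic[OF v] by blast
  define S where "S = {z. \<bar>Im z\<bar> < v / 4}"
  have S: "S = {z. Im z < v / 4} \<inter> {z. - (v / 4) < Im z}" by (auto simp: S_def)
  \<comment> \<open>Near \<open>x = 0\<close> the factor \<open>theta_ft v x\<close> is positive, so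
    \<open>theta_ft v\<close> vanishes on a punctured neighbourhood of \<open>t\<close>. The
    identity theorem carries this along the strip to 0, against
    \<open>theta_ft v 0 > 0\<close>.\<close>
  have "G (of_real 0) = 0"
  proof (rule analytic_continuation[of G S "of_real ` (\<lambda>x. t - x) ` {0<..<d}" "of_real t"])
    show "open S" unfolding S by (intro open_Int open_halfspace_Im_lt open_halfspace_Im_gt)
    show "connected S" unfolding S
      by (intro convex_connected convex_Int convex_halfspace_Im_lt convex_halfspace_Im_gt)
    show "complex_of_real t islimpt complex_of_real ` (\<lambda>x. t - x) ` {0<..<d}"
    proof (rule islimptI)
      fix T assume T: "complex_of_real t \<in> T" "open T"
      then obtain e where e: "e > 0" "ball (complex_of_real t) e \<subseteq> T" using openE by blast
      define x where "x = min d e / 2"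
      have x: "0 < x" "x < d" "x < e" using d(1) e(1) by (auto simp: x_def)
      have tT: "complex_of_real (t - x) \<in> T"
        using e(2) x by (intro subsetD[OF e(2)]) (simp add: dist_norm)
      show "\<exists>y\<in>complex_of_real ` (\<lambda>x. t - x) ` {0<..<d}. y \<in> T \<and> y \<noteq> complex_of_real t"
      proof (rule bexI)
        show "complex_of_real (t - x) \<in> complex_of_real ` (\<lambda>x. t - x) ` {0<..<d}"
          using x by (intro imageI) auto
        show "complex_of_real (t - x) \<in> T \<and> complex_of_real (t - x) \<noteq> complex_of_real t"
          using x tT by simp
      qed
    qed
    fix z assume "z \<in> complex_of_real ` (\<lambda>x. t - x) ` {0<..<d}"
    then obtain x where x: "0 < x" "x < d" and z: "z = of_real (t - x)" by auto
    show "G z = 0" unfolding z G(2) using z2[of x] x by simp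
  qed (use G v in \<open>auto simp: S_def\<close>)
  then show False using G(2)[of 0] theta_ft_0_pos[OF v] by simp
qed

text \<open>The real part \<open>- u / 2\<close> of \<open>s\<close> is the symmetric choice:
  \<open>- u * log_theta r - u / 2 * r\<close> equals
  \<open>- u * (log_theta 0 + theta_exponent r)\<close>, whose dependence on \<open>r\<close> is
  even.\<close>

lemma Z_Q_theta_ft:
  assumes u: "u > 0"
  shows "Z_Q (- of_real u) (- of_real u / 2 + \<i> * of_real t) = of_real (theta 1 powr (- u)) *
    (CLINT r|lborel. complex_of_real (theta_cf_powr u r) * exp (- \<i> * of_real (r * t)))"
proof -
  have e: "exp (- of_real u * of_real (log_theta r) + (- of_real u - (- of_real u / 2 + \<i> * of_real t)) * of_real r) =
      complex_of_real (theta 1 powr (- u)) * (complex_of_real (theta_cf_powr u r) * exp (- \<i> * of_real (r * t)))" for r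
  proof -
    have a: "- u * log_theta r - u / 2 * r = - u * log_theta 0 + - u * theta_exponent r"
      by (simp add: theta_exponent_def algebra_simps)
    have "theta 1 powr (- u) = exp (- u * log_theta 0)"
      using theta_ge_1[of 1] by (simp add: powr_def log_theta_def)
    then have b: "theta 1 powr (- u) * theta_cf_powr u r = exp (- u * log_theta r - u / 2 * r)"
      by (simp only: a exp_add theta_cf_powr_def)
    have "- of_real u * of_real (log_theta r) + (- of_real u - (- of_real u / 2 + \<i> * of_real t)) * of_real r =
        complex_of_real (- u * log_theta r - u / 2 * r) + - \<i> * of_real (r * t)"
      by (simp add: field_simps)
    then have "exp (- of_real u * of_real (log_theta r) + (- of_real u - (- of_real u / 2 + \<i> * of_real t)) * of_real r) =
      complex_of_real (exp (- u * log_theta r - u / 2 * r)) * exp (- \<i> * of_real (r * t))"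
      by (simp only: exp_add exp_of_real)
    then show ?thesis by (simp only: b[symmetric] of_real_mult mult.assoc)
  qed
  show ?thesis unfolding Z_Q_eq e by (rule integral_mult_right_zero)
qed

section \<open>Infinite divisibility and the second moment\<close>

lemma char_convolution:
  assumes "real_distribution M" "real_distribution N"
  shows "real_distribution (convolution M N)" "char (convolution M N) t = char M t * char N t"
proof -
  interpret M: real_distribution M by fact
  interpret N: real_distribution N by fact
  interpret P: pair_prob_space M N ..
  have [measurable]: "(\<lambda>(x, y). x + y) \<in> borel_measurable (M \<Otimes>\<^sub>M N)" by measurable
  have "prob_space (convolution M N)" unfolding convolution_def by (rule P.prob_space_distr) simp
  then interpret C: prob_space "convolution M N" .
  show "real_distribution (convolution M N)" by unfold_locales (simp add: convolution_def)
  have i: "integrable (M \<Otimes>\<^sub>M N) (\<lambda>z. exp (\<i> * of_real (t * (fst z + snd z))))"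
    by (rule P.integrable_const_bound[where B=1]) auto
  have "char (convolution M N) t = (CLINT z|(M \<Otimes>\<^sub>M N). exp (\<i> * of_real (t * (fst z + snd z))))"
    unfolding char_def convolution_def by (subst integral_distr) (auto simp: case_prod_beta)
  also have "\<dots> = (CLINT x|M. CLINT y|N. exp (\<i> * of_real (t * (x + y))))"
    using P.integral_fst'[OF i] by simp
  also have "\<dots> = (CLINT x|M. exp (\<i> * of_real (t * x)) * char N t)"
    unfolding char_def by (intro Bochner_Integration.integral_cong refl)
      (simp add: distrib_left exp_add)
  also have "\<dots> = char M t * char N t" by (simp add: char_def)
  finally show "char (convolution M N) t = char M t * char N t" .
qed

lemma char_convolution_power:
  assumes "real_distribution Q"
  shows "real_distribution (convolution_power Q n) \<and> char (convolution_power Q n) t = char Q t ^ n"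
proof (induction n)
  case 0
  have "prob_space (return borel (0::real))" by (rule prob_space_return) simp
  then interpret prob_space "return borel (0::real)" .
  have "real_distribution (return borel (0::real))" by unfold_locales simp
  moreover have "char (return borel 0) t = 1" unfolding char_def by (subst integral_return) auto
  ultimately show ?case by simp
next
  case (Suc n)
  then show ?case using char_convolution[OF assms, of "convolution_power Q n"] by simp
qed

text \<open>The \<open>n\<close>-th convolution root is the law with exponent \<open>1 / n\<close>:
  its characteristic function has \<open>n\<close>-th power \<open>f\<close>, and characteristic
  functions determine distributions.\<close>

lemma infinitely_divisible_theta: "infinitely_divisible (theta_distribution 1)"
  unfolding infinitely_divisible_def
proof (intro conjI allI impI)
  show P: "real_distribution (theta_distribution 1)" by (rule real_distribution_theta) simp
  fix n :: nat assume n: "n \<ge> 1"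
  then have n0: "1 / real n > 0" by simp
  define Q where "Q = theta_distribution (1 / real n)"
  have Q: "real_distribution Q" unfolding Q_def by (rule real_distribution_theta[OF n0])
  have "theta_distribution 1 = convolution_power Q n"
  proof (rule Levy_uniqueness[OF P])
    show "real_distribution (convolution_power Q n)" using char_convolution_power[OF Q] by blast
    show "char (theta_distribution 1) = char (convolution_power Q n)"
    proof
      fix t
      have "theta_cf_powr (1 / real n) t ^ n = theta_cf_powr 1 t"
        using n by (simp add: theta_cf_powr_def exp_of_nat_mult[symmetric])
      then show "char (theta_distribution 1) t = char (convolution_power Q n) t"
        using char_convolution_power[OF Q, of n t] unfolding Q_def
        by (simp add: char_theta_distribution[OF n0] char_theta_distribution[OF zero_less_one] flip: of_real_power)
    qed
  qed
  with Q show "\<exists>Q. real_distribution Q \<and> theta_distribution 1 = convolution_power Q n" by blast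
qed

text \<open>\<open>1 - f(a) = 1 - exp (- \<phi>(a)) \<le> \<phi>(a) \<le> C * a^2\<close> for small
  \<open>a\<close>, which is the hypothesis of the Fatou argument.\<close>

lemma theta_distribution_second_moment: "integrable (theta_distribution 1) (\<lambda>x. x\<^sup>2)"
proof -
  interpret real_distribution "theta_distribution 1" by (rule real_distribution_theta) simp
  obtain C where C: "C \<ge> 0" "\<And>v. \<bar>v\<bar> \<le> 1 \<Longrightarrow> theta_exponent v \<le> C * v\<^sup>2" using theta_exponent_quadratic by blast
  have "(\<integral>\<^sup>+x. ennreal (x\<^sup>2) \<partial>theta_distribution 1) \<le> ennreal (2 * C)"
  proof (rule second_moment_fatou)
    fix a :: real assume a: "0 < a" "a \<le> 1"
    have ic: "integrable (theta_distribution 1) (\<lambda>x. cos (a * x))" by (rule integrable_const_bound[where B=1]) auto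
    have "integrable (theta_distribution 1) (\<lambda>x. exp (\<i> * of_real (a * x)))" by (rule integrable_const_bound[where B=1]) auto
    then have "Re (char (theta_distribution 1) a) = (\<integral>x. cos (a * x) \<partial>theta_distribution 1)"
      unfolding char_def by (subst integral_Re[symmetric]) (auto simp: Re_exp)
    then have co: "(\<integral>x. cos (a * x) \<partial>theta_distribution 1) = theta_cf_powr 1 a"
      by (simp add: char_theta_distribution[OF zero_less_one])
    have "(\<integral>\<^sup>+x. ennreal (1 - cos (a * x)) \<partial>theta_distribution 1) = ennreal (\<integral>x. 1 - cos (a * x) \<partial>theta_distribution 1)"
      using ic by (intro nn_integral_eq_integral) auto
    also have "(\<integral>x. 1 - cos (a * x) \<partial>theta_distribution 1) = 1 - theta_cf_powr 1 a"
      using ic prob_space by (simp add: co)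
    also have "1 - theta_cf_powr 1 a \<le> C * a\<^sup>2"
      using exp_ge_add_one_self[of "- theta_exponent a"] C(2)[of a] a by (simp add: theta_cf_powr_def)
    finally show "(\<integral>\<^sup>+x. ennreal (1 - cos (a * x)) \<partial>theta_distribution 1) \<le> ennreal (C * a\<^sup>2)"
      by (simp add: ennreal_leI)
  qed simp
  then have "(\<integral>\<^sup>+x. ennreal (norm (x\<^sup>2)) \<partial>theta_distribution 1) < \<infinity>"
    using ennreal_less_top[of "2 * C"] by (simp add: order_le_less_trans)
  then show ?thesis by (intro integrableI_bounded) auto
qed

section \<open>The Feller and Khintchine canonical measures\<close>

text \<open>The compensator \<open>r * sin x\<close> differs from \<open>r * x\<close> by at most
  \<open>2 * \<bar>r\<bar> * x^2\<close>, so the numerator is the second-order Taylor remainder of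
  the exponential plus a term of the same order. Boundedness makes the kernel integrable against the
  integrable density.\<close>

lemma feller_kernel_bound: "norm (feller_kernel r x) \<le> r\<^sup>2 + 2 * \<bar>r\<bar>"
proof (cases "x = 0")
  case False
  define y where "y = r * x"
  have 1: "norm (exp (\<i> * of_real y) - 1 - \<i> * of_real y) \<le> y\<^sup>2 / 2"
    using iexp_approx1[of y 1] by (simp add: power2_eq_square numeral_2_eq_2 diff_diff_eq)
  have 2: "\<bar>sin x - x\<bar> \<le> 2 * x\<^sup>2"
  proof (cases "\<bar>x\<bar> \<le> 1")
    case True
    have "\<bar>sin x - (\<Sum>m<2. sin_coeff m * x ^ m)\<bar> \<le> inverse (fact 2) * \<bar>x\<bar> ^ 2" by (rule Maclaurin_sin_bound)
    then have h: "\<bar>sin x - x\<bar> * 2 \<le> x\<^sup>2" by (simp add: sin_coeff_def numeral_2_eq_2 power2_eq_square)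
    have "\<bar>sin x - x\<bar> \<le> \<bar>sin x - x\<bar> * 2" by simp
    also note h
    also have "x\<^sup>2 \<le> 2 * x\<^sup>2" by simp
    finally show ?thesis .
  next
    case False
    have "\<bar>sin x - x\<bar> \<le> \<bar>sin x\<bar> + \<bar>x\<bar>" by simp
    also have "\<dots> \<le> 2 * \<bar>x\<bar>" using False abs_sin_le_one[of x] by linarith
    also have "\<dots> \<le> 2 * (\<bar>x\<bar> * \<bar>x\<bar>)" using mult_right_mono[of 1 "\<bar>x\<bar>" "\<bar>x\<bar>"] False by simp
    finally show ?thesis by (simp add: power2_eq_square)
  qed
  have eq: "exp (\<i> * of_real y) - 1 - \<i> * of_real (r * sin x) = (exp (\<i> * of_real y) - 1 - \<i> * of_real y) - \<i> * of_real (r * (sin x - x))"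
    by (simp add: y_def algebra_simps)
  have "norm (\<i> * of_real (r * (sin x - x)) :: complex) = \<bar>r\<bar> * \<bar>sin x - x\<bar>"
    by (simp only: norm_mult norm_ii norm_of_real abs_mult mult_1_left)
  also have "\<dots> \<le> \<bar>r\<bar> * (2 * x\<^sup>2)" using 2 by (rule mult_left_mono) simp
  finally have 3: "norm (\<i> * of_real (r * (sin x - x)) :: complex) \<le> \<bar>r\<bar> * (2 * x\<^sup>2)" .
  have "norm (exp (\<i> * of_real y) - 1 - \<i> * of_real (r * sin x)) \<le> y\<^sup>2 / 2 + \<bar>r\<bar> * (2 * x\<^sup>2)"
    unfolding eq by (rule order_trans[OF norm_triangle_ineq4 add_mono[OF 1 3]])
  also have "\<dots> \<le> (r\<^sup>2 + 2 * \<bar>r\<bar>) * x\<^sup>2" by (simp add: y_def power_mult_distrib algebra_simps)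
  finally have "norm (exp (\<i> * of_real (r * x)) - 1 - \<i> * of_real (r * sin x)) \<le> (r\<^sup>2 + 2 * \<bar>r\<bar>) * x\<^sup>2" by (simp add: y_def)
  then show ?thesis using False by (simp add: feller_kernel_def norm_divide norm_power divide_le_eq)
qed (simp add: feller_kernel_def norm_power norm_divide)

text \<open>Multiplied by the density, the real part of the kernel becomes
  \<open>- levy_kernel\<close>; the imaginary part is odd in \<open>x\<close> and integrates to
  0.\<close>

lemma feller_kernel_integral:
  "(CLINT x|density lborel (\<lambda>x. ennreal (theta_density x)). feller_kernel r x) = of_real (- theta_exponent r)"
proof -
  have [measurable]: "feller_kernel r \<in> borel_measurable borel" unfolding feller_kernel_def[abs_def] by measurable
  have c: "(CLINT x|density lborel (\<lambda>x. ennreal (theta_density x)). feller_kernel r x) =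
      (CLINT x|lborel. levy_density x *\<^sub>R feller_kernel r x)"
    unfolding theta_density_eq by (rule integral_density) (auto simp: levy_density_nonneg)
  have i: "integrable lborel (\<lambda>x. levy_density x *\<^sub>R feller_kernel r x)"
  proof (rule Bochner_Integration.integrable_bound[OF integrable_mult_right[OF levy_density_integrable, of "r\<^sup>2 + 2 * \<bar>r\<bar>"]])
    show "AE x in lborel. norm (levy_density x *\<^sub>R feller_kernel r x) \<le> norm ((r\<^sup>2 + 2 * \<bar>r\<bar>) * levy_density x)"
      using feller_kernel_bound[of r]
      by (intro AE_I2) (simp add: abs_mult levy_density_nonneg mult.commute[of _ "levy_density _"] mult_left_mono)
  qed measurable
  have fk: "Re (feller_kernel r x) = (cos (r * x) - 1) / x\<^sup>2" "Im (feller_kernel r x) = (sin (r * x) - r * sin x) / x\<^sup>2" if "x \<noteq> 0" for x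
    using that by (simp_all add: feller_kernel_def Re_exp Im_exp flip: of_real_power)
  have "Re (CLINT x|lborel. levy_density x *\<^sub>R feller_kernel r x) = (\<integral>x. - levy_kernel r x \<partial>lborel)"
    unfolding integral_Re[OF i, symmetric]
  proof (rule integral_cong_AE)
    show "AE x in lborel. Re (levy_density x *\<^sub>R feller_kernel r x) = - levy_kernel r x"
      using AE_neq_0_lborel by eventually_elim (simp add: fk levy_kernel_def diff_divide_distrib algebra_simps)
  qed measurable
  moreover have "Im (CLINT x|lborel. levy_density x *\<^sub>R feller_kernel r x) = 0"
  proof -
    define g where "g x = levy_density x * ((sin (r * x) - r * sin x) / x\<^sup>2)" for x
    have [measurable]: "g \<in> borel_measurable borel" unfolding g_def[abs_def] by measurable
    have "Im (CLINT x|lborel. levy_density x *\<^sub>R feller_kernel r x) = (\<integral>x. g x \<partial>lborel)"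
      unfolding integral_Im[OF i, symmetric]
    proof (rule integral_cong_AE)
      show "AE x in lborel. Im (levy_density x *\<^sub>R feller_kernel r x) = g x"
        using AE_neq_0_lborel by eventually_elim (simp add: fk g_def)
    qed measurable
    moreover have "(\<integral>x. g x \<partial>lborel) = 0"
    proof -
      have "g (- x) = - g x" for x
        unfolding g_def levy_density_uminus by (simp add: algebra_simps diff_divide_distrib)
      then have "(\<integral>x. - g x \<partial>lborel) = (\<integral>x. g x \<partial>lborel)"
        using integral_reflect_lborel[of g] by (simp only:)
      then show ?thesis by simp
    qed
    ultimately show ?thesis by (simp only:)
  qed
  ultimately show ?thesis unfolding c using theta_exponent_levy(2)[of r] by (simp add: complex_eq_iff)
qed

text \<open>The total mass is already finite, because \<open>levy_density\<close> is integrable; the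
  tail conditions follow from \<open>1 / y^2 \<le> 1 / x^2\<close>.\<close>

lemma canonical_measure_theta: "canonical_measure (density lborel (\<lambda>x. ennreal (theta_density x)))"
proof -
  let ?M = "density lborel (\<lambda>x. ennreal (theta_density x))"
  have fin: "(\<integral>\<^sup>+x. ennreal (levy_density x) \<partial>lborel) < \<infinity>"
    using nn_integral_eq_integral[OF levy_density_integrable] levy_density_nonneg by simp
  have "emeasure ?M {a..b} < \<infinity>" for a b
  proof -
    have "emeasure ?M {a..b} \<le> (\<integral>\<^sup>+x. ennreal (levy_density x) \<partial>lborel)"
      unfolding theta_density_eq by (subst emeasure_density) (auto intro!: nn_integral_mono simp: indicator_def)
    then show ?thesis using fin by (rule order_le_less_trans)
  qed
  moreover have tail: "(\<integral>\<^sup>+y\<in>A. ennreal (1 / y\<^sup>2) \<partial>?M) < \<infinity>" if x: "x > 0" and A: "A \<in> sets borel" "\<And>y. y \<in> A \<Longrightarrow> x \<le> \<bar>y\<bar>" for x A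
  proof -
    have [measurable]: "A \<in> sets borel" by fact
    have "(\<integral>\<^sup>+y\<in>A. ennreal (1 / y\<^sup>2) \<partial>?M) = (\<integral>\<^sup>+y. ennreal (levy_density y) * (ennreal (1 / y\<^sup>2) * indicator A y) \<partial>lborel)"
      unfolding theta_density_eq by (subst nn_integral_density) auto
    also have "\<dots> \<le> (\<integral>\<^sup>+y. ennreal (1 / x\<^sup>2) * ennreal (levy_density y) \<partial>lborel)"
    proof (rule nn_integral_mono)
      fix y
      show "ennreal (levy_density y) * (ennreal (1 / y\<^sup>2) * indicator A y) \<le> ennreal (1 / x\<^sup>2) * ennreal (levy_density y)"
      proof (cases "y \<in> A")
        case True
        have "x\<^sup>2 \<le> \<bar>y\<bar>\<^sup>2" using A(2)[OF True] x by (intro power_mono) auto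
        then have "1 / y\<^sup>2 \<le> 1 / x\<^sup>2" using x by (intro divide_left_mono) (auto simp: zero_less_mult_iff)
        then have "ennreal (1 / y\<^sup>2) \<le> ennreal (1 / x\<^sup>2)" by (rule ennreal_leI)
        then show ?thesis using True by (simp add: mult.commute mult_left_mono)
      qed simp
    qed
    also have "\<dots> = ennreal (1 / x\<^sup>2) * (\<integral>\<^sup>+y. ennreal (levy_density y) \<partial>lborel)" by (rule nn_integral_cmult) measurable
    also have "\<dots> < \<infinity>" using fin by (simp add: ennreal_mult_less_top)
    finally show ?thesis .
  qed
  moreover have "(\<integral>\<^sup>+y\<in>{x..}. ennreal (1 / y\<^sup>2) \<partial>?M) < \<infinity>" "(\<integral>\<^sup>+y\<in>{..-x}. ennreal (1 / y\<^sup>2) \<partial>?M) < \<infinity>"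
    if "x > 0" for x
    by (rule tail[OF that]; auto)+
  ultimately show ?thesis unfolding canonical_measure_def by simp
qed

lemma feller_canonical_measure_theta:
  "feller_canonical_measure (theta_distribution 1) (density lborel (\<lambda>x. ennreal (theta_density x)))"
  unfolding feller_canonical_measure_def
\<comment> \<open>The drift is \<open>b = 0\<close>, since the law is symmetric.\<close>
proof (intro conjI canonical_measure_theta exI[of _ 0] allI)
  fix r
  show "char (theta_distribution 1) r = exp (\<i> * of_real (0 * r) + (CLINT x|density lborel (\<lambda>x. ennreal (theta_density x)). feller_kernel r x))"
    unfolding feller_kernel_integral char_theta_distribution[OF zero_less_one]
    by (simp add: theta_cf_powr_def exp_of_real[symmetric])
qed

lemma khintchine_canonical_measure_theta:
  "khintchine_canonical_measure (theta_distribution 1) (density lborel (\<lambda>x. ennreal (1 / (1 + x\<^sup>2) * theta_density x)))"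
  unfolding khintchine_canonical_measure_def
proof (intro exI conjI)
  show "feller_canonical_measure (theta_distribution 1) (density lborel (\<lambda>x. ennreal (theta_density x)))"
    by (rule feller_canonical_measure_theta)
  have "density (density lborel (\<lambda>x. ennreal (theta_density x))) (\<lambda>x. ennreal (1 / (1 + x\<^sup>2))) =
     density lborel (\<lambda>x. ennreal (theta_density x) * ennreal (1 / (1 + x\<^sup>2)))"
    unfolding theta_density_eq by (rule density_density_eq) measurable
  also have "(\<lambda>x. ennreal (theta_density x) * ennreal (1 / (1 + x\<^sup>2))) = (\<lambda>x. ennreal (1 / (1 + x\<^sup>2) * theta_density x))"
    unfolding theta_density_eq by (simp add: fun_eq_iff ennreal_mult[symmetric] levy_density_nonneg mult.commute)
  finally show "density lborel (\<lambda>x. ennreal (1 / (1 + x\<^sup>2) * theta_density x)) =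
    density (density lborel (\<lambda>x. ennreal (theta_density x))) (\<lambda>x. ennreal (1 / (1 + x\<^sup>2)))" ..
qed

lemma theta_cf_formulas:
  shows "theta_cf r = theta 1 / sqrt (theta (exp (- 2 * r)) * theta (exp (2 * r)))"
    and "theta_cf r = theta 1 * exp (- r / 2) / theta (exp (2 * r))"
proof -
  define T where "T = theta (exp (2 * r))"
  have T: "T \<ge> 1" using theta_ge_1[of "exp (2 * r)"] by (simp add: T_def)
  have neg: "theta (exp (- 2 * r)) = exp r * T" using theta_exp_neg[of r] by (simp add: T_def)
  have er: "exp r = exp (r / 2) * exp (r / 2)" by (simp add: exp_add[symmetric])
  have "exp r * T * T = (exp (r / 2) * T)\<^sup>2" unfolding er by (simp add: power2_eq_square)
  then have sq: "sqrt (exp r * T * T) = exp (r / 2) * T" using T by simp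
  have "theta_cf r = theta 1 / (exp (r / 2) * T)"
    unfolding theta_cf_def neg er by simp
  then show "theta_cf r = theta 1 / sqrt (theta (exp (- 2 * r)) * theta (exp (2 * r)))"
    and "theta_cf r = theta 1 * exp (- r / 2) / theta (exp (2 * r))"
    unfolding neg T_def[symmetric] sq by (simp_all add: exp_minus field_simps)
qed

theorem theorem1p2:
  fixes u :: real
  assumes "u > 0"
  shows
    "(\<forall>t::real.
        integrable lborel
          (\<lambda>r. complex_of_real (theta_cf r powr u) * exp (- \<i> * of_real (r * t))) \<and>
        Z_Q (- of_real u) (- of_real u / 2 + \<i> * of_real t) =
          of_real (theta 1 powr (- u)) *
            (CLINT r|lborel. complex_of_real (theta_cf r powr u) * exp (- \<i> * of_real (r * t))))
     \<and> (\<forall>r::real.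
          theta_cf r = theta 1 / sqrt (theta (exp (- 2 * r)) * theta (exp (2 * r))) \<and>
          theta_cf r = theta 1 * exp (- r / 2) / theta (exp (2 * r)) \<and>
          summable (\<lambda>n. exp (- pi * (real (Suc n))\<^sup>2 * exp (- 2 * r))) \<and>
          theta (exp (- 2 * r)) = 1 + 2 * (\<Sum>n. exp (- pi * (real (Suc n))\<^sup>2 * exp (- 2 * r))))
     \<and> (\<exists>P. real_distribution P \<and>
          (\<forall>r. char P r = of_real (theta_cf r)) \<and>
          infinitely_divisible P \<and>
          integrable P (\<lambda>x. x\<^sup>2) \<and>
          feller_canonical_measure P (density lborel (\<lambda>x. ennreal (theta_density x))) \<and>
          khintchine_canonical_measure P
            (density lborel (\<lambda>x. ennreal (1 / (1 + x\<^sup>2) * theta_density x))))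
     \<and> (\<forall>x::real. complex_of_real (theta_density x) = 1 / of_real pi * xi_Q 0 (\<i> * of_real x))
     \<and> (\<forall>t::real.
          Z_Q (- of_real u) (- of_real u / 2 + \<i> * of_real t) \<in> \<real> \<and>
          Re (Z_Q (- of_real u) (- of_real u / 2 + \<i> * of_real t)) > 0)"
proof (intro conjI allI)
  fix t r x :: real
  show "integrable lborel (\<lambda>r. complex_of_real (theta_cf r powr u) * exp (- \<i> * of_real (r * t)))"
    unfolding theta_cf_powr_eq by (rule theta_ft_complex(1)[OF assms])
  show "Z_Q (- of_real u) (- of_real u / 2 + \<i> * of_real t) = of_real (theta 1 powr (- u)) *
      (CLINT r|lborel. complex_of_real (theta_cf r powr u) * exp (- \<i> * of_real (r * t)))"
    unfolding theta_cf_powr_eq by (rule Z_Q_theta_ft[OF assms])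
  \<comment> \<open>Reality and positivity both rest on this value: a positive constant times
    \<open>theta_ft u t\<close>.\<close>
  have Z: "Z_Q (- of_real u) (- of_real u / 2 + \<i> * of_real t) = of_real (theta 1 powr (- u) * theta_ft u t)"
    by (simp only: Z_Q_theta_ft[OF assms] theta_ft_complex(2)[OF assms] of_real_mult[of "theta 1 powr (- u)"])
  show "Z_Q (- of_real u) (- of_real u / 2 + \<i> * of_real t) \<in> \<real>"
    unfolding Z by simp
  show "Re (Z_Q (- of_real u) (- of_real u / 2 + \<i> * of_real t)) > 0"
    unfolding Z using theta_ft_pos[OF assms, of t] theta_ge_1[of 1] by simp
  show "theta_cf r = theta 1 / sqrt (theta (exp (- 2 * r)) * theta (exp (2 * r)))"
    "theta_cf r = theta 1 * exp (- r / 2) / theta (exp (2 * r))"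
    by (rule theta_cf_formulas)+
  show "summable (\<lambda>n. exp (- pi * (real (Suc n))\<^sup>2 * exp (- 2 * r)))"
    by (rule summable_theta) simp
  show "theta (exp (- 2 * r)) = 1 + 2 * (\<Sum>n. exp (- pi * (real (Suc n))\<^sup>2 * exp (- 2 * r)))"
    by (rule theta_eq) simp
  show "complex_of_real (theta_density x) = 1 / of_real pi * xi_Q 0 (\<i> * of_real x)"
    unfolding theta_density_eq xi_Q_levy_density by simp
next
  show "\<exists>P. real_distribution P \<and>
          (\<forall>r. char P r = of_real (theta_cf r)) \<and>
          infinitely_divisible P \<and>
          integrable P (\<lambda>x. x\<^sup>2) \<and>
          feller_canonical_measure P (density lborel (\<lambda>x. ennreal (theta_density x))) \<and>
          khintchine_canonical_measure P
            (density lborel (\<lambda>x. ennreal (1 / (1 + x\<^sup>2) * theta_density x)))"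
    \<comment> \<open>The law of \<open>f\<close> itself is the member with exponent 1, whatever the
      given \<open>u\<close>.\<close>
    using real_distribution_theta[OF zero_less_one] infinitely_divisible_theta theta_distribution_second_moment
      feller_canonical_measure_theta khintchine_canonical_measure_theta char_theta_distribution[OF zero_less_one]
    by (intro exI[of _ "theta_distribution 1"]) (simp add: theta_cf_eq theta_cf_powr_def)
qed

end
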